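(* Let $N\ge 2$, $1\le p\le\infty$ and $\alpha\in\mathbb{R}$. There exists $C>0$ such that $$\bigl\||x|^\alpha\Delta u\bigr\|_p\ \ge\ C\,\bigl\||x|^{\alpha-2}u\bigr\|_p\qquad\text{for every }u\in C_c^\infty(\mathbb{R}^N\setminus\{0\})$$ if and only if $\alpha\ne\frac N{p'}+n$ and $\alpha\ne-\frac Np+2-n$ for every $n\in\mathbb{N}_0$. Moreover, if $N\ge 3$ and $2-\frac Np<\alpha<\frac N{p'}$, the best constant is $C=\bigl(\frac Np-2+\alpha\bigr)\bigl(\frac N{p'}-\alpha\bigr)$.
   Context: Norms are $L^p(\mathbb{R}^N)$ norms (sup norm for $p=\infty$). $p'=p/(p-1)$ with the conventions $1/\infty=0$, $p'=\infty$ for $p=1$, $p'=1$ for $p=\infty$. $\mathbb{N}_0=\{0,1,2,\dots\}$. *)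

theory Defs
  imports "HOL-Analysis.Analysis" "HOL-Probability.Essential_Supremum"
begin

definition pdiff :: "'n::finite \<Rightarrow> (real^'n \<Rightarrow> real) \<Rightarrow> real^'n \<Rightarrow> real" where
  "pdiff i f x = deriv (\<lambda>t. f (x + t *\<^sub>R axis i 1)) 0"

fun iter_pdiff :: "'n::finite list \<Rightarrow> (real^'n \<Rightarrow> real) \<Rightarrow> real^'n \<Rightarrow> real" where
  "iter_pdiff [] f = f"
| "iter_pdiff (i # is) f = pdiff i (iter_pdiff is f)"

definition smooth_fun :: "(real^'n::finite \<Rightarrow> real) \<Rightarrow> bool" where
  "smooth_fun f \<longleftrightarrow>
     (\<forall>is. continuous_on UNIV (iter_pdiff is f) \<and>
       (\<forall>i x. (\<lambda>t. iter_pdiff is f (x + t *\<^sub>R axis i 1)) differentiable (at 0)))"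

definition test_fun :: "(real^'n::finite \<Rightarrow> real) \<Rightarrow> bool" where
  "test_fun u \<longleftrightarrow> smooth_fun u \<and> compact (closure {x. u x \<noteq> 0})
                    \<and> 0 \<notin> closure {x. u x \<noteq> 0}"

definition laplacian :: "(real^'n::finite \<Rightarrow> real) \<Rightarrow> real^'n \<Rightarrow> real" where
  "laplacian u x = (\<Sum>i\<in>UNIV. pdiff i (pdiff i u) x)"

definition inv_exp :: "ennreal \<Rightarrow> real" where
  "inv_exp p = (if p = top then 0 else 1 / enn2real p)"

definition Lp_norm :: "ennreal \<Rightarrow> (real^'n::finite \<Rightarrow> real) \<Rightarrow> real" where
  "Lp_norm p f =
     (if p = top then real_of_ereal (esssup lborel (\<lambda>x. ereal \<bar>f x\<bar>))
      else (\<integral>x. \<bar>f x\<bar> powr enn2real p \<partial>lborel) powr (1 / enn2real p))"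

end

theory Submission
  imports Defs
begin

text \<open>
Let \<open>\<Gamma>\<close> be the Newtonian kernel and \<open>\<Gamma>(x - y) = \<Sum> T_n(x, y)\<close> its expansion for \<open>|y| < |x|\<close>,
where \<open>T_n\<close> is homogeneous of degree \<open>n\<close> in \<open>y\<close>. For a test function \<open>u\<close> one has
\<open>c u = \<Gamma> * \<Delta>u\<close>. Since \<open>u(x/t) = 0\<close> and \<open>u(tx) = 0\<close> for small \<open>t > 0\<close>, the integrals of \<open>\<Delta>u\<close>
against \<open>T_n(x, \<sqdot>)\<close> and against \<open>T_n(\<sqdot>, x)\<close> all vanish, so finitely many \<open>T_n\<close> may be subtracted from the kernel.
The number of subtracted terms can be chosen so that the Schur test with power weights applies exactly
when \<open>\<alpha>\<close> avoids the exceptional values. In the range where nothing is subtracted the kernel has one sign and the Schur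
constant is computed by inserting truncations of \<open>|x|^(2 - \<beta>)\<close>, \<open>\<beta> = \<alpha> + N/p\<close>, into the representation.

Conversely, for a harmonic polynomial \<open>P\<close> of degree \<open>n\<close> one has
\<open>\<Delta>(|x|^(z-n) P) = (z - n)(z + n + N - 2) |x|^(z-n-2) P\<close>; with \<open>z = 2 - \<alpha> - N/p\<close> and a slow cutoff in \<open>ln |x|\<close>
the quotient of the two norms tends to \<open>|(z - n)(z + n + N - 2)|\<close>, which is 0 for exceptional \<open>\<alpha>\<close>
and the asserted constant for \<open>n = 0\<close>.
\<close>

section \<open>Partial derivatives and smooth functions\<close>

text \<open>Only \<open>\<beta> = \<alpha> + N/p\<close> enters. The Schur test integrates the
  kernel against \<open>|y|^(-\<beta>)\<close>, which converges if its order in \<open>y\<close> is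
  greater than \<open>\<mu> = \<beta> - N\<close> at 0 and less than \<mu> at infinity. Subtracting
  the terms up to \<open>m\<close> raises the order at 0 to \<open>m + 1\<close>, but these terms
  themselves grow like \<open>|y|^m\<close>, so the admissible window is
  \<open>m < \<mu> < m + 1\<close>. The expansion in the other variable gives the mirror windows
  \<open>1 - N - m < \<mu> < 2 - N - m\<close>, and the plain kernel gives
  \<open>2 - N < \<mu> < 0\<close>. Together the windows miss exactly the exceptional values.

  Dimension 2 is the obstacle: the kernel is logarithmic, hence not homogeneous and of no fixed
  sign, and the middle window is empty. The logarithm is split off and its moment treated
  separately, and the growth at infinity becomes \<open>m + \<delta>\<close> with small \<delta>.

  Conversely, \<open>|x|^(z-n) P\<close> is the borderline case in which the weighted p-th power is
  homogeneous of degree -N. Its mass grows linearly with the logarithmic width \<open>K\<close>,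
  while the error due to the cutoff is of relative size \<open>1/K\<close>.\<close>

definition has_pd :: "'n::finite \<Rightarrow> (real^'n \<Rightarrow> real) \<Rightarrow> (real^'n \<Rightarrow> real) \<Rightarrow> bool" where
  "has_pd i f g \<longleftrightarrow> (\<forall>x. ((\<lambda>t. f (x + t *\<^sub>R axis i 1)) has_real_derivative g x) (at 0))"

lemma has_pdI:
  "(\<And>x. ((\<lambda>t. f (x + t *\<^sub>R axis i 1)) has_real_derivative g x) (at 0)) \<Longrightarrow> has_pd i f g"
  by (simp add: has_pd_def)

lemma has_pdD: "has_pd i f g \<Longrightarrow> ((\<lambda>t. f (x + t *\<^sub>R axis i 1)) has_real_derivative g x) (at 0)"
  by (simp add: has_pd_def)

lemma has_pd_at:
  assumes "has_pd i f g"
  shows "((\<lambda>t. f (x + t *\<^sub>R axis i 1)) has_real_derivative g (x + t *\<^sub>R axis i 1)) (at t)"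
proof -
  have "((\<lambda>s. f ((x + t *\<^sub>R axis i 1) + s *\<^sub>R axis i 1)) has_real_derivative g (x + t *\<^sub>R axis i 1)) (at 0)"
    by (rule has_pdD[OF assms])
  then have "((\<lambda>s. f (x + (s + t) *\<^sub>R axis i 1)) has_real_derivative g (x + t *\<^sub>R axis i 1)) (at 0)"
    by (simp add: algebra_simps)
  then show ?thesis
    using DERIV_shift[of "\<lambda>s. f (x + s *\<^sub>R axis i 1)" _ 0 t] by simp
qed

lemma has_pd_pdiff: "has_pd i f g \<Longrightarrow> pdiff i f = g"
  by (rule ext) (simp add: pdiff_def DERIV_imp_deriv has_pdD)

lemma has_pd_cong: "has_pd i f g \<Longrightarrow> (\<And>x. g x = h x) \<Longrightarrow> has_pd i f h"
  by (simp add: has_pd_def)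

lemma has_pd_const: "has_pd i (\<lambda>x. c) (\<lambda>x. 0)"
  by (simp add: has_pd_def)

lemma has_pd_add: "has_pd i f f' \<Longrightarrow> has_pd i g g' \<Longrightarrow> has_pd i (\<lambda>x. f x + g x) (\<lambda>x. f' x + g' x)"
  by (auto simp: has_pd_def intro!: DERIV_add)

lemma has_pd_diff: "has_pd i f f' \<Longrightarrow> has_pd i g g' \<Longrightarrow> has_pd i (\<lambda>x. f x - g x) (\<lambda>x. f' x - g' x)"
  by (auto simp: has_pd_def intro!: DERIV_diff)

lemma has_pd_mult:
  assumes "has_pd i f f'" "has_pd i g g'"
  shows "has_pd i (\<lambda>x. f x * g x) (\<lambda>x. f' x * g x + f x * g' x)"
proof (rule has_pdI)
  fix x
  show "((\<lambda>t. f (x + t *\<^sub>R axis i 1) * g (x + t *\<^sub>R axis i 1)) has_real_derivative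
    f' x * g x + f x * g' x) (at 0)"
    using DERIV_mult[OF has_pdD[OF assms(1), of x] has_pdD[OF assms(2), of x]]
    by (simp add: mult_ac add_ac)
qed

lemma has_pd_compose:
  assumes "has_pd i f f'" "\<And>x. (g has_real_derivative g' (f x)) (at (f x))"
  shows "has_pd i (\<lambda>x. g (f x)) (\<lambda>x. g' (f x) * f' x)"
proof (rule has_pdI)
  fix x
  show "((\<lambda>t. g (f (x + t *\<^sub>R axis i 1))) has_real_derivative g' (f x) * f' x) (at 0)"
    using DERIV_chain2[OF assms(2) has_pdD[OF assms(1), of x]] by simp
qed

lemma has_pd_component: "has_pd i (\<lambda>x. x $ j) (\<lambda>x. if i = j then 1 else 0)"
  for i j :: "'n::finite"
proof (rule has_pdI)
  fix x :: "real^'n"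
  have eq: "(x + t *\<^sub>R axis i 1) $ j = x $ j + t * (if i = j then 1 else 0)" for t :: real
    by (auto simp: axis_def)
  show "((\<lambda>t. (x + t *\<^sub>R axis i 1) $ j) has_real_derivative (if i = j then 1 else 0)) (at 0)"
    unfolding eq by (rule derivative_eq_intros refl | simp)+
qed

lemma has_pd_norm_sq: "has_pd i (\<lambda>x. (norm (x - a))\<^sup>2) (\<lambda>x. 2 * (x - a) $ i)"
  for a :: "real^'n::finite"
proof (rule has_pdI)
  fix x :: "real^'n"
  have eq: "(norm (x + t *\<^sub>R axis i 1 - a))\<^sup>2 = (norm (x - a))\<^sup>2 + 2 * t * (x - a) $ i + t\<^sup>2" for t
  proof -
    have "x + t *\<^sub>R axis i 1 - a = (x - a) + t *\<^sub>R axis i 1" by simp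
    moreover have "(norm (y + t *\<^sub>R axis i 1))\<^sup>2 = (norm y)\<^sup>2 + 2 * t * y $ i + t\<^sup>2" for y :: "real^'n"
      unfolding power2_norm_eq_inner
      by (simp add: inner_add_left inner_add_right inner_axis inner_axis' power2_eq_square algebra_simps)
    ultimately show ?thesis by (simp only: vector_minus_component)
  qed
  show "((\<lambda>t. (norm (x + t *\<^sub>R axis i 1 - a))\<^sup>2) has_real_derivative 2 * (x - a) $ i) (at 0)"
    unfolding eq by (auto intro!: derivative_eq_intros)
qed

text \<open>Finite regularity with witnesses for the derivatives, because closure under products and
  compositions goes by induction on the order, while \<open>smooth_fun\<close> speaks of all
  iterated \<open>pdiff\<close> at once. Continuity is demanded at every order: partial derivatives
  alone do not give it in several variables, whereas \<open>Ck1\<close> gets it from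
  differentiability.\<close>

fun CkN :: "nat \<Rightarrow> (real^'n::finite \<Rightarrow> real) \<Rightarrow> bool" where
  "CkN 0 f = continuous_on UNIV f"
| "CkN (Suc n) f = (continuous_on UNIV f \<and> (\<forall>i. \<exists>g. has_pd i f g \<and> CkN n g))"

fun Ck1 :: "nat \<Rightarrow> (real \<Rightarrow> real) \<Rightarrow> bool" where
  "Ck1 0 f = continuous_on UNIV f"
| "Ck1 (Suc n) f = (\<exists>g. (\<forall>t. (f has_real_derivative g t) (at t)) \<and> Ck1 n g)"

lemma CkN_cont: "CkN n f \<Longrightarrow> continuous_on UNIV f"
  by (cases n) auto

lemma CkN_Suc: "CkN (Suc n) f \<Longrightarrow> CkN n f"
proof (induction n arbitrary: f)
  case 0
  then show ?case by simp
next
  case (Suc n)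
  show ?case unfolding CkN.simps(2)[of n]
  proof (intro conjI allI)
    show "continuous_on UNIV f" using Suc.prems by simp
    fix i
    obtain g where "has_pd i f g" "CkN (Suc n) g"
      using Suc.prems unfolding CkN.simps(2)[of "Suc n"] by blast
    then show "\<exists>g. has_pd i f g \<and> CkN n g" using Suc.IH by blast
  qed
qed

lemma Ck1_cont: "Ck1 n f \<Longrightarrow> continuous_on UNIV f"
proof (cases n)
  case (Suc m)
  moreover assume "Ck1 n f"
  ultimately obtain g where "\<And>t. (f has_real_derivative g t) (at t)" by auto
  then show ?thesis by (intro DERIV_continuous_on[where D = g]) auto
qed auto

lemma Ck1_Suc: "Ck1 (Suc n) f \<Longrightarrow> Ck1 n f"
proof (induction n arbitrary: f)
  case 0
  then show ?case by (metis Ck1.simps(1) Ck1_cont)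
next
  case (Suc n)
  then show ?case by (metis Ck1.simps(2))
qed

lemma Ck1_const: "Ck1 n (\<lambda>t. c)"
  by (induction n arbitrary: c) (auto intro!: exI[of _ "\<lambda>_. 0"])

lemma Ck1_add: "Ck1 n f \<Longrightarrow> Ck1 n g \<Longrightarrow> Ck1 n (\<lambda>t. f t + g t)"
proof (induction n arbitrary: f g)
  case (Suc n)
  then obtain f' g' where "\<And>t. (f has_real_derivative f' t) (at t)" "Ck1 n f'"
    "\<And>t. (g has_real_derivative g' t) (at t)" "Ck1 n g'" by auto
  then show ?case using Suc.IH[of f' g'] by (auto intro!: exI[of _ "\<lambda>t. f' t + g' t"] DERIV_add)
qed (auto intro: continuous_on_add continuous_on_mult continuous_on_component continuous_on_id)

lemma Ck1_mult: "Ck1 n f \<Longrightarrow> Ck1 n g \<Longrightarrow> Ck1 n (\<lambda>t. f t * g t)"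
proof (induction n arbitrary: f g)
  case (Suc n)
  then obtain f' g' where *: "\<And>t. (f has_real_derivative f' t) (at t)" "Ck1 n f'"
    "\<And>t. (g has_real_derivative g' t) (at t)" "Ck1 n g'" by auto
  have "Ck1 n (\<lambda>t. f' t * g t + f t * g' t)"
    using Suc.prems[THEN Ck1_Suc] * by (intro Ck1_add Suc.IH)
  moreover have "((\<lambda>t. f t * g t) has_real_derivative f' t * g t + f t * g' t) (at t)" for t
    using DERIV_mult[OF *(1,3)] by (simp add: mult_ac add_ac)
  ultimately show ?case by (auto intro!: exI[of _ "\<lambda>t. f' t * g t + f t * g' t"])
qed (auto intro: continuous_on_add continuous_on_mult continuous_on_component continuous_on_id)

lemma Ck1_compose: "Ck1 n f \<Longrightarrow> Ck1 n g \<Longrightarrow> Ck1 n (\<lambda>t. f (g t))"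
proof (induction n arbitrary: f g)
  case 0
  then show ?case using continuous_on_compose2[of UNIV f UNIV g] by simp
next
  case (Suc n)
  then obtain f' g' where *: "\<And>t. (f has_real_derivative f' t) (at t)" "Ck1 n f'"
    "\<And>t. (g has_real_derivative g' t) (at t)" "Ck1 n g'" by auto
  have "Ck1 n (\<lambda>t. f' (g t) * g' t)"
    by (rule Ck1_mult[OF Suc.IH[OF *(2) Suc.prems(2)[THEN Ck1_Suc]] *(4)])
  moreover have "((\<lambda>t. f (g t)) has_real_derivative f' (g t) * g' t) (at t)" for t
    using DERIV_chain2[OF *(1,3)] by simp
  ultimately show ?case by (auto intro!: exI[of _ "\<lambda>t. f' (g t) * g' t"])
qed

lemma Ck1_ident: "Ck1 n (\<lambda>t. t)"
proof (cases n)
  case (Suc m)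
  then show ?thesis using Ck1_const[of m 1] by (auto intro!: exI[of _ "\<lambda>_. 1"])
qed auto

lemma CkN_const: "CkN n (\<lambda>x. c)"
  by (induction n arbitrary: c) (auto intro!: exI[of _ "\<lambda>_. 0"] has_pd_const)

lemma CkN_add: "CkN n f \<Longrightarrow> CkN n g \<Longrightarrow> CkN n (\<lambda>t. f t + g t)"
proof (induction n arbitrary: f g)
  case (Suc n)
  have "\<exists>h. has_pd i (\<lambda>t. f t + g t) h \<and> CkN n h" for i
  proof -
    obtain f' g' where "has_pd i f f'" "CkN n f'" "has_pd i g g'" "CkN n g'"
      using Suc.prems by (auto dest!: spec[of _ i])
    then show ?thesis using Suc.IH[of f' g'] by (auto intro!: exI[of _ "\<lambda>t. f' t + g' t"] has_pd_add)
  qed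
  then show ?case using Suc.prems by (auto intro: continuous_on_add continuous_on_mult continuous_on_component continuous_on_id)
qed (auto intro: continuous_on_add continuous_on_mult continuous_on_component continuous_on_id)

lemma CkN_mult: "CkN n f \<Longrightarrow> CkN n g \<Longrightarrow> CkN n (\<lambda>t. f t * g t)"
proof (induction n arbitrary: f g)
  case (Suc n)
  have "\<exists>h. has_pd i (\<lambda>t. f t * g t) h \<and> CkN n h" for i
  proof -
    obtain f' g' where *: "has_pd i f f'" "CkN n f'" "has_pd i g g'" "CkN n g'"
      using Suc.prems by (auto dest!: spec[of _ i])
    have "CkN n (\<lambda>t. f' t * g t + f t * g' t)"
      using Suc.prems[THEN CkN_Suc] * by (intro CkN_add Suc.IH)
    then show ?thesis using has_pd_mult[OF *(1,3)] by blast
  qed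
  then show ?case using Suc.prems by (auto intro: continuous_on_add continuous_on_mult continuous_on_component continuous_on_id)
qed (auto intro: continuous_on_add continuous_on_mult continuous_on_component continuous_on_id)

lemma CkN_compose: "Ck1 n f \<Longrightarrow> CkN n g \<Longrightarrow> CkN n (\<lambda>t. f (g t))"
proof (induction n arbitrary: f g)
  case 0
  then show ?case using continuous_on_compose2[of UNIV f UNIV g] by simp
next
  case (Suc n)
  obtain f' where f': "\<And>t. (f has_real_derivative f' t) (at t)" "Ck1 n f'" using Suc.prems by auto
  have "\<exists>h. has_pd i (\<lambda>t. f (g t)) h \<and> CkN n h" for i
  proof -
    obtain g' where *: "has_pd i g g'" "CkN n g'"
      using Suc.prems by (auto dest!: spec[of _ i])
    have "CkN n (\<lambda>t. f' (g t) * g' t)"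
      by (rule CkN_mult[OF Suc.IH[OF f'(2) Suc.prems(2)[THEN CkN_Suc]] *(2)])
    then show ?thesis using has_pd_compose[OF *(1) f'(1)] by blast
  qed
  moreover have "continuous_on UNIV (\<lambda>t. f (g t))"
    using Suc.prems(1)[THEN Ck1_cont] Suc.prems(2)[THEN CkN_cont]
      continuous_on_compose2[of UNIV f UNIV g] by blast
  ultimately show ?case by auto
qed

lemma CkN_component: "CkN n (\<lambda>x. x $ j)"
proof (cases n)
  case (Suc m)
  have "\<exists>g. has_pd i (\<lambda>x. x $ j) g \<and> CkN m g" for i
    using has_pd_component[of i j] CkN_const[of m "if i = j then 1 else 0"] by blast
  then show ?thesis using Suc by (auto intro: continuous_on_add continuous_on_mult continuous_on_component continuous_on_id)
qed (auto intro: continuous_on_add continuous_on_mult continuous_on_component continuous_on_id)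

lemma CkN_sum: "finite A \<Longrightarrow> (\<And>a. a \<in> A \<Longrightarrow> CkN n (f a)) \<Longrightarrow> CkN n (\<lambda>x. \<Sum>a\<in>A. f a x)"
  by (induction A rule: finite_induct) (auto intro: CkN_const CkN_add)

lemma CkN_norm_sq: "CkN n (\<lambda>x :: real^'n::finite. (norm x)\<^sup>2)"
proof -
  have eq: "(norm x)\<^sup>2 = (\<Sum>i\<in>UNIV. x $ i * x $ i)" for x :: "real^'n"
    by (simp add: power2_norm_eq_inner inner_vec_def)
  show ?thesis unfolding eq by (intro CkN_sum CkN_mult CkN_component) auto
qed

lemma CkN_iter_pdiff: "CkN (n + length is) f \<Longrightarrow> CkN n (iter_pdiff is f)"
proof (induction "is" arbitrary: n)
  case (Cons i "is")
  then have "CkN (Suc n) (iter_pdiff is f)" by (simp del: CkN.simps)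
  then show ?case by (auto dest!: spec[of _ i] has_pd_pdiff)
qed auto

lemma CkN_smooth:
  assumes "\<And>n. CkN n f"
  shows "smooth_fun f"
  unfolding smooth_fun_def
proof (intro allI conjI)
  fix "is" :: "'a list" and i x
  have 1: "CkN 1 (iter_pdiff is f)" by (rule CkN_iter_pdiff) (rule assms)
  then show "continuous_on UNIV (iter_pdiff is f)" by (rule CkN_cont)
  obtain g where "has_pd i (iter_pdiff is f) g" using 1 by auto
  from has_pdD[OF this, of x]
  show "(\<lambda>t. iter_pdiff is f (x + t *\<^sub>R axis i 1)) differentiable (at 0)"
    using real_differentiable_def by blast
qed

lemma smooth_has_pd:
  assumes "smooth_fun f"
  shows "has_pd i (iter_pdiff is f) (pdiff i (iter_pdiff is f))" "continuous_on UNIV (iter_pdiff is f)"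
proof -
  have *: "continuous_on UNIV (iter_pdiff is f)"
    "\<And>x. (\<lambda>t. iter_pdiff is f (x + t *\<^sub>R axis i 1)) differentiable (at 0)"
    using assms unfolding smooth_fun_def by blast+
  show "continuous_on UNIV (iter_pdiff is f)" by (rule *)
  show "has_pd i (iter_pdiff is f) (pdiff i (iter_pdiff is f))"
    unfolding has_pd_def pdiff_def using *(2) DERIV_imp_deriv real_differentiable_def by metis
qed

section \<open>Integrals of powers of the norm\<close>

lemma nn_integral_lborel_affine:
  fixes f :: "'a::euclidean_space \<Rightarrow> ennreal"
  assumes [measurable]: "f \<in> borel_measurable borel" and c: "c \<noteq> 0"
  shows "(\<integral>\<^sup>+x. f x \<partial>lborel) = ennreal (\<bar>c\<bar> ^ DIM('a)) * (\<integral>\<^sup>+x. f (a + c *\<^sub>R x) \<partial>lborel)"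
proof -
  have "(\<integral>\<^sup>+x. f x \<partial>lborel) =
    (\<integral>\<^sup>+x. f x \<partial>density (distr lborel borel (\<lambda>x. a + c *\<^sub>R x)) (\<lambda>_. ennreal (\<bar>c\<bar> ^ DIM('a))))"
    using lborel_affine[OF c, of a] by simp
  also have "\<dots> = ennreal (\<bar>c\<bar> ^ DIM('a)) * (\<integral>\<^sup>+x. f (a + c *\<^sub>R x) \<partial>lborel)"
    by (simp add: nn_integral_density nn_integral_distr nn_integral_cmult)
  finally show ?thesis .
qed

lemma lborel_integral_affine:
  fixes f :: "'a::euclidean_space \<Rightarrow> real"
  assumes [measurable]: "f \<in> borel_measurable borel" and c: "c \<noteq> 0"
  shows "(\<integral>x. f x \<partial>lborel) = \<bar>c\<bar> ^ DIM('a) * (\<integral>x. f (a + c *\<^sub>R x) \<partial>lborel)"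
proof -
  have "(\<integral>x. f x \<partial>lborel) =
    (\<integral>x. f x \<partial>density (distr lborel borel (\<lambda>x. a + c *\<^sub>R x)) (\<lambda>_. ennreal (\<bar>c\<bar> ^ DIM('a))))"
    using lborel_affine[OF c, of a] by simp
  also have "\<dots> = \<bar>c\<bar> ^ DIM('a) * (\<integral>x. f (a + c *\<^sub>R x) \<partial>lborel)"
    by (simp add: integral_density integral_distr)
  finally show ?thesis .
qed

lemma emeasure_cball_less_top: "emeasure lborel (cball x r) < top" for x :: "'a::euclidean_space"
  using emeasure_bounded_finite[OF bounded_cball] by simp

text \<open>\<open>T\<close> is covered by the images of the annulus 1/2 \<le> |y| \<le> 2 under
  dilation by \<open>b^k\<close>. Each further dilation multiplies the integral by
  \<open>b powr (q + DIM('a))\<close>, so a geometric series bounds the whole without polar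
  coordinates. The choice \<open>b = 1/2\<close> treats the singularity at 0, \<open>b = 2\<close>
  the tail at infinity.\<close>

lemma powr_shells_finite:
  fixes T :: "'a::euclidean_space set" and q b :: real
  assumes b: "b > 0" "b powr (q + DIM('a)) < 1" and [measurable]: "T \<in> sets borel"
    and T: "\<And>y. y \<in> T \<Longrightarrow> \<exists>k::nat. 1/2 \<le> norm y / b^k \<and> norm y / b^k \<le> 2"
  shows "(\<integral>\<^sup>+y. ennreal (norm y powr q) * indicator T y \<partial>lborel) < \<infinity>"
proof -
  define A where "A = {y::'a. 1/2 \<le> norm y \<and> norm y \<le> 2}"
  have [measurable]: "A \<in> sets borel" unfolding A_def by measurable
  define s where "s k y = ennreal (norm y powr q) * indicator A ((1 / b^k) *\<^sub>R y)" for k :: nat and y :: 'a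
  have [measurable]: "s k \<in> borel_measurable borel" for k unfolding s_def by measurable
  define J where "J = (\<integral>\<^sup>+y. ennreal (norm y powr q) * indicator A y \<partial>lborel)"
  define \<rho> where "\<rho> = b powr (q + DIM('a))"
  have \<rho>: "0 \<le> \<rho>" "\<rho> < 1" using b by (auto simp: \<rho>_def)
  have "J \<le> (\<integral>\<^sup>+y. ennreal (2 powr \<bar>q\<bar>) * indicator (cball (0::'a) 2) y \<partial>lborel)"
    unfolding J_def
  proof (rule nn_integral_mono)
    fix y :: 'a
    have "norm y powr q \<le> 2 powr \<bar>q\<bar>" if "y \<in> A"
    proof (cases "q \<ge> 0")
      case True
      then show ?thesis using that by (auto simp: A_def intro!: powr_mono2)
    next
      case False
      have "norm y powr q \<le> (1/2) powr q"
        using that False by (intro powr_mono2') (auto simp: A_def)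
      also have "\<dots> = 2 powr \<bar>q\<bar>" using False by (simp add: powr_divide powr_minus_divide)
      finally show ?thesis .
    qed
    moreover have "y \<in> cball 0 2" if "y \<in> A" using that by (auto simp: A_def)
    ultimately show "ennreal (norm y powr q) * indicator A y \<le> ennreal (2 powr \<bar>q\<bar>) * indicator (cball 0 2) y"
      by (auto simp: indicator_def ennreal_leI)
  qed
  also have "\<dots> < \<infinity>"
    by (simp add: nn_integral_cmult_indicator ennreal_mult_less_top emeasure_cball_less_top)
  finally have J: "J < \<infinity>" .
  have s: "(\<integral>\<^sup>+y. s k y \<partial>lborel) = ennreal (\<rho> ^ k) * J" for k
  proof -
    have "(\<integral>\<^sup>+y. s k y \<partial>lborel) = ennreal (\<bar>b^k\<bar> ^ DIM('a)) * (\<integral>\<^sup>+y. s k (0 + b^k *\<^sub>R y) \<partial>lborel)"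
      using b by (intro nn_integral_lborel_affine) auto
    also have "(\<lambda>y. s k (0 + b^k *\<^sub>R y)) = (\<lambda>y. ennreal ((b^k) powr q) * (ennreal (norm y powr q) * indicator A y))"
      using b by (auto simp: s_def powr_mult ennreal_mult mult_ac)
    also have "(\<integral>\<^sup>+y. ennreal ((b^k) powr q) * (ennreal (norm y powr q) * indicator A y) \<partial>lborel) = ennreal ((b^k) powr q) * J"
      unfolding J_def by (rule nn_integral_cmult) measurable
    also have "ennreal (\<bar>b^k\<bar> ^ DIM('a)) * (ennreal ((b^k) powr q) * J) = ennreal (\<rho> ^ k) * J"
    proof -
      have "\<bar>b^k\<bar> ^ DIM('a) * (b^k) powr q = \<rho> ^ k"
        using b by (simp add: \<rho>_def powr_add powr_realpow power_mult_distrib powr_powr mult_ac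
            flip: powr_realpow)
      then show ?thesis by (simp flip: ennreal_mult mult.assoc)
    qed
    finally show ?thesis .
  qed
  have "(\<integral>\<^sup>+y. ennreal (norm y powr q) * indicator T y \<partial>lborel) \<le> (\<integral>\<^sup>+y. (\<Sum>k. s k y) \<partial>lborel)"
  proof (rule nn_integral_mono)
    fix y :: 'a
    show "ennreal (norm y powr q) * indicator T y \<le> (\<Sum>k. s k y)"
    proof (cases "y \<in> T")
      case True
      from T[OF True] obtain k :: nat where k: "1/2 \<le> norm y / b^k" "norm y / b^k \<le> 2" by blast
      have "(1 / b^k) *\<^sub>R y \<in> A" using k b by (simp add: A_def)
      then have "ennreal (norm y powr q) * indicator T y = (\<Sum>i\<in>{k}. s i y)" using True by (simp add: s_def)
      also have "\<dots> \<le> (\<Sum>k. s k y)" by (rule sum_le_suminf) auto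
      finally show ?thesis .
    qed simp
  qed
  also have "\<dots> = (\<Sum>k. \<integral>\<^sup>+y. s k y \<partial>lborel)" by (rule nn_integral_suminf) simp
  also have "\<dots> = (\<Sum>k. ennreal (\<rho> ^ k)) * J" by (simp add: s)
  also have "(\<Sum>k. ennreal (\<rho> ^ k)) = ennreal (1 / (1 - \<rho>))"
    using \<rho> by (intro suminf_ennreal_eq geometric_sums) auto
  also have "ennreal (1 / (1 - \<rho>)) * J < \<infinity>" using J by (simp add: ennreal_mult_less_top)
  finally show ?thesis .
qed

lemma ex_power_between:
  fixes r :: real assumes "r \<ge> 1" shows "\<exists>k::nat. 1 \<le> r / 2^k \<and> r / 2^k \<le> 2"
proof -
  define k where "k = nat \<lfloor>log 2 r\<rfloor>"
  have "log 2 r \<ge> 0" using assms by simp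
  then have "real k \<le> log 2 r" "log 2 r \<le> real k + 1" unfolding k_def by linarith+
  then have "2 powr real k \<le> r" "r \<le> 2 powr (real k + 1)"
    using assms by (simp_all add: le_log_iff log_le_iff)
  then have "1 \<le> r / 2^k \<and> r / 2^k \<le> 2" by (simp add: powr_add powr_realpow field_simps)
  then show ?thesis by blast
qed

lemma nn_integral_powr_scale:
  fixes q R :: real and T :: "'a::euclidean_space set"
  assumes R: "R > 0" and [measurable]: "T \<in> sets borel"
  shows "(\<integral>\<^sup>+y. ennreal (norm y powr q) * indicator T ((1/R) *\<^sub>R y) \<partial>lborel) =
    ennreal (R powr (q + DIM('a))) * (\<integral>\<^sup>+y. ennreal (norm (y::'a) powr q) * indicator T y \<partial>lborel)"
proof -
  define f where "f y = ennreal (norm y powr q) * indicator T ((1/R) *\<^sub>R y)" for y :: 'a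
  have [measurable]: "f \<in> borel_measurable borel" unfolding f_def by measurable
  have "(\<integral>\<^sup>+y. f y \<partial>lborel) = ennreal (\<bar>R\<bar> ^ DIM('a)) * (\<integral>\<^sup>+y. f (0 + R *\<^sub>R y) \<partial>lborel)"
    using R by (intro nn_integral_lborel_affine) auto
  also have "(\<lambda>y. f (0 + R *\<^sub>R y)) = (\<lambda>y. ennreal (R powr q) * (ennreal (norm y powr q) * indicator T y))"
    using R by (auto simp: f_def powr_mult ennreal_mult mult_ac)
  also have "(\<integral>\<^sup>+y. ennreal (R powr q) * (ennreal (norm y powr q) * indicator T y) \<partial>lborel) =
     ennreal (R powr q) * (\<integral>\<^sup>+y. ennreal (norm y powr q) * indicator T y \<partial>lborel)"
    by (rule nn_integral_cmult) measurable
  also have "ennreal (\<bar>R\<bar> ^ DIM('a)) * (ennreal (R powr q) * (\<integral>\<^sup>+y. ennreal (norm y powr q) * indicator T y \<partial>lborel)) =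
     ennreal (R powr (q + DIM('a))) * (\<integral>\<^sup>+y. ennreal (norm y powr q) * indicator T y \<partial>lborel)"
  proof -
    have "\<bar>R\<bar> ^ DIM('a) * R powr q = R powr (q + DIM('a))"
      using R by (simp add: powr_add powr_realpow)
    then show ?thesis by (simp flip: ennreal_mult mult.assoc)
  qed
  finally show ?thesis unfolding f_def .
qed

lemma nn_integral_powr_inside:
  fixes q :: real
  assumes q: "q > - real DIM('a::euclidean_space)"
  shows "\<exists>C\<ge>0. \<forall>R>0. (\<integral>\<^sup>+y. ennreal (norm (y::'a) powr q) * indicator (cball 0 R) y \<partial>lborel)
           \<le> ennreal (C * R powr (q + DIM('a)))"
proof -
  define I where "I = (\<integral>\<^sup>+y. ennreal (norm (y::'a) powr q) * indicator (cball 0 1) y \<partial>lborel)"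
  \<comment> \<open>The integrand is 0 at the origin by the convention for \<open>powr\<close>, so
    the origin, which lies in no annulus, can be removed pointwise.\<close>
  have "I = (\<integral>\<^sup>+y. ennreal (norm (y::'a) powr q) * indicator (cball 0 1 - {0}) y \<partial>lborel)"
    unfolding I_def by (intro nn_integral_cong) (auto simp: indicator_def)
  also have "\<dots> < \<infinity>"
  proof (rule powr_shells_finite[where b = "1/2"])
    show "(1/2) powr (q + DIM('a)) < 1"
      using powr_less_mono2[of "q + DIM('a)" "1/2" 1] q by simp
    fix y :: 'a assume y: "y \<in> cball 0 1 - {0}"
    then obtain k :: nat where k: "1 \<le> (1 / norm y) / 2^k" "(1 / norm y) / 2^k \<le> 2"
      using ex_power_between[of "1 / norm y"] by auto
    have "norm y / (1/2)^k = norm y * 2^k" by (simp add: power_divide)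
    moreover have "norm y * 2^k \<le> 1" "1/2 \<le> norm y * 2^k" using k y by (simp_all add: field_simps)
    ultimately have "1/2 \<le> norm y / (1/2)^k \<and> norm y / (1/2)^k \<le> 2" by linarith
    then show "\<exists>k::nat. 1/2 \<le> norm y / (1/2)^k \<and> norm y / (1/2)^k \<le> 2" by blast
  qed auto
  finally obtain C where C: "C \<ge> 0" "I = ennreal C" by (auto simp: less_top_ennreal)
  have "(\<integral>\<^sup>+y. ennreal (norm (y::'a) powr q) * indicator (cball 0 R) y \<partial>lborel)
           = ennreal (C * R powr (q + DIM('a)))" if R: "R > 0" for R
  proof -
    have "indicator (cball 0 R) y = (indicator (cball 0 1) ((1/R) *\<^sub>R y) :: ennreal)" for y :: 'a
      using R by (auto simp: indicator_def field_simps)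
    then show ?thesis
      using nn_integral_powr_scale[OF R, of "cball 0 1 :: 'a set" q] C
      by (simp add: I_def ennreal_mult mult.commute)
  qed
  then show ?thesis using C(1) by (intro exI[of _ C]) auto
qed

lemma nn_integral_powr_outside:
  fixes q :: real
  assumes q: "q < - real DIM('a::euclidean_space)"
  shows "\<exists>C\<ge>0. \<forall>R>0. (\<integral>\<^sup>+y. ennreal (norm (y::'a) powr q) * indicator {y. R \<le> norm y} y \<partial>lborel)
           \<le> ennreal (C * R powr (q + DIM('a)))"
proof -
  define I where "I = (\<integral>\<^sup>+y. ennreal (norm (y::'a) powr q) * indicator {y. 1 \<le> norm y} y \<partial>lborel)"
  have [measurable]: "{y::'a. R \<le> norm y} \<in> sets borel" for R by measurable
  have "I < \<infinity>" unfolding I_def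
  proof (rule powr_shells_finite[where b = "2"])
    show "2 powr (q + DIM('a)) < 1" using q by (simp add: powr_less_one)
    fix y :: 'a assume y: "y \<in> {y. 1 \<le> norm y}"
    then obtain k :: nat where k: "1 \<le> norm y / 2^k" "norm y / 2^k \<le> 2"
      using ex_power_between[of "norm y"] by auto
    then have "1/2 \<le> norm y / 2^k \<and> norm y / 2^k \<le> 2" by linarith
    then show "\<exists>k::nat. 1/2 \<le> norm y / 2^k \<and> norm y / 2^k \<le> 2" by blast
  qed auto
  then obtain C where C: "C \<ge> 0" "I = ennreal C" by (auto simp: less_top_ennreal)
  have "(\<integral>\<^sup>+y. ennreal (norm (y::'a) powr q) * indicator {y. R \<le> norm y} y \<partial>lborel)
           = ennreal (C * R powr (q + DIM('a)))" if R: "R > 0" for R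
  proof -
    have "indicator {y. R \<le> norm y} y = (indicator {y. 1 \<le> norm y} ((1/R) *\<^sub>R y) :: ennreal)" for y :: 'a
      using R by (auto simp: indicator_def field_simps)
    then show ?thesis
      using nn_integral_powr_scale[OF R, of "{y. 1 \<le> norm y} :: 'a set" q] C
      by (simp add: I_def ennreal_mult mult.commute)
  qed
  then show ?thesis using C(1) by (intro exI[of _ C]) auto
qed

lemma nn_integral_powr_ball:
  fixes q :: real
  assumes q: "q > - real DIM('a::euclidean_space)"
  shows "\<exists>C\<ge>0. \<forall>R>0. \<forall>x::'a. (\<integral>\<^sup>+y. ennreal (norm (x - y) powr q) * indicator (cball x R) y \<partial>lborel)
           \<le> ennreal (C * R powr (q + DIM('a)))"
proof -
  obtain C where C: "C \<ge> 0" "\<And>R. R > 0 \<Longrightarrow> (\<integral>\<^sup>+y. ennreal (norm (y::'a) powr q) * indicator (cball 0 R) y \<partial>lborel)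
           \<le> ennreal (C * R powr (q + DIM('a)))"
    using nn_integral_powr_inside[OF q] by blast
  have "(\<integral>\<^sup>+y. ennreal (norm (x - y) powr q) * indicator (cball x R) y \<partial>lborel) =
     (\<integral>\<^sup>+y. ennreal (norm (y::'a) powr q) * indicator (cball 0 R) y \<partial>lborel)" for x :: 'a and R
    by (subst nn_integral_lborel_affine[where c = "-1" and a = x])
      (auto simp: indicator_def dist_norm intro!: nn_integral_cong)
  then show ?thesis using C by (intro exI[of _ C]) auto
qed

section \<open>Compactly supported functions and integrals of their derivatives\<close>

lemma integrable_compact_support:
  fixes f :: "'a::euclidean_space \<Rightarrow> real"
  assumes "continuous_on UNIV f" "\<And>x. norm x > R \<Longrightarrow> f x = 0"
  shows "integrable lborel f"
proof -
  have "integrable lborel (\<lambda>x. indicator (cball 0 R) x *\<^sub>R f x)"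
    using assms(1) by (intro borel_integrable_compact) (auto intro: continuous_on_subset)
  also have "(\<lambda>x. indicator (cball 0 R) x *\<^sub>R f x) = f"
    using assms(2) by (auto simp: indicator_def fun_eq_iff not_le)
  finally show ?thesis .
qed

lemma bounded_compact_support:
  fixes f :: "'a::euclidean_space \<Rightarrow> real"
  assumes "continuous_on UNIV f" "\<And>x. norm x > R \<Longrightarrow> f x = 0"
  shows "\<exists>B\<ge>0. \<forall>x. \<bar>f x\<bar> \<le> B"
proof -
  have "bounded (f ` cball 0 R)"
    using assms(1) by (intro compact_imp_bounded compact_continuous_image) (auto intro: continuous_on_subset)
  then obtain B where "\<forall>y\<in>f ` cball 0 R. norm y \<le> B" unfolding bounded_iff by blast
  then have B: "\<bar>f x\<bar> \<le> B" if "x \<in> cball 0 R" for x using that by auto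
  have "\<bar>f x\<bar> \<le> max B 0" for x
    using B[of x] assms(2)[of x] by (cases "norm x > R") auto
  then show ?thesis by (intro exI[of _ "max B 0"]) auto
qed

lemma DERIV_zero_on_open:
  fixes f :: "real^'n::finite \<Rightarrow> real"
  assumes "open S" "\<And>x. x \<in> S \<Longrightarrow> f x = 0" "x \<in> S"
  shows "((\<lambda>t. f (x + t *\<^sub>R axis i 1)) has_real_derivative 0) (at 0)"
proof -
  have "isCont (\<lambda>t::real. x + t *\<^sub>R axis i 1) 0" by (intro continuous_intros)
  then have "((\<lambda>t::real. x + t *\<^sub>R axis i 1) \<longlongrightarrow> x) (nhds 0)"
    using tendsto_at_iff_tendsto_nhds[of "\<lambda>t::real. x + t *\<^sub>R axis i 1" 0] by (simp add: isCont_def)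
  then have "eventually (\<lambda>t::real. x + t *\<^sub>R axis i 1 \<in> S) (nhds 0)"
    using assms(1,3) by (rule topological_tendstoD)
  then have "eventually (\<lambda>t::real. f (x + t *\<^sub>R axis i 1) = 0) (nhds 0)"
    by eventually_elim (use assms(2) in auto)
  then show ?thesis by (subst DERIV_cong_ev[where g = "\<lambda>_. 0" and v = 0, OF refl _ refl]) auto
qed

text \<open>Difference quotients integrate to 0 by translation invariance of Lebesgue measure. The
  mean value theorem bounds them by the maximum of the derivative, so dominated convergence carries
  this over to \<open>w'\<close>.\<close>

lemma integral_pd_zero:
  fixes w :: "real^'n::finite \<Rightarrow> real"
  assumes pd: "has_pd i w w'" and cont: "continuous_on UNIV w" "continuous_on UNIV w'"
    and supp: "\<And>x. norm x > R \<Longrightarrow> w x = 0"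
  shows "(\<integral>x. w' x \<partial>lborel) = 0"
proof -
  let ?e = "axis i 1 :: real^'n"
  have supp': "w' x = 0" if "norm x > R" for x
  proof -
    have "((\<lambda>t. w (x + t *\<^sub>R ?e)) has_real_derivative 0) (at 0)"
      using that supp by (intro DERIV_zero_on_open[where S = "{x. norm x > R}"]) (auto intro: open_Collect_less continuous_intros)
    then show ?thesis using DERIV_unique has_pdD[OF pd] by blast
  qed
  obtain B where B: "B \<ge> 0" "\<And>x. \<bar>w' x\<bar> \<le> B" using bounded_compact_support[OF cont(2) supp'] by blast
  have [measurable]: "w \<in> borel_measurable borel" "w' \<in> borel_measurable borel"
    using cont by (auto intro: borel_measurable_continuous_onI)
  define h where "h n = 1 / real (Suc n)" for n
  have h: "h n > 0" "h n \<le> 1" for n by (auto simp: h_def)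
  have h0: "h \<longlonglongrightarrow> 0" unfolding h_def using LIMSEQ_inverse_real_of_nat by (simp add: inverse_eq_divide)
  define d where "d n x = (w (x + h n *\<^sub>R ?e) - w x) / h n" for n x
  have [measurable]: "d n \<in> borel_measurable borel" for n unfolding d_def by measurable
  have intw: "integrable lborel w" by (rule integrable_compact_support[OF cont(1) supp])
  have "(\<lambda>n. \<integral>x. d n x \<partial>lborel) \<longlonglongrightarrow> (\<integral>x. w' x \<partial>lborel)"
  proof (rule integral_dominated_convergence)
    \<comment> \<open>A step of length at most 1 enlarges the support by at most 1, hence the radius
      \<open>R + 1\<close>.\<close>
    show "integrable lborel (\<lambda>x::real^'n. B * indicator (cball 0 (R + 1)) x)"
      by (intro integrable_mult_right integrable_real_indicator) (auto simp: emeasure_cball_less_top)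
    show "AE x in lborel. (\<lambda>n. d n x) \<longlonglongrightarrow> w' x"
    proof (rule AE_I2)
      fix x
      have "((\<lambda>t. (w (x + t *\<^sub>R ?e) - w x) / t) \<longlongrightarrow> w' x) (at 0)"
        using has_pdD[OF pd, of x] by (simp add: DERIV_def)
      moreover have "filterlim h (at 0) sequentially"
        using h0 h(1) by (auto simp: filterlim_at intro!: always_eventually) (metis less_irrefl)
      ultimately show "(\<lambda>n. d n x) \<longlonglongrightarrow> w' x" unfolding d_def by (rule filterlim_compose)
    qed
    fix n
    show "AE x in lborel. norm (d n x) \<le> B * indicator (cball 0 (R + 1)) x"
    proof (rule AE_I2)
      fix x
      have "\<exists>z. 0 < z \<and> z < h n \<and> w (x + h n *\<^sub>R ?e) - w (x + 0 *\<^sub>R ?e) = (h n - 0) * w' (x + z *\<^sub>R ?e)"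
        by (rule MVT2) (use h has_pd_at[OF pd] in auto)
      then obtain z where "w (x + h n *\<^sub>R ?e) - w x = h n * w' (x + z *\<^sub>R ?e)" by auto
      then have "d n x = w' (x + z *\<^sub>R ?e)" using h[of n] by (simp add: d_def)
      then have 1: "\<bar>d n x\<bar> \<le> B" using B by simp
      have 2: "d n x = 0" if "norm x > R + 1"
      proof -
        have "norm x \<le> norm (x + h n *\<^sub>R ?e) + norm (h n *\<^sub>R ?e)"
          using norm_triangle_ineq4[of "x + h n *\<^sub>R ?e" "h n *\<^sub>R ?e"] by simp
        also have "norm (h n *\<^sub>R ?e) \<le> 1" using h[of n] by (simp add: norm_axis_1)
        finally have "norm (x + h n *\<^sub>R ?e) > R" using that by simp
        then show ?thesis using that supp by (simp add: d_def)
      qed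
      show "norm (d n x) \<le> B * indicator (cball 0 (R + 1)) x"
        using 1 2 by (auto simp: indicator_def not_le)
    qed
  qed auto
  moreover have "(\<integral>x. d n x \<partial>lborel) = 0" for n
  proof -
    have sh: "(\<integral>x. w (x + h n *\<^sub>R ?e) \<partial>lborel) = (\<integral>x. w x \<partial>lborel)"
      by (subst (2) lborel_integral_affine[where c = 1 and a = "h n *\<^sub>R ?e"]) (auto simp: add.commute)
    have "integrable lborel (\<lambda>x. w (x + h n *\<^sub>R ?e))"
    proof (rule integrable_compact_support[where R = "R + norm (h n *\<^sub>R ?e)"])
      show "continuous_on UNIV (\<lambda>x. w (x + h n *\<^sub>R ?e))"
        by (rule continuous_on_compose2[OF cont(1)]) (auto intro!: continuous_on_add continuous_on_id continuous_on_const)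
      fix x :: "real^'n" assume "norm x > R + norm (h n *\<^sub>R ?e)"
      moreover have "norm x \<le> norm (x + h n *\<^sub>R ?e) + norm (h n *\<^sub>R ?e)"
        using norm_triangle_ineq4[of "x + h n *\<^sub>R ?e" "h n *\<^sub>R ?e"] by simp
      ultimately show "w (x + h n *\<^sub>R ?e) = 0" by (intro supp) linarith
    qed
    then show ?thesis unfolding d_def using intw sh by simp
  qed
  ultimately have "(\<lambda>n. 0 :: real) \<longlonglongrightarrow> (\<integral>x. w' x \<partial>lborel)" by simp
  then show ?thesis by (simp add: LIMSEQ_const_iff)
qed

section \<open>The Newtonian potential\<close>

text \<open>The fundamental solution as a function of the squared norm, which is smooth in
  \<open>x\<close> and can be regularised by adding a positive number. The factors are chosen so
  that the derivative is \<open>s powr (-N/2) / 2\<close> in every dimension.\<close>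

definition newton_profile :: "real \<Rightarrow> real \<Rightarrow> real" where
  "newton_profile N s = (if N = 2 then ln s / 2 else s powr (1 - N/2) / (2 - N))"

definition newton :: "real^'n::finite \<Rightarrow> real" where
  "newton z = newton_profile (real CARD('n)) ((norm z)\<^sup>2)"

text \<open>In dimension 2 the exponent only has to absorb the logarithm.\<close>

definition sing_order :: "real \<Rightarrow> real" where
  "sing_order N = (if N = 2 then 1/2 else N - 2)"

lemma newton_profile_deriv:
  assumes "s > 0" shows "(newton_profile N has_real_derivative s powr (-N/2) / 2) (at s)"
proof (cases "N = 2")
  case True
  have "((\<lambda>s. ln s / 2) has_real_derivative inverse s / 2) (at s)"
    by (rule DERIV_cdivide[OF DERIV_ln[OF assms]])
  moreover have "inverse s / 2 = s powr (-N/2) / 2" using True assms by (simp add: powr_minus)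
  moreover have "newton_profile N = (\<lambda>s. ln s / 2)" using True by (simp add: newton_profile_def[abs_def])
  ultimately show ?thesis by (simp only:)
next
  case False
  have "((\<lambda>s. s powr (1 - N/2) / (2 - N)) has_real_derivative ((1 - N/2) * s powr (1 - N/2 - 1)) / (2 - N)) (at s)"
    by (rule DERIV_cdivide, rule has_real_derivative_powr[OF assms])
  moreover have "((1 - N/2) * s powr (1 - N/2 - 1)) / (2 - N) = s powr (-N/2) / 2"
    using False by (simp add: field_simps)
  moreover have "newton_profile N = (\<lambda>s. s powr (1 - N/2) / (2 - N))" using False by (simp add: newton_profile_def[abs_def])
  ultimately show ?thesis by (simp only:)
qed

text \<open>Uniformity in \<open>e\<close> makes the right-hand side a common majorant for all
  regularised kernels and for the limit kernel.\<close>

lemma newton_profile_bound: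
  assumes N: "N \<ge> 2" and R: "R > 0"
  shows "\<exists>D\<ge>0. \<forall>e r. 0 \<le> e \<and> e \<le> 1 \<and> 0 < r \<and> r \<le> R \<longrightarrow> \<bar>newton_profile N (r\<^sup>2 + e)\<bar> \<le> D * r powr (- sing_order N)"
proof (cases "N = 2")
  case True
  define D where "D = 4 + (R\<^sup>2 + 1) * R powr (1/2)"
  have "\<bar>newton_profile N (r\<^sup>2 + e)\<bar> \<le> D * r powr (- sing_order N)" if e: "0 \<le> e" "e \<le> 1" and r: "0 < r" "r \<le> R" for e r
  proof -
    define s where "s = r\<^sup>2 + e"
    have "r\<^sup>2 \<le> R\<^sup>2" using r by (intro power_mono) auto
    then have s: "s \<le> R\<^sup>2 + 1" "r\<^sup>2 \<le> s" unfolding s_def using e by linarith+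
    have "r\<^sup>2 > 0" using r by simp
    then have s: "s > 0" "s \<le> R\<^sup>2 + 1" "r\<^sup>2 \<le> s" using s by linarith+
    have "ln s \<le> s" using s by (intro ln_bound) auto
    \<comment> \<open>\<open>ln x \<le> x\<close> is applied to \<open>s powr (-1/4)\<close>. This
      exponent turns into \<open>r powr (-1/2)\<close>, the singularity order chosen for dimension
      2, because \<open>r\<^sup>2 \<le> s\<close>.\<close>
    moreover have "- ln s \<le> 4 * s powr (-1/4)"
    proof -
      have "ln (s powr (-1/4)) \<le> s powr (-1/4)" using s by (intro ln_bound) auto
      then show ?thesis by simp
    qed
    ultimately have "\<bar>ln s\<bar> \<le> s + 4 * s powr (-1/4)"
      using s by (smt (verit) powr_ge_zero)
    also have "s powr (-1/4) \<le> (r\<^sup>2) powr (-1/4)" using s r by (intro powr_mono2') auto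
    also have "(r\<^sup>2) powr (-1/4) = r powr (-1/2)" using r by (simp add: powr_powr flip: powr_numeral)
    \<comment> \<open>The bounded summand \<open>s\<close> is absorbed into the singular one, since
      \<open>(R/r) powr (1/2)\<close> is at least 1.\<close>
    also have "s \<le> (R\<^sup>2 + 1) * (R powr (1/2) * r powr (-1/2))"
    proof -
      have "1 = r powr (1/2) * r powr (-1/2)" using r by (simp flip: powr_add)
      also have "\<dots> \<le> R powr (1/2) * r powr (-1/2)" using r by (intro mult_right_mono powr_mono2) auto
      finally have "(R\<^sup>2 + 1) * 1 \<le> (R\<^sup>2 + 1) * (R powr (1/2) * r powr (-1/2))"
        by (intro mult_left_mono) auto
      moreover have "s \<le> (R\<^sup>2 + 1) * 1" using s by simp
      ultimately show ?thesis by (rule order_trans[rotated])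
    qed
    finally have "\<bar>ln s\<bar> \<le> D * r powr (-1/2)" by (simp add: D_def algebra_simps)
    then show ?thesis using True unfolding s_def[symmetric] by (simp add: newton_profile_def sing_order_def)
  qed
  moreover have "D \<ge> 0" by (simp add: D_def)
  ultimately show ?thesis by blast
next
  case False
  then have N2: "N > 2" using N by simp
  have "\<bar>newton_profile N (r\<^sup>2 + e)\<bar> \<le> 1 / (N - 2) * r powr (- sing_order N)" if e: "0 \<le> e" "e \<le> 1" and r: "0 < r" "r \<le> R" for e r
  proof -
    have "(r\<^sup>2 + e) powr (1 - N/2) \<le> (r\<^sup>2) powr (1 - N/2)" using e r N2 by (intro powr_mono2') auto
    also have "\<dots> = r powr (2 - N)" using r by (simp add: powr_powr flip: powr_numeral)
    finally show ?thesis using N2 by (simp add: newton_profile_def sing_order_def abs_divide divide_right_mono)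
  qed
  moreover have "1 / (N - 2) \<ge> 0" using N2 by simp
  ultimately show ?thesis by blast
qed

lemma sum_component_sq: "(\<Sum>i\<in>UNIV. ((x::real^'n::finite) $ i)\<^sup>2) = (norm x)\<^sup>2"
  unfolding power2_norm_eq_inner by (simp add: inner_vec_def power2_eq_square)

text \<open>In the sum over the coordinates the second derivatives cancel up to
  \<open>N q - N |y - x|^2 = N e\<close>. What remains is positive and concentrates at
  \<open>x\<close> as \<open>e\<close> tends to 0.\<close>

lemma has_pd_reg:
  fixes x :: "real^'n::finite" and e :: real
  assumes e: "e > 0"
  defines "N \<equiv> real CARD('n)"
  defines "q \<equiv> \<lambda>y. (norm (y - x))\<^sup>2 + e"
  shows "has_pd i (\<lambda>y. newton_profile N (q y)) (\<lambda>y. (y - x) $ i * q y powr (-N/2))"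
    and "has_pd i (\<lambda>y. (y - x) $ i * q y powr (-N/2))
           (\<lambda>y. q y powr (-N/2) - N * ((y - x) $ i)\<^sup>2 * q y powr (-N/2 - 1))"
    and "(\<Sum>i\<in>UNIV. q y powr (-N/2) - N * ((y - x) $ i)\<^sup>2 * q y powr (-N/2 - 1)) = N * e * q y powr (-N/2 - 1)"
proof -
  have q: "q y > 0" for y using e by (simp add: q_def add_nonneg_pos)
  have pq: "has_pd j q (\<lambda>y. 2 * (y - x) $ j)" for j
    unfolding q_def by (rule has_pd_cong[OF has_pd_add[OF has_pd_norm_sq has_pd_const]]) simp
  show "has_pd i (\<lambda>y. newton_profile N (q y)) (\<lambda>y. (y - x) $ i * q y powr (-N/2))"
    by (rule has_pd_cong[OF has_pd_compose[OF pq newton_profile_deriv[OF q]]]) simp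
  have pc: "has_pd i (\<lambda>y. (y - x) $ i) (\<lambda>y. 1)"
    by (rule has_pd_cong[of _ _ "\<lambda>x. (if i = i then 1 else 0) - 0"])
       (use has_pd_diff[OF has_pd_component[of i i] has_pd_const[of i "x $ i"]] in simp_all)
  have pp: "has_pd i (\<lambda>y. q y powr (-N/2)) (\<lambda>y. - (N * q y powr (-N/2 - 1) * (y - x) $ i))"
    by (rule has_pd_cong[OF has_pd_compose[OF pq has_real_derivative_powr[OF q]]]) (simp add: field_simps)
  show "has_pd i (\<lambda>y. (y - x) $ i * q y powr (-N/2))
           (\<lambda>y. q y powr (-N/2) - N * ((y - x) $ i)\<^sup>2 * q y powr (-N/2 - 1))"
    by (rule has_pd_cong[OF has_pd_mult[OF pc pp]]) (simp only: power2_eq_square mult_1 mult_minus_right mult_ac diff_conv_add_uminus)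
  have "q y powr (-N/2) = q y powr 1 * q y powr (-N/2 - 1)" using powr_add[of "q y" 1 "-N/2 - 1"] by simp
  also have "\<dots> = q y * q y powr (-N/2 - 1)" using q[of y] by simp
  finally have *: "q y powr (-N/2) = q y * q y powr (-N/2 - 1)" .
  have "(\<Sum>i\<in>UNIV. q y powr (-N/2) - N * ((y - x) $ i)\<^sup>2 * q y powr (-N/2 - 1))
      = N * q y powr (-N/2) - N * (norm (y - x))\<^sup>2 * q y powr (-N/2 - 1)"
  proof -
    have "(\<Sum>i\<in>UNIV. N * ((y - x) $ i)\<^sup>2 * q y powr (-N/2 - 1)) = N * (norm (y - x))\<^sup>2 * q y powr (-N/2 - 1)"
      unfolding sum_component_sq[symmetric] by (simp add: sum_distrib_left sum_distrib_right)
    then show ?thesis by (simp add: sum_subtractf N_def)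
  qed
  also have "\<dots> = N * e * q y powr (-N/2 - 1)" unfolding * by (simp add: q_def algebra_simps)
  finally show "(\<Sum>i\<in>UNIV. q y powr (-N/2) - N * ((y - x) $ i)\<^sup>2 * q y powr (-N/2 - 1)) = N * e * q y powr (-N/2 - 1)" .
qed

lemma smooth_facts:
  assumes "smooth_fun u"
  shows "continuous_on UNIV u" "has_pd i u (pdiff i u)" "continuous_on UNIV (pdiff i u)"
    "has_pd i (pdiff i u) (pdiff i (pdiff i u))" "continuous_on UNIV (pdiff i (pdiff i u))"
    "continuous_on UNIV (laplacian u)"
proof -
  show "continuous_on UNIV u" "has_pd i u (pdiff i u)" using smooth_has_pd(1)[OF assms, of _ "[]"] smooth_has_pd(2)[OF assms, of "[]"] by simp_all
  show "continuous_on UNIV (pdiff i u)" "has_pd i (pdiff i u) (pdiff i (pdiff i u))"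
    using smooth_has_pd(1)[OF assms, of _ "[i]"] smooth_has_pd(2)[OF assms, of "[i]"] by simp_all
  have *: "continuous_on UNIV (pdiff i (pdiff i u))" for i
    using smooth_has_pd(2)[OF assms, of "[i, i]"] by simp
  then show "continuous_on UNIV (pdiff i (pdiff i u))" .
  show "continuous_on UNIV (laplacian u)" unfolding laplacian_def[abs_def]
    by (intro continuous_on_sum *)
qed

lemma pdiff_zero_on_open:
  assumes "open S" "\<And>x. x \<in> S \<Longrightarrow> f x = 0" "x \<in> S" shows "pdiff i f x = 0"
  unfolding pdiff_def by (rule DERIV_imp_deriv, rule DERIV_zero_on_open[OF assms])

lemma laplacian_zero_on_open:
  assumes "open S" "\<And>x. x \<in> S \<Longrightarrow> f x = 0" "x \<in> S" shows "laplacian f x = 0"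
  unfolding laplacian_def
  by (intro sum.neutral ballI pdiff_zero_on_open[OF assms(1) _ assms(3)] pdiff_zero_on_open[OF assms(1,2)])

lemma open_outside: "open {x::real^'n::finite. norm x > R}"
  by (intro open_Collect_less continuous_on_const continuous_on_norm continuous_on_id)

lemma test_fun_support:
  fixes u :: "real^'n::finite \<Rightarrow> real"
  assumes "test_fun u"
  obtains r R where "0 < r" "r < R" "\<And>x. norm x < r \<Longrightarrow> u x = 0" "\<And>x. norm x > R \<Longrightarrow> u x = 0"
    "\<And>x. norm x < r \<Longrightarrow> laplacian u x = 0" "\<And>x. norm x > R \<Longrightarrow> laplacian u x = 0"
proof -
  let ?S = "closure {x. u x \<noteq> 0}"
  have S: "compact ?S" "0 \<notin> ?S" using assms by (auto simp: test_fun_def)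
  have "open (- ?S)" by (simp add: open_Compl)
  then obtain r where r: "r > 0" "ball 0 r \<subseteq> - ?S" using S(2) open_contains_ball by blast
  obtain R0 where R0: "\<And>x. x \<in> ?S \<Longrightarrow> norm x \<le> R0" using compact_imp_bounded[OF S(1)] by (auto simp: bounded_iff)
  have 1: "u x = 0" if "norm x < r" for x
    using that r(2) closure_subset[of "{x. u x \<noteq> 0}"] by (force simp: subset_iff)
  have 2: "u x = 0" if "norm x > max R0 (r + 1)" for x
    using that R0[of x] closure_subset[of "{x. u x \<noteq> 0}"] by force
  show ?thesis
  proof (rule that[of r "max R0 (r+1)"])
    show "laplacian u x = 0" if "norm x < r" for x
      by (rule laplacian_zero_on_open[of "ball 0 r"]) (use that 1 in auto)
    show "laplacian u x = 0" if "norm x > max R0 (r + 1)" for x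
      by (rule laplacian_zero_on_open[OF open_outside[of "max R0 (r + 1)"]]) (use that 2 in \<open>simp_all only: mem_Collect_eq\<close>)
  qed (use r 1 2 in auto)
qed

text \<open>Both partial integrations are made in one stroke:
  \<open>pdiff i u * g - u * gd i\<close> has compact support, and its derivative in direction
  \<open>i\<close> is the difference of the two integrands.\<close>

lemma green:
  fixes u g :: "real^'n::finite \<Rightarrow> real"
  assumes u: "smooth_fun u" "\<And>x. norm x > R \<Longrightarrow> u x = 0"
    and g: "\<And>i. has_pd i g (gd i)" "\<And>i. has_pd i (gd i) (gdd i)"
    "continuous_on UNIV g" "\<And>i. continuous_on UNIV (gd i)" "\<And>i. continuous_on UNIV (gdd i)"
  shows "(\<integral>x. laplacian u x * g x \<partial>lborel) = (\<integral>x. u x * (\<Sum>i\<in>UNIV. gdd i x) \<partial>lborel)"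
proof -
  note sm = smooth_facts[OF u(1)]
  have z1: "pdiff i u x = 0" if "norm x > R" for i x
    by (rule pdiff_zero_on_open[OF open_outside[of R]]) (use that u in auto)
  have z2: "pdiff i (pdiff i u) x = 0" if "norm x > R" for i x
    by (rule pdiff_zero_on_open[OF open_outside[of R]]) (use that z1 in auto)
  have int1: "integrable lborel (\<lambda>x. pdiff i (pdiff i u) x * g x)" for i
    by (rule integrable_compact_support[where R = R]) (use z2 in \<open>auto intro!: continuous_on_mult sm g\<close>)
  have int2: "integrable lborel (\<lambda>x. u x * gdd i x)" for i
    by (rule integrable_compact_support[where R = R]) (use u in \<open>auto intro!: continuous_on_mult sm g\<close>)
  have "(\<integral>x. pdiff i (pdiff i u) x * g x - u x * gdd i x \<partial>lborel) = 0" for i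
  proof (rule integral_pd_zero[where R = R])
    have "has_pd i (\<lambda>x. pdiff i u x * g x - u x * gd i x)
      (\<lambda>x. (pdiff i (pdiff i u) x * g x + pdiff i u x * gd i x) - (pdiff i u x * gd i x + u x * gdd i x))"
      by (intro has_pd_diff has_pd_mult sm g)
    then show "has_pd i (\<lambda>x. pdiff i u x * g x - u x * gd i x) (\<lambda>x. pdiff i (pdiff i u) x * g x - u x * gdd i x)"
      by (rule has_pd_cong) simp
  qed (use z1 u in \<open>auto intro!: continuous_on_mult continuous_on_diff sm g\<close>)
  moreover have "(\<integral>x. pdiff i (pdiff i u) x * g x - u x * gdd i x \<partial>lborel)
      = (\<integral>x. pdiff i (pdiff i u) x * g x \<partial>lborel) - (\<integral>x. u x * gdd i x \<partial>lborel)" for i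
    by (rule Bochner_Integration.integral_diff[OF int1 int2])
  ultimately have eq: "(\<integral>x. pdiff i (pdiff i u) x * g x \<partial>lborel) = (\<integral>x. u x * gdd i x \<partial>lborel)" for i
    by (metis eq_iff_diff_eq_0)
  have "(\<integral>x. laplacian u x * g x \<partial>lborel) = (\<integral>x. (\<Sum>i\<in>UNIV. pdiff i (pdiff i u) x * g x) \<partial>lborel)"
    by (simp add: laplacian_def sum_distrib_right)
  also have "\<dots> = (\<Sum>i\<in>UNIV. \<integral>x. pdiff i (pdiff i u) x * g x \<partial>lborel)"
    by (intro Bochner_Integration.integral_sum int1)
  also have "\<dots> = (\<Sum>i\<in>UNIV. \<integral>x. u x * gdd i x \<partial>lborel)" by (simp add: eq)
  also have "\<dots> = (\<integral>x. (\<Sum>i\<in>UNIV. u x * gdd i x) \<partial>lborel)"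
    by (intro Bochner_Integration.integral_sum[symmetric] int2)
  finally show ?thesis by (simp add: sum_distrib_left)
qed

lemma integral_laplacian_zero:
  fixes u :: "real^'n::finite \<Rightarrow> real"
  assumes u: "smooth_fun u" "\<And>x. norm x > R \<Longrightarrow> u x = 0"
  shows "(\<integral>x. laplacian u x \<partial>lborel) = 0"
  using green[OF u has_pd_const[of _ 1] has_pd_const] by simp

text \<open>The Laplacian of the regularised kernel is an approximate identity, which the substitution
  \<open>y = x + ez\<close> makes visible.\<close>

lemma green_reg:
  fixes u :: "real^'n::finite \<Rightarrow> real" and x :: "real^'n"
  assumes u: "smooth_fun u" "\<And>x. norm x > R \<Longrightarrow> u x = 0" and e: "e > 0"
  defines "N \<equiv> real CARD('n)"
  shows "(\<integral>y. laplacian u y * newton_profile N ((norm (y - x))\<^sup>2 + e\<^sup>2) \<partial>lborel) =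
    (\<integral>z. u (x + e *\<^sub>R z) * (N * (1 + (norm z)\<^sup>2) powr (-N/2 - 1)) \<partial>lborel)"
proof -
  have e2: "e\<^sup>2 > 0" using e by simp
  define q where "q y = (norm (y - x))\<^sup>2 + e\<^sup>2" for y
  have q: "q y \<noteq> 0" "q y > 0" for y using e2 by (auto simp: q_def add_nonneg_pos add_nonneg_eq_0_iff)
  note pd = has_pd_reg[OF e2, where 'n='n and x=x, folded N_def q_def]
  have cq: "continuous_on UNIV q" unfolding q_def by (intro continuous_intros)
  have cp: "continuous_on UNIV (\<lambda>y. q y powr a)" for a
    using q by (intro continuous_on_powr' cq continuous_on_const) (auto simp: less_imp_le)
  have cc: "continuous_on UNIV (\<lambda>y. (y - x) $ i)" for i by (intro continuous_intros)
  have cg: "continuous_on UNIV (\<lambda>y. newton_profile N (q y))"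
    using cp[of "1 - N/2"] cq q unfolding newton_profile_def
    by (cases "N = 2") (auto intro!: continuous_on_ln continuous_on_divide continuous_on_const)
  have meas: "u \<in> borel_measurable borel" "q \<in> borel_measurable borel"
    using smooth_facts(1)[OF u(1)] cq by (auto intro: borel_measurable_continuous_onI)
  note [measurable] = meas
  have "(\<integral>y. laplacian u y * newton_profile N (q y) \<partial>lborel) = (\<integral>y. u y * (N * e\<^sup>2 * q y powr (-N/2 - 1)) \<partial>lborel)"
    unfolding pd(3)[symmetric]
  proof (rule green[OF u])
    show "has_pd i (\<lambda>y. newton_profile N (q y)) (\<lambda>y. (y - x) $ i * q y powr (-N/2))" for i by (rule pd(1))
    show "has_pd i (\<lambda>y. (y - x) $ i * q y powr (-N/2))
        (\<lambda>y. q y powr (-N/2) - N * ((y - x) $ i)\<^sup>2 * q y powr (-N/2 - 1))" for i by (rule pd(2))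
    show "continuous_on UNIV (\<lambda>y. (y - x) $ i * q y powr (-N/2))" for i
      by (intro continuous_on_mult cc cp)
    show "continuous_on UNIV (\<lambda>y. q y powr (-N/2) - N * ((y - x) $ i)\<^sup>2 * q y powr (-N/2 - 1))" for i
      by (intro continuous_on_diff continuous_on_mult continuous_on_power cc cp continuous_on_const)
  qed (assumption, rule cg)
  also have "\<dots> = \<bar>e\<bar> ^ DIM(real^'n) * (\<integral>z. u (x + e *\<^sub>R z) * (N * e\<^sup>2 * q (x + e *\<^sub>R z) powr (-N/2 - 1)) \<partial>lborel)"
    using e by (intro lborel_integral_affine) auto
  also have "\<dots> = (\<integral>z. u (x + e *\<^sub>R z) * (N * (1 + (norm z)\<^sup>2) powr (-N/2 - 1)) \<partial>lborel)"
  proof -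
    have "\<bar>e\<bar> ^ DIM(real^'n) * (u (x + e *\<^sub>R z) * (N * e\<^sup>2 * q (x + e *\<^sub>R z) powr (-N/2 - 1)))
       = u (x + e *\<^sub>R z) * (N * (1 + (norm z)\<^sup>2) powr (-N/2 - 1))" for z
    proof -
      have "q (x + e *\<^sub>R z) = e\<^sup>2 * (1 + (norm z)\<^sup>2)" by (simp add: q_def power_mult_distrib algebra_simps)
      then have "q (x + e *\<^sub>R z) powr (-N/2 - 1) = (e powr 2) powr (-N/2 - 1) * (1 + (norm z)\<^sup>2) powr (-N/2 - 1)"
        using e by (simp add: powr_mult)
      also have "(e powr 2) powr (-N/2 - 1) = e powr (-N - 2)" by (simp add: powr_powr algebra_simps)
      finally have "\<bar>e\<bar> ^ DIM(real^'n) * e\<^sup>2 * q (x + e *\<^sub>R z) powr (-N/2 - 1)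
          = (e powr N * e powr 2 * e powr (-N - 2)) * (1 + (norm z)\<^sup>2) powr (-N/2 - 1)"
        using e by (simp add: N_def powr_realpow)
      \<comment> \<open>Jacobian, numerator and kernel contribute the exponents \<open>N\<close>, 2
        and \<open>-N - 2\<close>, which cancel.\<close>
      also have "e powr N * e powr 2 * e powr (-N - 2) = e powr (N + 2 + (-N - 2))" by (simp only: powr_add)
      also have "\<dots> = 1" using e by simp
      finally show ?thesis by (simp add: mult_ac)
    qed
    then show ?thesis by (simp only: integral_mult_right_zero[symmetric])
  qed
  finally show ?thesis unfolding q_def .
qed

text \<open>This is the profile of the approximate identity, and its mass becomes the constant of
  the representation formula. The value is left open: it cancels in the computation of the best
  constant, and elsewhere only its sign matters.\<close>

lemma psi_integrable:
  defines "N \<equiv> real CARD('n::finite)"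
  shows "integrable lborel (\<lambda>z::real^'n. N * (1 + (norm z)\<^sup>2) powr (-N/2 - 1))" (is "integrable _ ?psi")
    and "(\<integral>z. N * (1 + (norm (z::real^'n))\<^sup>2) powr (-N/2 - 1) \<partial>lborel) > 0"
proof -
  have N: "N > 0" by (simp add: N_def)
  have [measurable]: "{y::real^'n. 1 \<le> norm y} \<in> sets borel" by measurable
  have [measurable]: "cball (0::real^'n) 1 \<in> sets borel" by simp
  have pos: "1 + (norm z)\<^sup>2 > 0" for z :: "real^'n" by (simp add: add_pos_nonneg)
  have ppos: "?psi z > 0" for z using N pos[of z] by simp
  obtain C where C: "(\<integral>\<^sup>+y. ennreal (norm (y::real^'n) powr (-N-2)) * indicator {y. 1 \<le> norm y} y \<partial>lborel) \<le> ennreal C"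
    using nn_integral_powr_outside[where 'a = "real^'n" and q = "-N-2"] by (auto simp: N_def dest!: spec[of _ 1])
  have "(\<integral>\<^sup>+z. ennreal (?psi z) \<partial>lborel) \<le> (\<integral>\<^sup>+z. ennreal N * (indicator (cball (0::real^'n) 1) z +
      ennreal (norm z powr (-N-2)) * indicator {y. 1 \<le> norm y} z) \<partial>lborel)"
  proof (rule nn_integral_mono)
    fix z :: "real^'n"
    show "ennreal (?psi z) \<le> ennreal N * (indicator (cball 0 1) z + ennreal (norm z powr (-N-2)) * indicator {y. 1 \<le> norm y} z)"
    proof (cases "norm z \<le> 1")
      case True
      have "(1 + (norm z)\<^sup>2) powr (-N/2 - 1) \<le> 1 powr (-N/2-1)" using N by (intro powr_mono2') auto
      then have "ennreal (?psi z) \<le> ennreal N * 1" using N by (simp add: ennreal_leI)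
      also have "\<dots> \<le> ennreal N * (indicator (cball 0 1) z + ennreal (norm z powr (-N-2)) * indicator {y. 1 \<le> norm y} z)"
        using True by (intro mult_left_mono) (auto simp: indicator_def)
      finally show ?thesis .
    next
      case False
      have "(1 + (norm z)\<^sup>2) powr (-N/2 - 1) \<le> ((norm z)\<^sup>2) powr (-N/2-1)" using N False by (intro powr_mono2') auto
      also have "((norm z)\<^sup>2) powr (-N/2-1) = (norm z powr 2) powr (-N/2-1)" using False by simp
      also have "\<dots> = norm z powr (2 * (-N/2-1))" by (rule powr_powr)
      also have "2 * (-N/2-1) = -N-2" by simp
      finally have "ennreal (?psi z) \<le> ennreal (N * norm z powr (-N-2))" using N by (intro ennreal_leI mult_left_mono) auto
      then show ?thesis using False N by (simp add: ennreal_mult)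
    qed
  qed
  also have "\<dots> = ennreal N * (\<integral>\<^sup>+z. (indicator (cball (0::real^'n) 1) z +
      ennreal (norm z powr (-N-2)) * indicator {y. 1 \<le> norm y} z) \<partial>lborel)"
    by (rule nn_integral_cmult) measurable
  also have "(\<integral>\<^sup>+z. (indicator (cball (0::real^'n) 1) z +
      ennreal (norm z powr (-N-2)) * indicator {y. 1 \<le> norm y} z) \<partial>lborel)
    = (\<integral>\<^sup>+z. indicator (cball (0::real^'n) 1) z \<partial>lborel) +
      (\<integral>\<^sup>+y. ennreal (norm (y::real^'n) powr (-N-2)) * indicator {y. 1 \<le> norm y} y \<partial>lborel)"
    by (rule nn_integral_add) measurable
  also have "(\<integral>\<^sup>+z. indicator (cball (0::real^'n) 1) z \<partial>lborel) = emeasure lborel (cball (0::real^'n) 1)"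
    by simp
  also have "ennreal N * (emeasure lborel (cball (0::real^'n) 1) +
      (\<integral>\<^sup>+y. ennreal (norm (y::real^'n) powr (-N-2)) * indicator {y. 1 \<le> norm y} y \<partial>lborel))
      \<le> ennreal N * (emeasure lborel (cball (0::real^'n) 1) + ennreal C)"
    by (intro mult_left_mono add_left_mono C) auto
  also have "\<dots> < \<infinity>" by (simp add: ennreal_mult_less_top emeasure_cball_less_top)
  finally show int: "integrable lborel ?psi"
    using ppos by (intro integrableI_bounded) (auto simp: abs_of_pos less_imp_le)
  have "(\<integral>z. ?psi z \<partial>lborel) \<noteq> 0"
  proof
    assume "(\<integral>z. ?psi z \<partial>lborel) = 0"
    then have "AE z in lborel. ?psi z = 0"
      using integral_nonneg_eq_0_iff_AE[OF int] ppos by (simp add: less_imp_le)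
    then have "AE z in (lborel :: (real^'n) measure). False" by eventually_elim (use ppos in \<open>metis less_irrefl\<close>)
    then show False by (simp add: AE_iff_null null_sets_def)
  qed
  moreover have "(\<integral>z. ?psi z \<partial>lborel) \<ge> 0" using ppos by (intro integral_nonneg_AE AE_I2) (rule less_imp_le)
  ultimately show "(\<integral>z. ?psi z \<partial>lborel) > 0" by (simp only: order.strict_iff_order) (metis)
qed

lemma integrable_sing:
  fixes f :: "real^'n::finite \<Rightarrow> real"
  assumes f: "continuous_on UNIV f" "\<And>x. norm x > R \<Longrightarrow> f x = 0" and s: "s < real CARD('n)"
  shows "integrable lborel (\<lambda>y. \<bar>f y\<bar> * norm (x - y) powr (-s))"
proof -
  obtain B where B: "B \<ge> 0" "\<And>x. \<bar>f x\<bar> \<le> B" using bounded_compact_support[OF f] by blast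
  have [measurable]: "f \<in> borel_measurable borel" using f(1) by (rule borel_measurable_continuous_onI)
  define R1 where "R1 = norm x + \<bar>R\<bar> + 1"
  have R1: "R1 > 0" by (simp add: R1_def add_nonneg_pos)
  have [measurable]: "cball x R1 \<in> sets borel" by simp
  obtain C where C: "(\<integral>\<^sup>+y. ennreal (norm (x - y) powr (-s)) * indicator (cball x R1) y \<partial>lborel) \<le> ennreal C"
    using nn_integral_powr_ball[where 'a = "real^'n" and q = "-s"] s R1 by auto
  have "(\<integral>\<^sup>+y. ennreal (\<bar>f y\<bar> * norm (x - y) powr (-s)) \<partial>lborel)
     \<le> (\<integral>\<^sup>+y. ennreal B * (ennreal (norm (x - y) powr (-s)) * indicator (cball x R1) y) \<partial>lborel)"
  proof (rule nn_integral_mono)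
    fix y
    show "ennreal (\<bar>f y\<bar> * norm (x - y) powr (-s)) \<le> ennreal B * (ennreal (norm (x - y) powr (-s)) * indicator (cball x R1) y)"
    proof (cases "norm y > R")
      case True then show ?thesis using f by simp
    next
      case False
      then have "y \<in> cball x R1" using norm_triangle_ineq4[of x y] by (simp add: dist_norm R1_def)
      then show ?thesis using B by (simp add: ennreal_mult[symmetric] mult_right_mono ennreal_leI)
    qed
  qed
  also have "\<dots> = ennreal B * (\<integral>\<^sup>+y. ennreal (norm (x - y) powr (-s)) * indicator (cball x R1) y \<partial>lborel)"
    by (rule nn_integral_cmult) measurable
  also have "\<dots> \<le> ennreal B * ennreal C" by (intro mult_left_mono C) auto
  also have "\<dots> < \<infinity>" by (simp add: ennreal_mult_less_top)
  finally show ?thesis by (intro integrableI_nonneg AE_I2) auto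
qed

lemma newton_measurable [measurable]: "newton \<in> borel_measurable borel"
  unfolding newton_def[abs_def] newton_profile_def by (cases "real CARD('a) = 2") auto

lemma sing_order_less: "N \<ge> 2 \<Longrightarrow> sing_order N < N" "N \<ge> 2 \<Longrightarrow> 0 < sing_order N" by (auto simp: sing_order_def)

text \<open>The integral of the Laplacian against the regularised kernel is passed to the limit in
  two ways: by dominated convergence towards the kernel itself, and after the substitution towards
  the mass of \<open>psi\<close> times \<open>u x\<close>. Hence the constant is the same for all
  \<open>u\<close> and \<open>x\<close>.\<close>

theorem newton_representation:
  assumes N2: "CARD('n::finite) \<ge> 2"
  shows "\<exists>c>0. \<forall>u :: real^'n \<Rightarrow> real. test_fun u \<longrightarrow> (\<forall>x.
     integrable lborel (\<lambda>y. newton (x - y) * laplacian u y) \<and>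
     (\<integral>y. newton (x - y) * laplacian u y \<partial>lborel) = c * u x)"
proof -
  define N where "N = real CARD('n)"
  have N: "N \<ge> 2" using N2 by (simp add: N_def)
  define psi where "psi = (\<lambda>z::real^'n. N * (1 + (norm z)\<^sup>2) powr (-N/2 - 1))"
  have psi: "integrable lborel psi" "(\<integral>z. psi z \<partial>lborel) > 0"
    using psi_integrable[where 'n='n] by (simp_all add: psi_def N_def)
  have psi_pos: "psi z \<ge> 0" for z using N by (simp add: psi_def)
  have [measurable]: "psi \<in> borel_measurable borel" unfolding psi_def by measurable
  have "integrable lborel (\<lambda>y. newton (x - y) * laplacian u y) \<and>
     (\<integral>y. newton (x - y) * laplacian u y \<partial>lborel) = (\<integral>z. psi z \<partial>lborel) * u x" if u: "test_fun u" for u :: "real^'n \<Rightarrow> real" and x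
  proof -
    have sm: "smooth_fun u" using u by (simp add: test_fun_def)
    obtain r R where rR: "0 < r" "r < R" "\<And>x. norm x > R \<Longrightarrow> u x = 0" "\<And>x. norm x > R \<Longrightarrow> laplacian u x = 0"
      using test_fun_support[OF u] by metis
    note sf = smooth_facts[OF sm]
    have [measurable]: "u \<in> borel_measurable borel" "laplacian u \<in> borel_measurable borel"
      using sf by (auto intro: borel_measurable_continuous_onI)
    define R1 where "R1 = norm x + R + 1"
    have R1: "R1 > 0" using rR by (simp add: R1_def add_nonneg_pos)
    obtain D where D: "D \<ge> 0" "\<And>e r. 0 \<le> e \<Longrightarrow> e \<le> 1 \<Longrightarrow> 0 < r \<Longrightarrow> r \<le> R1 \<Longrightarrow> \<bar>newton_profile N (r\<^sup>2 + e)\<bar> \<le> D * r powr (- sing_order N)"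
      using newton_profile_bound[OF N R1] by blast
    define dom where "dom y = D * (\<bar>laplacian u y\<bar> * norm (x - y) powr (- sing_order N))" for y
    have dom: "integrable lborel dom" unfolding dom_def
      using sing_order_less[OF N] rR(4) by (intro integrable_mult_right integrable_sing[OF sf(6)]) (auto simp: N_def)
    \<comment> \<open>Used with \<open>e = 0\<close> for the kernel and with
      \<open>e = (h n)^2\<close> for its regularisations.\<close>
    have bnd: "\<bar>laplacian u y * newton_profile N ((norm (y - x))\<^sup>2 + e)\<bar> \<le> dom y" if "0 \<le> e" "e \<le> 1" "y \<noteq> x" for y e
    proof (cases "norm y > R")
      case True then show ?thesis using rR D by (simp add: dom_def)
    next
      case False
      then have "norm (x - y) \<le> R1" using norm_triangle_ineq4[of x y] by (simp add: R1_def)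
      then have "\<bar>newton_profile N ((norm (y - x))\<^sup>2 + e)\<bar> \<le> D * norm (x - y) powr (- sing_order N)"
        using D(2)[of e "norm (x - y)"] that by (simp add: norm_minus_commute)
      from mult_left_mono[OF this, of "\<bar>laplacian u y\<bar>"] show ?thesis
        by (simp add: dom_def abs_mult mult_ac)
    qed
    have nw: "newton (x - y) = newton_profile N ((norm (y - x))\<^sup>2 + 0)" for y by (simp add: newton_def N_def norm_minus_commute)
    have AEx: "AE y in lborel. y \<noteq> x" by (rule AE_lborel_singleton)
    have int: "integrable lborel (\<lambda>y. newton (x - y) * laplacian u y)"
    proof (rule Bochner_Integration.integrable_bound[OF dom])
      show "AE y in lborel. norm (newton (x - y) * laplacian u y) \<le> norm (dom y)"
        using AEx
      proof eventually_elim
        case (elim y)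
        then show ?case using bnd[of 0 y] unfolding nw by (simp add: mult.commute)
      qed
    qed measurable
    define h where "h n = 1 / real (Suc n)" for n
    have h: "h n > 0" "h n \<le> 1" for n by (auto simp: h_def)
    have h0: "h \<longlonglongrightarrow> 0" unfolding h_def using LIMSEQ_inverse_real_of_nat by (simp add: inverse_eq_divide)
    have L1: "(\<lambda>n. \<integral>y. laplacian u y * newton_profile N ((norm (y - x))\<^sup>2 + (h n)\<^sup>2) \<partial>lborel)
        \<longlonglongrightarrow> (\<integral>y. newton (x - y) * laplacian u y \<partial>lborel)"
    proof (rule integral_dominated_convergence[OF _ _ dom])
      have [measurable]: "newton_profile N \<in> borel_measurable borel" unfolding newton_profile_def[abs_def] by (cases "N = 2") auto
      show "(\<lambda>y. laplacian u y * newton_profile N ((norm (y - x))\<^sup>2 + (h n)\<^sup>2)) \<in> borel_measurable lborel" for n by measurable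
      show "AE y in lborel. norm (laplacian u y * newton_profile N ((norm (y - x))\<^sup>2 + (h n)\<^sup>2)) \<le> dom y" for n
        using AEx by eventually_elim (use bnd[of "(h n)\<^sup>2"] h[of n] in \<open>auto simp: power_le_one\<close>)
      show "AE y in lborel. (\<lambda>n. laplacian u y * newton_profile N ((norm (y - x))\<^sup>2 + (h n)\<^sup>2)) \<longlonglongrightarrow> newton (x - y) * laplacian u y"
        using AEx
      proof eventually_elim
        case (elim y)
        then have "norm (y - x) > 0" by simp
        then have "(norm (y - x))\<^sup>2 + 0\<^sup>2 > 0" by simp
        then have "isCont (newton_profile N) ((norm (y - x))\<^sup>2 + 0\<^sup>2)" by (rule DERIV_isCont[OF newton_profile_deriv])
        moreover have "(\<lambda>n. (norm (y - x))\<^sup>2 + (h n)\<^sup>2) \<longlonglongrightarrow> (norm (y - x))\<^sup>2 + 0\<^sup>2"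
          by (intro tendsto_add tendsto_const tendsto_power h0)
        ultimately have "(\<lambda>n. newton_profile N ((norm (y - x))\<^sup>2 + (h n)\<^sup>2)) \<longlonglongrightarrow> newton_profile N ((norm (y - x))\<^sup>2 + 0\<^sup>2)"
          by (rule isCont_tendsto_compose)
        then have "(\<lambda>n. laplacian u y * newton_profile N ((norm (y - x))\<^sup>2 + (h n)\<^sup>2)) \<longlonglongrightarrow> laplacian u y * newton_profile N ((norm (y - x))\<^sup>2 + 0\<^sup>2)"
          by (intro tendsto_mult tendsto_const)
        then show ?case unfolding nw by (simp add: mult.commute)
      qed
    qed measurable
    obtain B where B: "B \<ge> 0" "\<And>x. \<bar>u x\<bar> \<le> B" using bounded_compact_support[OF sf(1) rR(3)] by blast
    have L2: "(\<lambda>n. \<integral>z. u (x + h n *\<^sub>R z) * psi z \<partial>lborel) \<longlonglongrightarrow> (\<integral>z. u x * psi z \<partial>lborel)"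
    proof (rule integral_dominated_convergence)
      show "integrable lborel (\<lambda>z. B * psi z)" using psi by simp
      show "AE z in lborel. norm (u (x + h n *\<^sub>R z) * psi z) \<le> B * psi z" for n
        using B psi_pos by (auto simp: abs_mult intro!: mult_right_mono)
      show "AE z in lborel. (\<lambda>n. u (x + h n *\<^sub>R z) * psi z) \<longlonglongrightarrow> u x * psi z"
      proof (rule AE_I2)
        fix z
        have "(\<lambda>n. x + h n *\<^sub>R z) \<longlonglongrightarrow> x + 0 *\<^sub>R z" by (intro tendsto_intros h0)
        moreover have "isCont u (x + 0 *\<^sub>R z)" using sf(1) by (simp add: continuous_on_eq_continuous_at)
        ultimately have "(\<lambda>n. u (x + h n *\<^sub>R z)) \<longlonglongrightarrow> u (x + 0 *\<^sub>R z)" by (metis isCont_tendsto_compose)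
        then show "(\<lambda>n. u (x + h n *\<^sub>R z) * psi z) \<longlonglongrightarrow> u x * psi z" by (intro tendsto_mult tendsto_const) simp
      qed
    qed measurable
    have "(\<integral>y. newton (x - y) * laplacian u y \<partial>lborel) = (\<integral>z. u x * psi z \<partial>lborel)"
    proof (rule LIMSEQ_unique[OF L1])
      show "(\<lambda>n. \<integral>y. laplacian u y * newton_profile N ((norm (y - x))\<^sup>2 + (h n)\<^sup>2) \<partial>lborel) \<longlonglongrightarrow> (\<integral>z. u x * psi z \<partial>lborel)"
        using L2 green_reg[OF sm rR(3) h(1), where x = x] unfolding psi_def N_def by simp
    qed
    then show ?thesis using int by (simp add: mult.commute)
  qed
  then show ?thesis using psi(2) by blast
qed

section \<open>Expansion of the Newtonian kernel\<close>

text \<open>Leading coefficients of the derivatives of \<open>newton_profile N (1 + z)\<close>. The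
  pattern starts at order 1, where the logarithmic and the power case agree; the value at 0 is a
  dummy.\<close>

fun profile_const :: "real \<Rightarrow> nat \<Rightarrow> real" where
  "profile_const N 0 = 0"
| "profile_const N (Suc 0) = 1/2"
| "profile_const N (Suc (Suc n)) = profile_const N (Suc n) * (1 - N/2 - real (Suc n))"

fun profile_derivs :: "real \<Rightarrow> nat \<Rightarrow> real \<Rightarrow> real" where
  "profile_derivs N 0 z = newton_profile N (1 + z)"
| "profile_derivs N (Suc n) z = profile_const N (Suc n) * (1 + z) powr (1 - N/2 - real (Suc n))"

lemma profile_derivs_deriv:
  assumes "\<bar>z\<bar> < 1" shows "(profile_derivs N n has_real_derivative profile_derivs N (Suc n) z) (at z)"
proof (cases n)
  case 0
  have "((\<lambda>z. newton_profile N (1 + z)) has_real_derivative (1 + z) powr (-N/2) / 2 * 1) (at z)"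
    by (rule DERIV_chain2[OF newton_profile_deriv]) (use assms in \<open>auto intro!: derivative_eq_intros\<close>)
  moreover have "profile_derivs N 0 = (\<lambda>z. newton_profile N (1 + z))" by (rule ext) simp
  ultimately show ?thesis using 0 by simp
next
  case (Suc m)
  have "((\<lambda>z. (1 + z) powr (1 - N/2 - real (Suc m))) has_real_derivative
     (1 - N/2 - real (Suc m)) * (1 + z) powr (1 - N/2 - real (Suc m) - 1) * 1) (at z)"
    by (rule DERIV_chain2[OF has_real_derivative_powr]) (use assms in \<open>auto intro!: derivative_eq_intros\<close>)
  moreover have "profile_const N (Suc m) * ((1 - N/2 - real (Suc m)) * (1 + z) powr (1 - N/2 - real (Suc m) - 1) * 1)
      = profile_const N (Suc (Suc m)) * (1 + z) powr (1 - N/2 - real (Suc (Suc m)))"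
  proof -
    have "1 - N/2 - real (Suc m) - 1 = 1 - N/2 - real (Suc (Suc m))" by simp
    then show ?thesis by (simp only: profile_const.simps(3) mult_1_right mult.assoc)
  qed
  ultimately have "((\<lambda>z. profile_const N (Suc m) * (1 + z) powr (1 - N/2 - real (Suc m))) has_real_derivative
     profile_const N (Suc (Suc m)) * (1 + z) powr (1 - N/2 - real (Suc (Suc m)))) (at z)"
    using DERIV_cmult[where c = "profile_const N (Suc m)"] by metis
  moreover have "profile_derivs N (Suc m) = (\<lambda>z. profile_const N (Suc m) * (1 + z) powr (1 - N/2 - real (Suc m)))" by (rule ext) simp
  ultimately show ?thesis using Suc by simp
qed

definition profile_taylor :: "real \<Rightarrow> nat \<Rightarrow> real" where "profile_taylor N j = profile_derivs N j 0 / fact j"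

text \<open>The coefficient of \<open>t^n\<close> in \<open>newton_profile N (1 + (t\<^sup>2 - 2ts))\<close>; up to normalisation this is the Gegenbauer polynomial.\<close>

definition gegenbauer :: "real \<Rightarrow> nat \<Rightarrow> real \<Rightarrow> real" where
  "gegenbauer N n s = (\<Sum>j\<le>n. profile_taylor N j * real (j choose (n - j)) * (-2 * s) ^ (j - (n - j)))"

lemma gegenbauer_bound: "\<exists>A\<ge>0. \<forall>s. \<bar>s\<bar> \<le> 1 \<longrightarrow> \<bar>gegenbauer N n s\<bar> \<le> A"
proof (intro exI conjI allI impI)
  show "0 \<le> (\<Sum>j\<le>n. \<bar>profile_taylor N j\<bar> * real (j choose (n - j)) * 2 ^ (j - (n - j)))"
    by (intro sum_nonneg) auto
  fix s :: real assume s: "\<bar>s\<bar> \<le> 1"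
  show "\<bar>gegenbauer N n s\<bar> \<le> (\<Sum>j\<le>n. \<bar>profile_taylor N j\<bar> * real (j choose (n - j)) * 2 ^ (j - (n - j)))"
    unfolding gegenbauer_def
  proof (rule order_trans[OF sum_abs], rule sum_mono)
    fix j
    have "\<bar>-2 * s\<bar> ^ (j - (n - j)) \<le> 2 ^ (j - (n - j))" using s by (intro power_mono) (auto simp: abs_mult)
    moreover have "\<bar>profile_taylor N j * real (j choose (n - j)) * (- 2 * s) ^ (j - (n - j))\<bar>
        = \<bar>profile_taylor N j\<bar> * real (j choose (n - j)) * \<bar>-2 * s\<bar> ^ (j - (n - j))"
      by (simp only: abs_mult power_abs abs_of_nat)
    ultimately show "\<bar>profile_taylor N j * real (j choose (n - j)) * (- 2 * s) ^ (j - (n - j))\<bar> \<le> \<bar>profile_taylor N j\<bar> * real (j choose (n - j)) * 2 ^ (j - (n - j))"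
      by (simp only:) (intro mult_left_mono, auto)
  qed
qed

lemma newton_profile_taylor:
  assumes N: "N \<ge> 2"
  shows "\<exists>C\<ge>0. \<forall>z. \<bar>z\<bar> \<le> 9/16 \<longrightarrow> \<bar>newton_profile N (1 + z) - (\<Sum>j\<le>m. profile_taylor N j * z ^ j)\<bar> \<le> C * \<bar>z\<bar> ^ Suc m"
proof -
  \<comment> \<open>The radius 9/16 is the maximum of \<open>|t^2 - 2ts|\<close> for 0 \<le> t \<le>
    1/4 and |s| \<le> 1. At the intermediate point the base stays above 1 - 9/16 = 7/16, where the
    power with negative exponent is largest.\<close>
  define C where "C = \<bar>profile_const N (Suc m)\<bar> * (7/16) powr (1 - N/2 - real (Suc m)) / fact (Suc m)"
  have "\<bar>newton_profile N (1 + z) - (\<Sum>j\<le>m. profile_taylor N j * z ^ j)\<bar> \<le> C * \<bar>z\<bar> ^ Suc m" if z: "\<bar>z\<bar> \<le> 9/16" for z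
  proof -
    have "\<forall>k t. k < Suc m \<and> \<bar>t\<bar> \<le> \<bar>z\<bar> \<longrightarrow> DERIV (profile_derivs N k) t :> profile_derivs N (Suc k) t"
      using z by (intro allI impI profile_derivs_deriv) auto
    then obtain t where t: "\<bar>t\<bar> \<le> \<bar>z\<bar>" "profile_derivs N 0 z = (\<Sum>k<Suc m. profile_derivs N k 0 / fact k * z ^ k) + profile_derivs N (Suc m) t / fact (Suc m) * z ^ Suc m"
      using Maclaurin_bi_le[of "profile_derivs N" "profile_derivs N 0" "Suc m" z] by blast
    have "newton_profile N (1 + z) - (\<Sum>j\<le>m. profile_taylor N j * z ^ j) = profile_derivs N (Suc m) t / fact (Suc m) * z ^ Suc m"
      using t(2) by (simp add: profile_taylor_def lessThan_Suc_atMost del: profile_derivs.simps(2))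
    also have "\<bar>\<dots>\<bar> = \<bar>profile_const N (Suc m)\<bar> * (1 + t) powr (1 - N/2 - real (Suc m)) / fact (Suc m) * \<bar>z\<bar> ^ Suc m"
      by (simp add: abs_mult power_abs)
    also have "\<dots> \<le> C * \<bar>z\<bar> ^ Suc m"
      unfolding C_def using z t(1) N
      by (intro mult_right_mono divide_right_mono mult_left_mono powr_mono2') auto
    finally show ?thesis .
  qed
  moreover have "C \<ge> 0" by (simp add: C_def)
  ultimately show ?thesis by blast
qed

text \<open>Inserting \<open>z^j = t^j (t - 2s)^j\<close> and expanding by the binomial theorem
  gives monomials of degree \<open>j + i\<close> in \<open>t\<close>. Those of degree at most
  \<open>m\<close> regroup by degree into the Gegenbauer sums, and the finitely many others, indexed
  by \<open>S\<close>, carry a factor \<open>t^(m+1)\<close>.\<close>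

lemma newton_profile_expansion:
  assumes N: "N \<ge> 2"
  shows "\<exists>C\<ge>0. \<forall>t s. 0 \<le> t \<and> t \<le> 1/4 \<and> \<bar>s\<bar> \<le> 1 \<longrightarrow>
    \<bar>newton_profile N (1 + (t\<^sup>2 - 2 * t * s)) - (\<Sum>n\<le>m. gegenbauer N n s * t ^ n)\<bar> \<le> C * t ^ Suc m"
proof -
  obtain C where C: "C \<ge> 0" "\<And>z. \<bar>z\<bar> \<le> 9/16 \<Longrightarrow> \<bar>newton_profile N (1 + z) - (\<Sum>j\<le>m. profile_taylor N j * z ^ j)\<bar> \<le> C * \<bar>z\<bar> ^ Suc m"
    using newton_profile_taylor[OF N] by blast
  define S where "S = {..m} \<times> {..m} - {(i, j). i + j \<le> m}"
  have finS: "finite S" by (simp add: S_def)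
  define E where "E = (\<Sum>(j, i)\<in>S. \<bar>profile_taylor N j\<bar> * real (j choose i) * 2 ^ (j - i))"
  have E0: "E \<ge> 0" unfolding E_def by (intro sum_nonneg) auto
  have "\<bar>newton_profile N (1 + (t\<^sup>2 - 2 * t * s)) - (\<Sum>n\<le>m. gegenbauer N n s * t ^ n)\<bar> \<le> (C * (9/4) ^ Suc m + E) * t ^ Suc m"
    if t: "0 \<le> t" "t \<le> 1/4" and s: "\<bar>s\<bar> \<le> 1" for t s
  proof -
    define F where "F j i = profile_taylor N j * real (j choose i) * (-2 * s) ^ (j - i) * t ^ (j + i)" for j i
    define z where "z = t\<^sup>2 - 2 * t * s"
    have "\<bar>t * s\<bar> \<le> t * 1" using t s unfolding abs_mult by (intro mult_mono) auto
    moreover have "t\<^sup>2 \<le> t * (1/4)" using mult_left_mono[OF t(2) t(1)] by (simp add: power2_eq_square)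
    moreover have "t\<^sup>2 \<ge> 0" by simp
    ultimately have "t\<^sup>2 - 2 * t * s \<le> 9/4 * t" "- (t\<^sup>2 - 2 * t * s) \<le> 9/4 * t"
      unfolding abs_le_iff mult.assoc by linarith+
    then have z: "\<bar>z\<bar> \<le> 9/4 * t" unfolding z_def abs_le_iff by blast
    have pw: "profile_taylor N j * z ^ j = (\<Sum>i\<le>m. F j i)" if j: "j \<le> m" for j
    proof -
      have "z ^ j = (t * (t + (-2 * s))) ^ j" by (simp add: z_def algebra_simps power2_eq_square)
      also have "\<dots> = t ^ j * (\<Sum>i\<le>j. real (j choose i) * t ^ i * (-2 * s) ^ (j - i))"
        unfolding power_mult_distrib binomial_ring by simp
      finally have "profile_taylor N j * z ^ j = (\<Sum>i\<le>j. F j i)"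
        by (simp add: F_def sum_distrib_left power_add mult_ac)
      \<comment> \<open>Extending the range to \<open>m\<close> adds only zeros, because the
        binomial coefficients vanish; this also disarms the truncated subtraction in the exponent
        \<open>j - i\<close>.\<close>
      also have "\<dots> = (\<Sum>i\<le>m. F j i)"
        using j by (intro sum.mono_neutral_left) (auto simp: F_def not_le binomial_eq_0)
      finally show ?thesis .
    qed
    have "(\<Sum>j\<le>m. profile_taylor N j * z ^ j) = (\<Sum>(j, i)\<in>{..m} \<times> {..m}. F j i)"
      by (simp add: pw sum.cartesian_product)
    also have "\<dots> = (\<Sum>(j, i)\<in>{(i, j). i + j \<le> m}. F j i) + (\<Sum>(j, i)\<in>S. F j i)"
    proof -
      have "{(i, j). i + j \<le> m} \<subseteq> {..m} \<times> {..m}" by auto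
      from sum.subset_diff[OF this, of "\<lambda>(j, i). F j i"] show ?thesis by (simp add: S_def add.commute)
    qed
    also have "(\<Sum>(j, i)\<in>{(i, j). i + j \<le> m}. F j i) = (\<Sum>n\<le>m. \<Sum>j\<le>n. F j (n - j))"
      by (rule sum.triangle_reindex_eq)
    also have "\<dots> = (\<Sum>n\<le>m. gegenbauer N n s * t ^ n)"
      by (intro sum.cong refl) (simp add: gegenbauer_def F_def sum_distrib_right)
    finally have eq: "(\<Sum>j\<le>m. profile_taylor N j * z ^ j) = (\<Sum>n\<le>m. gegenbauer N n s * t ^ n) + (\<Sum>(j, i)\<in>S. F j i)" .
    have "\<bar>\<Sum>(j, i)\<in>S. F j i\<bar> \<le> (\<Sum>(j, i)\<in>S. \<bar>profile_taylor N j\<bar> * real (j choose i) * 2 ^ (j - i) * t ^ Suc m)"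
    proof (rule order_trans[OF sum_abs], rule sum_mono, clarify)
      fix j i assume "(j, i) \<in> S"
      then have ij: "j + i \<ge> Suc m" by (auto simp: S_def)
      have a: "\<bar>-2 * s\<bar> ^ (j - i) \<le> 2 ^ (j - i)" using s by (intro power_mono) (auto simp: abs_mult)
      have b: "t ^ (j + i) \<le> t ^ Suc m" using t ij by (intro power_decreasing) auto
      have "\<bar>F j i\<bar> = \<bar>profile_taylor N j\<bar> * real (j choose i) * \<bar>-2 * s\<bar> ^ (j - i) * t ^ (j + i)"
        unfolding F_def using t by (simp only: abs_mult power_abs abs_of_nat abs_of_nonneg)
      then show "\<bar>F j i\<bar> \<le> \<bar>profile_taylor N j\<bar> * real (j choose i) * 2 ^ (j - i) * t ^ Suc m"
        by (simp only:) (intro mult_mono[OF _ b] mult_left_mono[OF a], use t in auto)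
    qed
    also have "\<dots> = E * t ^ Suc m" unfolding E_def sum_distrib_right by (intro sum.cong) auto
    finally have 1: "\<bar>\<Sum>(j, i)\<in>S. F j i\<bar> \<le> E * t ^ Suc m" .
    have "\<bar>newton_profile N (1 + z) - (\<Sum>j\<le>m. profile_taylor N j * z ^ j)\<bar> \<le> C * \<bar>z\<bar> ^ Suc m" using z t by (intro C) auto
    also have "\<dots> \<le> C * (9/4 * t) ^ Suc m" using z C(1) by (intro mult_left_mono power_mono) auto
    also have "\<dots> = C * (9/4) ^ Suc m * t ^ Suc m" by (simp only: power_mult_distrib mult.assoc)
    finally have 2: "\<bar>newton_profile N (1 + z) - (\<Sum>j\<le>m. profile_taylor N j * z ^ j)\<bar> \<le> C * (9/4) ^ Suc m * t ^ Suc m" .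
    have "\<bar>newton_profile N (1 + z) - (\<Sum>n\<le>m. gegenbauer N n s * t ^ n)\<bar> \<le> C * (9/4) ^ Suc m * t ^ Suc m + E * t ^ Suc m"
      using 1 2 unfolding eq by linarith
    then show ?thesis unfolding z_def by (simp add: distrib_right)
  qed
  moreover have "C * (9/4) ^ Suc m + E \<ge> 0" using C(1) E0 by simp
  ultimately show ?thesis by blast
qed

text \<open>The defect of homogeneity of the Newtonian kernel, present only in dimension 2.\<close>

definition log_part :: "real \<Rightarrow> real \<Rightarrow> real" where "log_part N r = (if N = 2 then ln r else 0)"

lemma newton_profile_scale:
  assumes "r > 0" "b > 0"
  shows "newton_profile N (r\<^sup>2 * b) = log_part N r + r powr (2 - N) * newton_profile N b"
proof (cases "N = 2")
  case True
  have "ln (r\<^sup>2 * b) = 2 * ln r + ln b" using assms by (simp add: ln_mult ln_realpow)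
  then have "ln (r\<^sup>2 * b) / 2 = ln r + ln b / 2" by simp
  then show ?thesis using True assms(1) unfolding newton_profile_def log_part_def by simp
next
  case False
  have "(r\<^sup>2) powr (1 - N/2) = (r powr 2) powr (1 - N/2)" using assms by simp
  also have "\<dots> = r powr (2 * (1 - N/2))" by (rule powr_powr)
  also have "2 * (1 - N/2) = 2 - N" by simp
  finally show ?thesis using False assms by (simp add: newton_profile_def log_part_def powr_mult)
qed

text \<open>For \<open>y = 0\<close> the cosine is 0 by the convention for division. This is
  harmless: for \<open>n > 0\<close> the power of the norm vanishes, and for \<open>n = 0\<close>
  the Gegenbauer factor is constant.\<close>

definition newton_term :: "nat \<Rightarrow> real^'n::finite \<Rightarrow> real^'n \<Rightarrow> real" where
  "newton_term n x y = norm x powr (2 - real CARD('n)) * (norm y / norm x) ^ n *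
     gegenbauer (real CARD('n)) n (x \<bullet> y / (norm x * norm y))"

definition newton_rest :: "nat \<Rightarrow> real^'n::finite \<Rightarrow> real^'n \<Rightarrow> real" where
  "newton_rest m x y = newton (x - y) - log_part (real CARD('n)) (norm x) - (\<Sum>n\<le>m. newton_term n x y)"

lemma cos_bound: "\<bar>x \<bullet> y / (norm x * norm y)\<bar> \<le> 1" for x y :: "'a::real_inner"
proof (cases "norm x * norm y = 0")
  case False
  then have "norm x * norm y > 0" by (simp add: zero_less_mult_iff)
  then show ?thesis using Cauchy_Schwarz_ineq2[of x y] by (simp add: abs_divide)
qed (auto simp: field_simps)

lemma newton_term_bound:
  "\<exists>A\<ge>0. \<forall>x y::real^'n::finite. \<bar>newton_term n x y\<bar> \<le> norm x powr (2 - real CARD('n)) * (A * (norm y / norm x) ^ n)"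
proof -
  obtain A where A: "A \<ge> 0" "\<And>s. \<bar>s\<bar> \<le> 1 \<Longrightarrow> \<bar>gegenbauer (real CARD('n)) n s\<bar> \<le> A" using gegenbauer_bound by blast
  have "\<bar>newton_term n x y\<bar> \<le> norm x powr (2 - real CARD('n)) * (A * (norm y / norm x) ^ n)" for x y :: "real^'n"
  proof -
    have "\<bar>newton_term n x y\<bar> = norm x powr (2 - real CARD('n)) * (norm y / norm x) ^ n * \<bar>gegenbauer (real CARD('n)) n (x \<bullet> y / (norm x * norm y))\<bar>"
      by (simp add: newton_term_def abs_mult)
    also have "\<dots> \<le> norm x powr (2 - real CARD('n)) * (norm y / norm x) ^ n * A"
      by (intro mult_left_mono A(2) cos_bound) auto
    finally show ?thesis by (simp add: mult_ac)
  qed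
  then show ?thesis using A(1) by blast
qed

lemma newton_term_scale: "t > 0 \<Longrightarrow> newton_term n x (t *\<^sub>R y) = t ^ n * newton_term n x y"
proof -
  assume t: "t > 0"
  have "x \<bullet> (t *\<^sub>R y) / (norm x * norm (t *\<^sub>R y)) = x \<bullet> y / (norm x * norm y)" using t by simp
  then show ?thesis using t by (simp add: newton_term_def power_mult_distrib power_divide)
qed

lemma gegenbauer_measurable [measurable]: "gegenbauer N n \<in> borel_measurable borel"
  unfolding gegenbauer_def[abs_def] by measurable

lemma log_part_measurable [measurable]: "log_part N \<in> borel_measurable borel"
  unfolding log_part_def[abs_def] by (cases "N = 2") auto

lemma newton_term_measurable [measurable]:
  assumes [measurable]: "f \<in> borel_measurable M" "g \<in> borel_measurable M"
  shows "(\<lambda>z. newton_term n (f z) (g z)) \<in> borel_measurable M"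
  unfolding newton_term_def by measurable

lemma newton_rest_measurable [measurable]:
  assumes [measurable]: "f \<in> borel_measurable M" "g \<in> borel_measurable M"
  shows "(\<lambda>z. newton_rest m (f z) (g z)) \<in> borel_measurable M"
  unfolding newton_rest_def by measurable

text \<open>Scaling by \<open>1/|x|\<close> and the law of cosines put the kernel into the form of
  the one-variable expansion, with \<open>t = |y|/|x|\<close> and \<open>s\<close> the cosine of the
  angle.\<close>

lemma newton_expand:
  fixes x y :: "real^'n::finite"
  assumes x: "x \<noteq> 0" and xy: "x \<noteq> y"
  defines "N \<equiv> real CARD('n)" and "r \<equiv> norm (x - y) / norm x"
  shows "newton (x - y) - log_part N (norm x) = norm x powr (2 - N) * newton_profile N (r\<^sup>2)"
    and "r\<^sup>2 = 1 + ((norm y / norm x)\<^sup>2 - 2 * (norm y / norm x) * (x \<bullet> y / (norm x * norm y)))"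
proof -
  have r: "r > 0" using x xy by (simp add: r_def)
  have "(norm (x - y))\<^sup>2 = (norm x)\<^sup>2 * r\<^sup>2" using x by (simp add: r_def power_divide)
  then show "newton (x - y) - log_part N (norm x) = norm x powr (2 - N) * newton_profile N (r\<^sup>2)"
    using newton_profile_scale[of "norm x" "r\<^sup>2" N] x r by (simp add: newton_def N_def)
  have "(norm (x - y))\<^sup>2 = (norm x)\<^sup>2 - 2 * (x \<bullet> y) + (norm y)\<^sup>2"
    unfolding power2_norm_eq_inner by (simp add: inner_diff_left inner_diff_right inner_commute[of y x])
  moreover have "y = 0 \<or> norm y > 0" by simp
  ultimately show "r\<^sup>2 = 1 + ((norm y / norm x)\<^sup>2 - 2 * (norm y / norm x) * (x \<bullet> y / (norm x * norm y)))"
    using x by (auto simp: r_def power_divide field_simps power2_eq_square)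
qed

lemma newton_rest_inner:
  assumes N2: "CARD('n::finite) \<ge> 2"
  shows "\<exists>A\<ge>0. \<forall>x y::real^'n. x \<noteq> 0 \<and> norm y \<le> norm x / 4 \<longrightarrow>
     \<bar>newton_rest m x y\<bar> \<le> norm x powr (2 - real CARD('n)) * (A * (norm y / norm x) ^ Suc m)"
proof -
  define N where "N = real CARD('n)"
  have N: "N \<ge> 2" using N2 by (simp add: N_def)
  obtain C where C: "C \<ge> 0" "\<And>t s. 0 \<le> t \<Longrightarrow> t \<le> 1/4 \<Longrightarrow> \<bar>s\<bar> \<le> 1 \<Longrightarrow>
    \<bar>newton_profile N (1 + (t\<^sup>2 - 2 * t * s)) - (\<Sum>n\<le>m. gegenbauer N n s * t ^ n)\<bar> \<le> C * t ^ Suc m"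
    using newton_profile_expansion[OF N] by blast
  have "\<bar>newton_rest m x y\<bar> \<le> norm x powr (2 - N) * (C * (norm y / norm x) ^ Suc m)"
    if x: "x \<noteq> 0" "norm y \<le> norm x / 4" for x y :: "real^'n"
  proof -
    have xy: "x \<noteq> y" using x by auto
    define t where "t = norm y / norm x"
    define s where "s = x \<bullet> y / (norm x * norm y)"
    have t: "0 \<le> t" "t \<le> 1/4" using x by (auto simp: t_def field_simps)
    have "newton_rest m x y = norm x powr (2 - N) * newton_profile N (1 + (t\<^sup>2 - 2 * t * s)) - (\<Sum>n\<le>m. newton_term n x y)"
      using newton_expand[OF x(1) xy] by (simp add: newton_rest_def N_def t_def s_def)
    also have "(\<Sum>n\<le>m. newton_term n x y) = norm x powr (2 - N) * (\<Sum>n\<le>m. gegenbauer N n s * t ^ n)"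
      by (simp add: newton_term_def sum_distrib_left N_def t_def s_def mult_ac)
    finally have "\<bar>newton_rest m x y\<bar> = norm x powr (2 - N) * \<bar>newton_profile N (1 + (t\<^sup>2 - 2 * t * s)) - (\<Sum>n\<le>m. gegenbauer N n s * t ^ n)\<bar>"
      by (simp add: abs_mult flip: right_diff_distrib)
    also have "\<dots> \<le> norm x powr (2 - N) * (C * t ^ Suc m)"
      using cos_bound[of x y] by (intro mult_left_mono C t) (auto simp: s_def)
    finally show ?thesis by (simp add: t_def)
  qed
  then show ?thesis using C(1) unfolding N_def by blast
qed

lemma newton_term_sum_bound:
  "\<exists>A\<ge>0. \<forall>x y::real^'n::finite. \<bar>\<Sum>n\<le>m. newton_term n x y\<bar> \<le> norm x powr (2 - real CARD('n)) * (A * (max 1 (norm y / norm x)) ^ m)"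
proof -
  have "\<forall>n. \<exists>A\<ge>0. \<forall>x y::real^'n. \<bar>newton_term n x y\<bar> \<le> norm x powr (2 - real CARD('n)) * (A * (norm y / norm x) ^ n)"
    using newton_term_bound by blast
  then obtain A where A: "\<And>n. A n \<ge> 0" "\<And>n x y::real^'n. \<bar>newton_term n x y\<bar> \<le> norm x powr (2 - real CARD('n)) * (A n * (norm y / norm x) ^ n)"
    by metis
  have "\<bar>\<Sum>n\<le>m. newton_term n x y\<bar> \<le> norm x powr (2 - real CARD('n)) * ((\<Sum>n\<le>m. A n) * (max 1 (norm y / norm x)) ^ m)" for x y :: "real^'n"
  proof -
    have "\<bar>\<Sum>n\<le>m. newton_term n x y\<bar> \<le> (\<Sum>n\<le>m. norm x powr (2 - real CARD('n)) * (A n * (max 1 (norm y / norm x)) ^ m))"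
    proof (rule order_trans[OF sum_abs], rule sum_mono)
      fix n assume n: "n \<in> {..m}"
      have "(norm y / norm x) ^ n \<le> (max 1 (norm y / norm x)) ^ n" by (intro power_mono) auto
      also have "\<dots> \<le> (max 1 (norm y / norm x)) ^ m" using n by (intro power_increasing) auto
      finally show "\<bar>newton_term n x y\<bar> \<le> norm x powr (2 - real CARD('n)) * (A n * (max 1 (norm y / norm x)) ^ m)"
        using A(1)[of n] by (intro order_trans[OF A(2)[of n x y]] mult_left_mono) auto
    qed
    then show ?thesis by (simp add: sum_distrib_left sum_distrib_right)
  qed
  then show ?thesis using A(1) by (intro exI[of _ "\<Sum>n\<le>m. A n"]) (auto intro: sum_nonneg)
qed

text \<open>Far out the subtracted terms grow like the power \<open>m\<close> of the ratio of the
  norms. The scaled kernel itself is bounded for N > 2 and logarithmic for N = 2, and \<delta>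
  absorbs the logarithm.\<close>

lemma newton_rest_outer:
  assumes N2: "CARD('n::finite) \<ge> 2" and d: "\<delta> > 0"
  shows "\<exists>A\<ge>0. \<forall>x y::real^'n. x \<noteq> 0 \<and> norm y \<ge> 4 * norm x \<longrightarrow>
     \<bar>newton_rest m x y\<bar> \<le> norm x powr (2 - real CARD('n)) * (A * (norm y / norm x) powr (real m + \<delta>))"
proof -
  define N where "N = real CARD('n)"
  have N: "N \<ge> 2" using N2 by (simp add: N_def)
  obtain A where A: "A \<ge> 0" "\<And>x y::real^'n. \<bar>\<Sum>n\<le>m. newton_term n x y\<bar> \<le> norm x powr (2 - N) * (A * (max 1 (norm y / norm x)) ^ m)"
    using newton_term_sum_bound[where 'n='n and m = m] unfolding N_def by blast
  define D where "D = (if N = 2 then 1 / \<delta> else 1 / (N - 2))"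
  have D: "D \<ge> 0" using N d by (simp add: D_def)
  have G: "\<bar>newton_profile N (r\<^sup>2)\<bar> \<le> D * r powr \<delta>" if r: "r \<ge> 1" for r
  proof (cases "N = 2")
    case True
    have "ln (r powr \<delta>) \<le> r powr \<delta>" using r by (intro ln_bound) auto
    then have "ln r \<le> r powr \<delta> / \<delta>" using d by (simp add: field_simps)
    moreover have "ln r \<ge> 0" using r by simp
    ultimately show ?thesis using True r by (simp add: newton_profile_def D_def ln_realpow)
  next
    case False
    have "(r\<^sup>2) powr (1 - N/2) \<le> 1 powr (1 - N/2)" using r N by (intro powr_mono2') (auto simp: one_le_power)
    moreover have "1 \<le> r powr \<delta>" using r d by (simp add: ge_one_powr_ge_zero)
    ultimately have "(r\<^sup>2) powr (1 - N/2) \<le> r powr \<delta>" by simp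
    then show ?thesis using False N by (simp add: newton_profile_def D_def abs_divide divide_right_mono)
  qed
  define B where "B = D * 2 powr \<delta> + A"
  have "\<bar>newton_rest m x y\<bar> \<le> norm x powr (2 - N) * (B * (norm y / norm x) powr (real m + \<delta>))"
    if x: "x \<noteq> 0" "norm y \<ge> 4 * norm x" for x y :: "real^'n"
  proof -
    define \<rho> where "\<rho> = norm y / norm x"
    define r where "r = norm (x - y) / norm x"
    have \<rho>: "\<rho> \<ge> 4" using x by (simp add: \<rho>_def field_simps)
    have xy: "x \<noteq> y" using x by auto
    have "norm (x - y) \<le> 2 * norm y" using norm_triangle_ineq4[of x y] x(2) norm_ge_zero[of x] by linarith
    from divide_right_mono[OF this, of "norm x"] have r2: "r \<le> 2 * \<rho>" by (simp add: r_def \<rho>_def)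
    have "norm x \<le> norm (x - y)"
      using norm_triangle_ineq2[of y x] x(2) norm_ge_zero[of x] unfolding norm_minus_commute[of y x] by linarith
    then have r1: "r \<ge> 1" using x by (simp add: r_def field_simps)
    have le: "\<rho> powr \<delta> \<le> \<rho> powr (real m + \<delta>)" "\<rho> ^ m \<le> \<rho> powr (real m + \<delta>)"
    proof -
      show "\<rho> powr \<delta> \<le> \<rho> powr (real m + \<delta>)" using \<rho> by (intro powr_mono) auto
      have "\<rho> ^ m = \<rho> powr real m" using \<rho> by (simp add: powr_realpow)
      also have "\<dots> \<le> \<rho> powr (real m + \<delta>)" using \<rho> d by (intro powr_mono) auto
      finally show "\<rho> ^ m \<le> \<rho> powr (real m + \<delta>)" .
    qed
    have "\<bar>newton_profile N (r\<^sup>2)\<bar> \<le> D * r powr \<delta>" by (rule G[OF r1])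
    also have "\<dots> \<le> D * (2 * \<rho>) powr \<delta>" using r1 r2 d D by (intro mult_left_mono powr_mono2) auto
    also have "\<dots> = D * 2 powr \<delta> * \<rho> powr \<delta>" using \<rho> by (simp add: powr_mult)
    also have "\<dots> \<le> D * 2 powr \<delta> * \<rho> powr (real m + \<delta>)" using D le by (intro mult_left_mono) auto
    finally have 1: "norm x powr (2 - N) * \<bar>newton_profile N (r\<^sup>2)\<bar> \<le> norm x powr (2 - N) * (D * 2 powr \<delta> * \<rho> powr (real m + \<delta>))"
      by (intro mult_left_mono) auto
    have "max 1 \<rho> = \<rho>" using \<rho> by simp
    then have "\<bar>\<Sum>n\<le>m. newton_term n x y\<bar> \<le> norm x powr (2 - N) * (A * \<rho> ^ m)" using A(2)[of x y] by (simp add: \<rho>_def)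
    also have "\<dots> \<le> norm x powr (2 - N) * (A * \<rho> powr (real m + \<delta>))" using A(1) le by (intro mult_left_mono) auto
    finally have 2: "\<bar>\<Sum>n\<le>m. newton_term n x y\<bar> \<le> norm x powr (2 - N) * (A * \<rho> powr (real m + \<delta>))" .
    have "newton_rest m x y = norm x powr (2 - N) * newton_profile N (r\<^sup>2) - (\<Sum>n\<le>m. newton_term n x y)"
      using newton_expand(1)[OF x(1) xy] by (simp add: newton_rest_def N_def r_def)
    then have "\<bar>newton_rest m x y\<bar> \<le> norm x powr (2 - N) * \<bar>newton_profile N (r\<^sup>2)\<bar> + \<bar>\<Sum>n\<le>m. newton_term n x y\<bar>"
      by (metis abs_mult abs_of_nonneg abs_triangle_ineq4 powr_ge_zero)
    also have "\<dots> \<le> norm x powr (2 - N) * (D * 2 powr \<delta> * \<rho> powr (real m + \<delta>)) + norm x powr (2 - N) * (A * \<rho> powr (real m + \<delta>))"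
      using 1 2 by (rule add_mono)
    also have "\<dots> = norm x powr (2 - N) * (B * \<rho> powr (real m + \<delta>))" by (simp add: B_def algebra_simps)
    finally show ?thesis by (simp add: \<rho>_def)
  qed
  moreover have "B \<ge> 0" using D A(1) by (simp add: B_def)
  ultimately show ?thesis unfolding N_def by blast
qed

text \<open>The singularity comes from the kernel alone, because the subtracted terms are bounded
  here after scaling. Since |x - y| \<le> 5 |x|, the singular factor is bounded below and absorbs
  them.\<close>

lemma newton_rest_middle:
  assumes N2: "CARD('n::finite) \<ge> 2"
  shows "\<exists>A\<ge>0. \<forall>x y::real^'n. x \<noteq> 0 \<and> x \<noteq> y \<and> norm y \<le> 4 * norm x \<longrightarrow>
     \<bar>newton_rest m x y\<bar> \<le> norm x powr (2 - real CARD('n)) * (A * (norm (x - y) / norm x) powr (- sing_order (real CARD('n))))"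
proof -
  define N where "N = real CARD('n)"
  have N: "N \<ge> 2" using N2 by (simp add: N_def)
  obtain A where A: "A \<ge> 0" "\<And>x y::real^'n. \<bar>\<Sum>n\<le>m. newton_term n x y\<bar> \<le> norm x powr (2 - N) * (A * (max 1 (norm y / norm x)) ^ m)"
    using newton_term_sum_bound[where 'n='n and m = m] unfolding N_def by blast
  obtain D where D: "D \<ge> 0" "\<And>r. 0 < r \<Longrightarrow> r \<le> 5 \<Longrightarrow> \<bar>newton_profile N (r\<^sup>2 + 0)\<bar> \<le> D * r powr (- sing_order N)"
    using newton_profile_bound[OF N, of 5] by (metis order_refl zero_le_one zero_less_numeral)
  define B where "B = D + A * 4 ^ m * 5 powr (sing_order N)"
  have "\<bar>newton_rest m x y\<bar> \<le> norm x powr (2 - N) * (B * (norm (x - y) / norm x) powr (- sing_order N))"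
    if x: "x \<noteq> 0" "x \<noteq> y" "norm y \<le> 4 * norm x" for x y :: "real^'n"
  proof -
    define r where "r = norm (x - y) / norm x"
    have r0: "r > 0" using x by (simp add: r_def)
    have "norm (x - y) \<le> norm x + norm y" by (rule norm_triangle_ineq4)
    then have r5: "r \<le> 5" using x by (simp add: r_def field_simps)
    have 1: "norm x powr (2 - N) * \<bar>newton_profile N (r\<^sup>2)\<bar> \<le> norm x powr (2 - N) * (D * r powr (- sing_order N))"
      using D(2)[OF r0 r5] by (intro mult_left_mono) auto
    have "5 powr (- sing_order N) \<le> r powr (- sing_order N)" using r0 r5 sing_order_less[OF N] by (intro powr_mono2') auto
    then have s1: "1 \<le> 5 powr (sing_order N) * r powr (- sing_order N)" by (simp add: powr_minus field_simps)
    have "max 1 (norm y / norm x) ^ m \<le> 4 ^ m" using x by (intro power_mono) (auto simp: field_simps)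
    also have "\<dots> = 4 ^ m * 1" by simp
    also have "\<dots> \<le> 4 ^ m * (5 powr (sing_order N) * r powr (- sing_order N))" by (intro mult_left_mono s1) auto
    finally have "norm x powr (2 - N) * (A * max 1 (norm y / norm x) ^ m) \<le> norm x powr (2 - N) * (A * (4 ^ m * (5 powr (sing_order N) * r powr (- sing_order N))))"
      using A(1) by (intro mult_left_mono) auto
    then have 2: "\<bar>\<Sum>n\<le>m. newton_term n x y\<bar> \<le> norm x powr (2 - N) * (A * (4 ^ m * (5 powr (sing_order N) * r powr (- sing_order N))))"
      by (rule order_trans[OF A(2)])
    have "newton_rest m x y = norm x powr (2 - N) * newton_profile N (r\<^sup>2) - (\<Sum>n\<le>m. newton_term n x y)"
      using newton_expand(1)[OF x(1) x(2)] by (simp add: newton_rest_def N_def r_def)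
    then have "\<bar>newton_rest m x y\<bar> \<le> norm x powr (2 - N) * \<bar>newton_profile N (r\<^sup>2)\<bar> + \<bar>\<Sum>n\<le>m. newton_term n x y\<bar>"
      by (metis abs_mult abs_of_nonneg abs_triangle_ineq4 powr_ge_zero)
    also have "\<dots> \<le> norm x powr (2 - N) * (D * r powr (- sing_order N)) + norm x powr (2 - N) * (A * (4 ^ m * (5 powr (sing_order N) * r powr (- sing_order N))))"
      using 1 2 by (rule add_mono)
    also have "\<dots> = norm x powr (2 - N) * (B * r powr (- sing_order N))" by (simp add: B_def algebra_simps)
    finally show ?thesis by (simp add: r_def)
  qed
  moreover have "B \<ge> 0" using D A(1) by (simp add: B_def)
  ultimately show ?thesis unfolding N_def by blast
qed

section \<open>Vanishing moments and the Schur test\<close>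

text \<open>Comparing powers of the parameter \<open>t\<close> needs only the remainder estimate for each finite partial sum,
  so no series has to be integrated term by term.\<close>

lemma moments_vanish:
  fixes h :: "real \<Rightarrow> 'a \<Rightarrow> real" and d :: "nat \<Rightarrow> 'a \<Rightarrow> real" and f :: "'a \<Rightarrow> real"
  assumes T: "T > 0" and f: "integrable M f"
    and d: "\<And>n. integrable M (\<lambda>y. d n y * f y)"
    and rem: "\<And>m. \<exists>C\<ge>0. \<forall>t y. 0 < t \<and> t < T \<longrightarrow> \<bar>(h t y - (\<Sum>n\<le>m. t ^ n * d n y)) * f y\<bar> \<le> C * t ^ Suc m * \<bar>f y\<bar>"
    and h: "\<And>t. 0 < t \<Longrightarrow> t < T \<Longrightarrow> integrable M (\<lambda>y. h t y * f y)"
    and h0: "\<And>t. 0 < t \<Longrightarrow> t < T \<Longrightarrow> (\<integral>y. h t y * f y \<partial>M) = 0"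
  shows "(\<integral>y. d n y * f y \<partial>M) = 0"
proof (induction n rule: less_induct)
  case (less n)
  define I where "I = (\<integral>y. d n y * f y \<partial>M)"
  obtain C where C: "C \<ge> 0" "\<And>t y. 0 < t \<Longrightarrow> t < T \<Longrightarrow> \<bar>(h t y - (\<Sum>k\<le>n. t ^ k * d k y)) * f y\<bar> \<le> C * t ^ Suc n * \<bar>f y\<bar>"
    using rem[of n] by blast
  define F where "F = (\<integral>y. \<bar>f y\<bar> \<partial>M)"
  have F: "F \<ge> 0" unfolding F_def by simp
  \<comment> \<open>The lower moments vanish by the induction hypothesis, so \<open>t^n I\<close> is
    minus the integral of a remainder of order \<open>t^(n+1)\<close>. Dividing by
    \<open>t^n\<close> leaves a bound that tends to 0.\<close>
  have key: "\<bar>I\<bar> \<le> C * F * t" if t: "0 < t" "t < T" for t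
  proof -
    have sumint: "integrable M (\<lambda>y. \<Sum>k\<le>n. t ^ k * (d k y * f y))"
      by (intro Bochner_Integration.integrable_sum integrable_mult_right d)
    have eq: "(h t y - (\<Sum>k\<le>n. t ^ k * d k y)) * f y = h t y * f y - (\<Sum>k\<le>n. t ^ k * (d k y * f y))" for y
      by (simp add: left_diff_distrib sum_distrib_right mult.assoc)
    have "(\<integral>y. (h t y - (\<Sum>k\<le>n. t ^ k * d k y)) * f y \<partial>M)
        = (\<integral>y. h t y * f y \<partial>M) - (\<integral>y. (\<Sum>k\<le>n. t ^ k * (d k y * f y)) \<partial>M)"
      unfolding eq by (rule Bochner_Integration.integral_diff[OF h[OF t] sumint])
    also have "(\<integral>y. (\<Sum>k\<le>n. t ^ k * (d k y * f y)) \<partial>M) = (\<Sum>k\<le>n. \<integral>y. t ^ k * (d k y * f y) \<partial>M)"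
      by (intro Bochner_Integration.integral_sum integrable_mult_right d)
    also have "\<dots> = (\<Sum>k\<le>n. t ^ k * (\<integral>y. d k y * f y \<partial>M))" by simp
    also have "\<dots> = (\<Sum>k\<in>{n}. t ^ k * (\<integral>y. d k y * f y \<partial>M))"
      using less.IH by (intro sum.mono_neutral_right) auto
    also have "\<dots> = t ^ n * I" by (simp add: I_def)
    finally have "\<bar>t ^ n * I\<bar> = \<bar>\<integral>y. (h t y - (\<Sum>k\<le>n. t ^ k * d k y)) * f y \<partial>M\<bar>" using h0[OF t] by simp
    also have "\<dots> \<le> (\<integral>y. \<bar>(h t y - (\<Sum>k\<le>n. t ^ k * d k y)) * f y\<bar> \<partial>M)"
      by (rule integral_abs_bound)
    also have "\<dots> \<le> (\<integral>y. C * t ^ Suc n * \<bar>f y\<bar> \<partial>M)"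
    proof (rule integral_mono)
      show "integrable M (\<lambda>y. \<bar>(h t y - (\<Sum>k\<le>n. t ^ k * d k y)) * f y\<bar>)"
        unfolding eq by (intro integrable_abs Bochner_Integration.integrable_diff h t sumint)
      show "integrable M (\<lambda>y. C * t ^ Suc n * \<bar>f y\<bar>)" by (intro integrable_mult_right integrable_abs f)
    qed (rule C(2)[OF t])
    also have "\<dots> = t ^ n * (C * F * t)" by (simp add: F_def mult_ac)
    finally have "t ^ n * \<bar>I\<bar> \<le> t ^ n * (C * F * t)" using t by (simp add: abs_mult)
    then show ?thesis using t by (simp add: mult_le_cancel_left)
  qed
  have "\<bar>I\<bar> \<le> 0 + e" if e: "e > 0" for e
  proof -
    define t where "t = min (T / 2) (e / (C * F + 1))"
    have CF: "C * F + 1 > 0" using C(1) F by (simp add: add_nonneg_pos)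
    have t: "0 < t" "t < T" "t \<le> e / (C * F + 1)" using T e CF by (auto simp: t_def)
    have "\<bar>I\<bar> \<le> C * F * t" by (rule key[OF t(1,2)])
    also have "\<dots> \<le> (C * F + 1) * t" using t by (intro mult_right_mono) auto
    also have "\<dots> \<le> (C * F + 1) * (e / (C * F + 1))" using t CF by (intro mult_left_mono) auto
    also have "\<dots> = e" using CF by simp
    finally show ?thesis by simp
  qed
  then have "\<bar>I\<bar> \<le> 0" by (rule field_le_epsilon)
  then show ?case by (simp add: I_def)
qed

lemma newton_sym: "newton (x - y) = newton (y - x)"
  by (simp add: newton_def norm_minus_commute)

lemma laplacian_compact:
  fixes u :: "real^'n::finite \<Rightarrow> real"
  assumes "test_fun u"
  shows "integrable lborel (laplacian u)" "(\<integral>y. laplacian u y \<partial>lborel) = 0" "continuous_on UNIV (laplacian u)"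
proof -
  have sm: "smooth_fun u" using assms by (simp add: test_fun_def)
  obtain r R where rR: "\<And>x. norm x > R \<Longrightarrow> u x = 0" "\<And>x. norm x > R \<Longrightarrow> laplacian u x = 0"
    using test_fun_support[OF assms] by metis
  show "continuous_on UNIV (laplacian u)" by (rule smooth_facts(6)[OF sm])
  then show "integrable lborel (laplacian u)" using rR(2) by (rule integrable_compact_support)
  show "(\<integral>y. laplacian u y \<partial>lborel) = 0" by (rule integral_laplacian_zero[OF sm rR(1)])
qed

lemma integrable_weight:
  fixes f w :: "real^'n::finite \<Rightarrow> real"
  assumes "integrable lborel f" "w \<in> borel_measurable borel" "\<And>y. f y \<noteq> 0 \<Longrightarrow> \<bar>w y\<bar> \<le> B"
  shows "integrable lborel (\<lambda>y. w y * f y)"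
proof (rule Bochner_Integration.integrable_bound)
  show "integrable lborel (\<lambda>y. B * f y)" using assms(1) by simp
  show "(\<lambda>y. w y * f y) \<in> borel_measurable lborel" using assms(1,2) by measurable
  show "AE y in lborel. norm (w y * f y) \<le> norm (B * f y)"
  proof (rule AE_I2)
    fix y
    show "norm (w y * f y) \<le> norm (B * f y)"
    proof (cases "f y = 0")
      case False
      then have "\<bar>w y\<bar> \<le> \<bar>B\<bar>" using assms(3)[of y] by linarith
      then show ?thesis by (simp add: abs_mult mult_right_mono)
    qed simp
  qed
qed

section \<open>Vanishing moments of the Laplacian of a test function\<close>

context
  fixes c :: real and u :: "real^'n::finite \<Rightarrow> real"
  assumes N2: "CARD('n) \<ge> 2"
    and rep_int: "\<And>x. integrable lborel (\<lambda>y. newton (x - y) * laplacian u y)"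
    and rep: "\<And>x. (\<integral>y. newton (x - y) * laplacian u y \<partial>lborel) = c * u x"
    and u: "test_fun u"
begin

text \<open>Homogeneity turns the integral of the kernel at \<open>x - t y\<close> into one at
  \<open>x/t - y\<close>, that is into a multiple of \<open>u (x/t)\<close>. The scaling defect in
  dimension 2 only adds constants times the integral of the Laplacian, which is 0.\<close>

lemma newton_term_moment_right:
  assumes x: "x \<noteq> 0"
  shows "integrable lborel (\<lambda>y. newton_term n x y * laplacian u y)" "(\<integral>y. newton_term n x y * laplacian u y \<partial>lborel) = 0"
proof -
  define N where "N = real CARD('n)"
  obtain r R where rR: "0 < r" "r < R" "\<And>x. norm x < r \<Longrightarrow> u x = 0" "\<And>x. norm x > R \<Longrightarrow> u x = 0"
    "\<And>x. norm x < r \<Longrightarrow> laplacian u x = 0" "\<And>x. norm x > R \<Longrightarrow> laplacian u x = 0"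
    using test_fun_support[OF u] by metis
  note lc = laplacian_compact[OF u]
  have sup: "norm y \<le> R" if "laplacian u y \<noteq> 0" for y using rR(6)[of y] that by force
  show int: "integrable lborel (\<lambda>y. newton_term n x y * laplacian u y)" for n
  proof -
    obtain A where A: "A \<ge> 0" "\<And>y::real^'n. \<bar>newton_term n x y\<bar> \<le> norm x powr (2 - N) * (A * (norm y / norm x) ^ n)"
      using newton_term_bound[where 'n='n and n = n] unfolding N_def by blast
    show ?thesis
    proof (rule integrable_weight[OF lc(1)])
      fix y assume "laplacian u y \<noteq> 0"
      then have "norm y / norm x \<le> R / norm x" using sup by (intro divide_right_mono) auto
      then have "(norm y / norm x) ^ n \<le> (R / norm x) ^ n" by (intro power_mono) auto
      then have "norm x powr (2 - N) * (A * (norm y / norm x) ^ n) \<le> norm x powr (2 - N) * (A * (R / norm x) ^ n)"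
        using A(1) by (intro mult_left_mono) auto
      then show "\<bar>newton_term n x y\<bar> \<le> norm x powr (2 - N) * (A * (R / norm x) ^ n)" by (rule order_trans[OF A(2)])
    qed measurable
  qed
  show "(\<integral>y. newton_term n x y * laplacian u y \<partial>lborel) = 0"
  \<comment> \<open>Below this threshold \<open>t y\<close> stays in the region |t y| \<le> |x|/4 of
    the expansion for every \<open>y\<close> in the support, and \<open>x/t\<close> lies outside the
    support.\<close>
  proof (rule moments_vanish[where h = "\<lambda>t y. newton (x - t *\<^sub>R y) - log_part N (norm x)" and T = "norm x / (4 * R)", OF _ lc(1) int])
    show "norm x / (4 * R) > 0" using x rR by simp
    fix m
    obtain A where A: "A \<ge> 0" "\<And>y::real^'n. norm y \<le> norm x / 4 \<Longrightarrow> \<bar>newton_rest m x y\<bar> \<le> norm x powr (2 - N) * (A * (norm y / norm x) ^ Suc m)"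
      using newton_rest_inner[OF N2, of m] x unfolding N_def by blast
    define C where "C = norm x powr (2 - N) * (A * (R / norm x) ^ Suc m)"
    have "\<bar>(newton (x - t *\<^sub>R y) - log_part N (norm x) - (\<Sum>n\<le>m. t ^ n * newton_term n x y)) * laplacian u y\<bar> \<le> C * t ^ Suc m * \<bar>laplacian u y\<bar>"
      if t: "0 < t" "t < norm x / (4 * R)" for t y
    proof (cases "laplacian u y = 0")
      case False
      have yR: "norm y \<le> R" using sup[OF False] .
      have "t * norm y \<le> t * R" using yR t by (intro mult_left_mono) auto
      also have "t * R \<le> norm x / 4" using t rR by (simp add: field_simps)
      finally have ty: "norm (t *\<^sub>R y) \<le> norm x / 4" using t by simp
      have "newton (x - t *\<^sub>R y) - log_part N (norm x) - (\<Sum>n\<le>m. t ^ n * newton_term n x y) = newton_rest m x (t *\<^sub>R y)"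
        using t by (simp add: newton_rest_def newton_term_scale N_def)
      also have "\<bar>\<dots>\<bar> \<le> norm x powr (2 - N) * (A * (norm (t *\<^sub>R y) / norm x) ^ Suc m)" by (rule A(2)[OF ty])
      also have "\<dots> \<le> norm x powr (2 - N) * (A * (t * R / norm x) ^ Suc m)"
        using A(1) t yR by (intro mult_left_mono power_mono divide_right_mono) auto
      also have "\<dots> = C * t ^ Suc m" by (simp add: C_def power_mult_distrib power_divide)
      finally show ?thesis unfolding abs_mult by (intro mult_right_mono) auto
    qed simp
    moreover have "C \<ge> 0" using A(1) rR by (simp add: C_def)
    ultimately show "\<exists>C\<ge>0. \<forall>t y. 0 < t \<and> t < norm x / (4 * R) \<longrightarrow>
      \<bar>(newton (x - t *\<^sub>R y) - log_part N (norm x) - (\<Sum>n\<le>m. t ^ n * newton_term n x y)) * laplacian u y\<bar> \<le> C * t ^ Suc m * \<bar>laplacian u y\<bar>"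
      by blast
  next
    fix t :: real assume t: "0 < t" "t < norm x / (4 * R)"
    have xR: "norm ((1/t) *\<^sub>R x) > R"
    proof -
      have "t * (4 * R) < norm x" using t rR by (simp add: field_simps)
      moreover have "t * R > 0" using t rR by simp
      ultimately have "t * R < norm x" by linarith
      then show ?thesis using t by (simp add: field_simps)
    qed
    have eq: "(newton (x - t *\<^sub>R y) - log_part N (norm x)) * laplacian u y =
      (log_part N t - log_part N (norm x)) * laplacian u y + t powr (2 - N) * (newton ((1/t) *\<^sub>R x - y) * laplacian u y)" for y
    proof (cases "laplacian u y = 0")
      case False
      then have "(1/t) *\<^sub>R x - y \<noteq> 0" using xR sup[OF False] by auto
      then have pos: "(norm ((1/t) *\<^sub>R x - y))\<^sup>2 > 0" by simp
      have "x - t *\<^sub>R y = t *\<^sub>R ((1/t) *\<^sub>R x - y)" using t by (simp add: scaleR_diff_right)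
      then have "(norm (x - t *\<^sub>R y))\<^sup>2 = t\<^sup>2 * (norm ((1/t) *\<^sub>R x - y))\<^sup>2" using t by (simp add: power_mult_distrib)
      then have "newton (x - t *\<^sub>R y) = log_part N t + t powr (2 - N) * newton ((1/t) *\<^sub>R x - y)"
        using newton_profile_scale[OF t(1) pos, of N] by (simp add: newton_def N_def)
      then show ?thesis by (simp add: algebra_simps)
    qed simp
    show "integrable lborel (\<lambda>y. (newton (x - t *\<^sub>R y) - log_part N (norm x)) * laplacian u y)"
      unfolding eq by (intro Bochner_Integration.integrable_add integrable_mult_right lc rep_int)
    have "(\<integral>y. (newton (x - t *\<^sub>R y) - log_part N (norm x)) * laplacian u y \<partial>lborel)
      = (log_part N t - log_part N (norm x)) * (\<integral>y. laplacian u y \<partial>lborel)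
        + t powr (2 - N) * (\<integral>y. newton ((1/t) *\<^sub>R x - y) * laplacian u y \<partial>lborel)"
      unfolding eq by (subst Bochner_Integration.integral_add) (auto intro: integrable_mult_right lc rep_int)
    also have "\<dots> = 0" unfolding lc(2) rep using rR(4)[OF xR] by simp
    finally show "(\<integral>y. (newton (x - t *\<^sub>R y) - log_part N (norm x)) * laplacian u y \<partial>lborel) = 0" .
  qed
qed

text \<open>In dimension 2 this is the representation formula at the origin, where \<open>u\<close>
  vanishes.\<close>

lemma log_part_moment:
  shows "integrable lborel (\<lambda>y. log_part (real CARD('n)) (norm y) * laplacian u y)"
    "(\<integral>y. log_part (real CARD('n)) (norm y) * laplacian u y \<partial>lborel) = 0"
proof -
  obtain r R where rR: "0 < r" "\<And>x. norm x < r \<Longrightarrow> u x = 0" "\<And>x. norm x < r \<Longrightarrow> laplacian u x = 0"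
    using test_fun_support[OF u] by metis
  have "integrable lborel (\<lambda>y. log_part (real CARD('n)) (norm y) * laplacian u y) \<and>
    (\<integral>y. log_part (real CARD('n)) (norm y) * laplacian u y \<partial>lborel) = 0"
  proof (cases "CARD('n) = 2")
    case True
    have "log_part (real CARD('n)) (norm y) * laplacian u y = newton (0 - y) * laplacian u y" for y
      using rR(3)[of y] rR(1) True by (cases "y = 0") (auto simp: log_part_def newton_def newton_profile_def ln_realpow)
    then show ?thesis using rep_int[of 0] rep[of 0] rR(1,2) by (simp only: norm_zero) simp
  qed (simp add: log_part_def)
  then show "integrable lborel (\<lambda>y. log_part (real CARD('n)) (norm y) * laplacian u y)"
    "(\<integral>y. log_part (real CARD('n)) (norm y) * laplacian u y \<partial>lborel) = 0" by blast+
qed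

text \<open>The expansion is now in powers of the evaluation point: the kernel at
  \<open>t x - y\<close> integrates to a multiple of \<open>u (t x)\<close> without rescaling, and
  this is 0 for small \<open>t\<close>. The logarithm depends on the integration variable and is
  removed by \<open>log_part_moment\<close>. Negative powers of \<open>|y|\<close> stay bounded
  because the support avoids a ball about 0.\<close>

lemma newton_term_moment_left:
  assumes x: "x \<noteq> 0"
  shows "integrable lborel (\<lambda>y. newton_term n y x * laplacian u y)" "(\<integral>y. newton_term n y x * laplacian u y \<partial>lborel) = 0"
proof -
  define N where "N = real CARD('n)"
  have N: "N \<ge> 2" using N2 by (simp add: N_def)
  obtain r R where rR: "0 < r" "r < R" "\<And>x. norm x < r \<Longrightarrow> u x = 0" "\<And>x. norm x > R \<Longrightarrow> u x = 0"
    "\<And>x. norm x < r \<Longrightarrow> laplacian u x = 0" "\<And>x. norm x > R \<Longrightarrow> laplacian u x = 0"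
    using test_fun_support[OF u] by metis
  note lc = laplacian_compact[OF u]
  have sup: "norm y \<ge> r" if "laplacian u y \<noteq> 0" for y using rR(5)[of y] that by force
  have mono: "norm y powr (2 - N) * (A * (s / norm y) ^ n) \<le> r powr (2 - N) * (A * (s / r) ^ n)"
    if "norm y \<ge> r" "A \<ge> 0" "s \<ge> 0" for A s n and y :: "real^'n"
  proof (intro mult_mono mult_left_mono power_mono divide_left_mono)
    show "norm y powr (2 - N) \<le> r powr (2 - N)" using that rR N by (intro powr_mono2') auto
    have "norm y > 0" using that rR by linarith
    then show "0 < norm y * r" using rR by simp
  qed (use that rR in auto)
  show int: "integrable lborel (\<lambda>y. newton_term n y x * laplacian u y)" for n
  proof -
    obtain A where A: "A \<ge> 0" "\<And>y::real^'n. \<bar>newton_term n y x\<bar> \<le> norm y powr (2 - N) * (A * (norm x / norm y) ^ n)"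
      using newton_term_bound[where 'n='n and n = n] unfolding N_def by blast
    show ?thesis
    proof (rule integrable_weight[OF lc(1)])
      fix y assume "laplacian u y \<noteq> 0"
      then show "\<bar>newton_term n y x\<bar> \<le> r powr (2 - N) * (A * (norm x / r) ^ n)"
        using A(1) by (intro order_trans[OF A(2) mono] sup) auto
    qed measurable
  qed
  show "(\<integral>y. newton_term n y x * laplacian u y \<partial>lborel) = 0"
  proof (rule moments_vanish[where h = "\<lambda>t y. newton (t *\<^sub>R x - y) - log_part N (norm y)" and T = "r / (4 * norm x)", OF _ lc(1) int])
    show "r / (4 * norm x) > 0" using x rR by simp
    fix m
    obtain A where A: "A \<ge> 0" "\<And>y x::real^'n. y \<noteq> 0 \<Longrightarrow> norm x \<le> norm y / 4 \<Longrightarrow> \<bar>newton_rest m y x\<bar> \<le> norm y powr (2 - N) * (A * (norm x / norm y) ^ Suc m)"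
      using newton_rest_inner[OF N2, of m] unfolding N_def by blast
    define C where "C = r powr (2 - N) * (A * (norm x / r) ^ Suc m)"
    have "\<bar>(newton (t *\<^sub>R x - y) - log_part N (norm y) - (\<Sum>n\<le>m. t ^ n * newton_term n y x)) * laplacian u y\<bar> \<le> C * t ^ Suc m * \<bar>laplacian u y\<bar>"
      if t: "0 < t" "t < r / (4 * norm x)" for t y
    proof (cases "laplacian u y = 0")
      case False
      have yr: "norm y \<ge> r" using sup[OF False] .
      then have y0: "y \<noteq> 0" using rR(1) by auto
      have "t * norm x \<le> r / 4" using t x by (simp add: field_simps)
      then have ty: "norm (t *\<^sub>R x) \<le> norm y / 4" using t yr by simp
      have "newton (t *\<^sub>R x - y) - log_part N (norm y) - (\<Sum>n\<le>m. t ^ n * newton_term n y x) = newton_rest m y (t *\<^sub>R x)"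
        using t by (simp add: newton_rest_def newton_term_scale N_def newton_sym[of _ y])
      also have "\<bar>\<dots>\<bar> \<le> norm y powr (2 - N) * (A * (norm (t *\<^sub>R x) / norm y) ^ Suc m)" by (rule A(2)[OF y0 ty])
      also have "\<dots> \<le> r powr (2 - N) * (A * (norm (t *\<^sub>R x) / r) ^ Suc m)" by (rule mono[OF yr A(1)]) simp
      also have "\<dots> = C * t ^ Suc m" using t by (simp add: C_def power_mult_distrib power_divide)
      finally show ?thesis unfolding abs_mult by (intro mult_right_mono) auto
    qed simp
    moreover have "C \<ge> 0" using A(1) rR by (simp add: C_def)
    ultimately show "\<exists>C\<ge>0. \<forall>t y. 0 < t \<and> t < r / (4 * norm x) \<longrightarrow>
      \<bar>(newton (t *\<^sub>R x - y) - log_part N (norm y) - (\<Sum>n\<le>m. t ^ n * newton_term n y x)) * laplacian u y\<bar> \<le> C * t ^ Suc m * \<bar>laplacian u y\<bar>"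
      by blast
  next
    fix t :: real assume t: "0 < t" "t < r / (4 * norm x)"
    have xr: "norm (t *\<^sub>R x) < r"
    proof -
      have "t * (4 * norm x) < r" using t x by (simp add: field_simps)
      moreover have "t * norm x \<ge> 0" using t by simp
      ultimately have "t * norm x < r" by linarith
      then show ?thesis using t by simp
    qed
    note L = log_part_moment[folded N_def]
    show "integrable lborel (\<lambda>y. (newton (t *\<^sub>R x - y) - log_part N (norm y)) * laplacian u y)"
      unfolding left_diff_distrib by (intro Bochner_Integration.integrable_diff L rep_int)
    have "(\<integral>y. (newton (t *\<^sub>R x - y) - log_part N (norm y)) * laplacian u y \<partial>lborel)
      = (\<integral>y. newton (t *\<^sub>R x - y) * laplacian u y \<partial>lborel) - (\<integral>y. log_part N (norm y) * laplacian u y \<partial>lborel)"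
      unfolding left_diff_distrib by (rule Bochner_Integration.integral_diff[OF rep_int L(1)])
    also have "\<dots> = 0" unfolding L(2) rep using rR(3)[OF xr] by simp
    finally show "(\<integral>y. (newton (t *\<^sub>R x - y) - log_part N (norm y)) * laplacian u y \<partial>lborel) = 0" .
  qed
qed

text \<open>Absolute values are taken only here, since the Schur test wants a nonnegative kernel;
  the cancellation has already been spent on the vanishing moments.\<close>

lemma newton_rest_right:
  assumes x: "x \<noteq> 0"
  shows "ennreal \<bar>c * u x\<bar> \<le> (\<integral>\<^sup>+y. ennreal (\<bar>newton_rest m x y\<bar> * \<bar>laplacian u y\<bar>) \<partial>lborel)"
proof -
  note lc = laplacian_compact[OF u] and D = newton_term_moment_right[OF x]
  let ?l = "log_part (real CARD('n)) (norm x)"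
  have eq: "newton_rest m x y * laplacian u y = newton (x - y) * laplacian u y - ?l * laplacian u y - (\<Sum>n\<le>m. newton_term n x y * laplacian u y)" for y
    by (simp add: newton_rest_def left_diff_distrib sum_distrib_right)
  have i1: "integrable lborel (\<lambda>y. ?l * laplacian u y)" by (intro integrable_mult_right lc)
  have i2: "integrable lborel (\<lambda>y. \<Sum>n\<le>m. newton_term n x y * laplacian u y)" by (intro Bochner_Integration.integrable_sum D)
  have int: "integrable lborel (\<lambda>y. newton_rest m x y * laplacian u y)"
    unfolding eq by (intro Bochner_Integration.integrable_diff rep_int i1 i2)
  have "(\<integral>y. (\<Sum>n\<le>m. newton_term n x y * laplacian u y) \<partial>lborel) = (\<Sum>n\<le>m. \<integral>y. newton_term n x y * laplacian u y \<partial>lborel)"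
    by (intro Bochner_Integration.integral_sum D)
  then have s0: "(\<integral>y. (\<Sum>n\<le>m. newton_term n x y * laplacian u y) \<partial>lborel) = 0" by (simp add: D)
  have "(\<integral>y. newton_rest m x y * laplacian u y \<partial>lborel) = c * u x"
    unfolding eq
    by (subst Bochner_Integration.integral_diff[OF Bochner_Integration.integrable_diff[OF rep_int i1] i2],
        subst Bochner_Integration.integral_diff[OF rep_int i1]) (simp add: s0 rep lc)
  then show ?thesis using integral_norm_bound_ennreal[OF int] by (simp add: abs_mult)
qed

lemma newton_rest_left:
  assumes x: "x \<noteq> 0"
  shows "ennreal \<bar>c * u x\<bar> \<le> (\<integral>\<^sup>+y. ennreal (\<bar>newton_rest m y x\<bar> * \<bar>laplacian u y\<bar>) \<partial>lborel)"
proof -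
  note D = newton_term_moment_left[OF x] and i1 = log_part_moment(1)
  have eq: "newton_rest m y x * laplacian u y = newton (x - y) * laplacian u y - log_part (real CARD('n)) (norm y) * laplacian u y - (\<Sum>n\<le>m. newton_term n y x * laplacian u y)" for y
    by (simp add: newton_rest_def left_diff_distrib sum_distrib_right newton_sym[of x y])
  have i2: "integrable lborel (\<lambda>y. \<Sum>n\<le>m. newton_term n y x * laplacian u y)" by (intro Bochner_Integration.integrable_sum D)
  have int: "integrable lborel (\<lambda>y. newton_rest m y x * laplacian u y)"
    unfolding eq by (intro Bochner_Integration.integrable_diff rep_int i1 i2)
  have "(\<integral>y. (\<Sum>n\<le>m. newton_term n y x * laplacian u y) \<partial>lborel) = (\<Sum>n\<le>m. \<integral>y. newton_term n y x * laplacian u y \<partial>lborel)"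
    by (intro Bochner_Integration.integral_sum D)
  then have s0: "(\<integral>y. (\<Sum>n\<le>m. newton_term n y x * laplacian u y) \<partial>lborel) = 0" by (simp add: D)
  have "(\<integral>y. newton_rest m y x * laplacian u y \<partial>lborel) = c * u x"
    unfolding eq
    by (subst Bochner_Integration.integral_diff[OF Bochner_Integration.integrable_diff[OF rep_int i1] i2],
        subst Bochner_Integration.integral_diff[OF rep_int i1]) (simp add: s0 rep log_part_moment(2))
  then show ?thesis using integral_norm_bound_ennreal[OF int] by (simp add: abs_mult)
qed

end

section \<open>The Schur test with power weights\<close>

lemma young_powr:
  fixes h A p :: real
  assumes "h \<ge> 0" "A > 0" "p \<ge> 1"
  shows "h \<le> A powr (1 - p) / p * h powr p + A * (p - 1) / p"
proof (cases "h = 0")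
  case True
  then show ?thesis using assms by simp
next
  case False
  define s where "s = h / A"
  have s: "s > 0" using assms False by (simp add: s_def)
  \<comment> \<open>Young's inequality for \<open>s\<close> and 1, to be scaled by \<open>A\<close>.
    Equality holds at \<open>h = A\<close>, so nothing is lost once \<open>A\<close> is
    optimised.\<close>
  have "(s powr p) powr (1/p) * 1 powr (1 - 1/p) \<le> (1/p) * (s powr p) + (1 - 1/p) * 1"
    using assms s by (intro Youngs_inequality_0) auto
  then have "s \<le> s powr p / p + (1 - 1/p)" using assms s by (simp add: powr_powr)
  then have "A * s \<le> A * (s powr p / p + (1 - 1/p))" using assms by (intro mult_left_mono) auto
  moreover have "A * s = h" using assms by (simp add: s_def)
  moreover have "A * (s powr p / p) = A powr (1 - p) / p * h powr p"
  proof -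
    have "s powr p = h powr p * A powr (- p)" using assms by (simp add: s_def powr_divide powr_minus_divide)
    moreover have "A * A powr (- p) = A powr (1 - p)" using assms powr_add[of A 1 "-p"] by simp
    ultimately show ?thesis by (simp add: mult_ac)
  qed
  moreover have "A * (s powr p / p + (1 - 1/p)) = A * (s powr p / p) + A * (p - 1) / p"
    using assms by (simp add: field_simps)
  ultimately show ?thesis by linarith
qed

text \<open>The value \<open>A = V / m\<close> turns the second term into \<open>V - V/p\<close>,
  which is absorbed on the left. This optimisation takes the place of a weighted Hoelder
  inequality.\<close>

lemma schur_pointwise:
  fixes p m V j :: real
  assumes p: "p \<ge> 1" and m: "m > 0" and V: "V > 0"
    and le: "\<And>A. A > 0 \<Longrightarrow> V \<le> A powr (1 - p) / p * j + A * (p - 1) / p * m"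
  shows "V powr p \<le> m powr (p - 1) * j"
proof -
  have "V \<le> (V / m) powr (1 - p) / p * j + (V / m) * (p - 1) / p * m" using le[of "V / m"] V m by simp
  also have "(V / m) * (p - 1) / p * m = V - V / p" using m p by (simp add: field_simps)
  finally have "V / p \<le> (V / m) powr (1 - p) / p * j" by simp
  then have "V \<le> (V / m) powr (1 - p) * j" using p by (simp add: field_simps)
  also have "(V / m) powr (1 - p) = V powr (1 - p) * m powr (p - 1)"
    using V m powr_minus_divide[of m "p - 1"] by (simp add: powr_divide)
  finally have "V * V powr (p - 1) \<le> V powr (1 - p) * m powr (p - 1) * j * V powr (p - 1)"
    by (intro mult_right_mono) auto
  also have "\<dots> = (V powr (1 - p) * V powr (p - 1)) * (m powr (p - 1) * j)" by (simp add: mult_ac)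
  also have "V powr (1 - p) * V powr (p - 1) = 1" using V by (simp flip: powr_add)
  also have "V * V powr (p - 1) = V powr p" using V powr_add[of V 1 "p - 1"] by simp
  finally show ?thesis by simp
qed

lemma nn_integral_lincomb:
  "f \<in> borel_measurable M \<Longrightarrow> g \<in> borel_measurable M \<Longrightarrow>
    (\<integral>\<^sup>+x. a * f x + b * g x \<partial>M) = a * (\<integral>\<^sup>+x. f x \<partial>M) + b * (\<integral>\<^sup>+x. g x \<partial>M)"
  by (simp add: nn_integral_add nn_integral_cmult)

lemma ennreal_lincomb:
  "a \<ge> 0 \<Longrightarrow> b \<ge> 0 \<Longrightarrow> x \<ge> 0 \<Longrightarrow> y \<ge> 0 \<Longrightarrow> ennreal (a * x + b * y) = ennreal a * ennreal x + ennreal b * ennreal y"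
  by (simp add: ennreal_plus ennreal_mult)

text \<open>Young's inequality with the weight \<open>|y|^(-a)\<close> bounds \<open>(v x)^p\<close>
  by \<open>(M |x|^(-a))^(p-1)\<close> times the integral of \<open>k g^p |y|^b\<close>; then the
  integrals are exchanged and the second kernel bound is applied. The relation
  \<open>b = a (p - 1)\<close> makes the factor in \<open>x\<close> exactly the weight
  \<open>|x|^(-b)\<close> of that bound. One \<open>M\<close> in both bounds yields the operator
  bound \<open>M\<close> itself, so a sharp \<open>M\<close> gives a sharp inequality.\<close>

theorem schur_test:
  fixes k :: "'a::euclidean_space \<Rightarrow> 'a \<Rightarrow> real" and g v :: "'a \<Rightarrow> real"
  assumes [measurable]: "case_prod k \<in> borel_measurable (borel \<Otimes>\<^sub>M borel)" "g \<in> borel_measurable borel"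
    and nn: "\<And>x y. k x y \<ge> 0" "\<And>y. g y \<ge> 0" "\<And>x. v x \<ge> 0"
    and p: "p \<ge> 1" and b: "b = a * (p - 1)" and M: "M > 0"
    and A: "\<And>x. x \<noteq> 0 \<Longrightarrow> (\<integral>\<^sup>+y. ennreal (k x y * norm y powr (- a)) \<partial>lborel) \<le> ennreal (M * norm x powr (- a))"
    and B: "\<And>y. y \<noteq> 0 \<Longrightarrow> (\<integral>\<^sup>+x. ennreal (k x y * norm x powr (- b)) \<partial>lborel) \<le> ennreal (M * norm y powr (- b))"
    and v: "\<And>x. x \<noteq> 0 \<Longrightarrow> ennreal (v x) \<le> (\<integral>\<^sup>+y. ennreal (k x y * g y) \<partial>lborel)"
  shows "(\<integral>\<^sup>+x. ennreal (v x powr p) \<partial>lborel) \<le> ennreal (M powr p) * (\<integral>\<^sup>+y. ennreal (g y powr p) \<partial>lborel)"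
proof -
  have AE0: "AE y in lborel. y \<noteq> (0::'a)" by (rule AE_lborel_singleton)
  define J where "J x = (\<integral>\<^sup>+y. ennreal (k x y * (g y powr p * norm y powr b)) \<partial>lborel)" for x
  have pt: "ennreal (v x powr p) \<le> ennreal (M powr (p - 1) * norm x powr (- b)) * J x" if x: "x \<noteq> 0" for x
  \<comment> \<open>If \<open>J x\<close> is infinite, so is the right-hand side; otherwise all
    quantities are real and the optimisation over \<open>s\<close> applies.\<close>
  proof (cases "v x = 0 \<or> J x = top")
    case True
    then show ?thesis using M x by (auto simp: ennreal_mult_top)
  next
    case False
    then have V: "v x > 0" using nn(3)[of x] by simp
    obtain j where j: "j \<ge> 0" "J x = ennreal j" using False by (cases "J x") auto
    define m where "m = M * norm x powr (- a)"
    have m: "m > 0" using M x by (simp add: m_def)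
    have "v x \<le> s powr (1 - p) / p * j + s * (p - 1) / p * m" if s: "s > 0" for s
    proof -
      have c0: "s powr (1 - p) / p \<ge> 0" "s * (p - 1) / p \<ge> 0" using s p by auto
      have "ennreal (v x) \<le> (\<integral>\<^sup>+y. ennreal (k x y * g y) \<partial>lborel)" by (rule v[OF x])
      also have "\<dots> \<le> (\<integral>\<^sup>+y. ennreal (s powr (1 - p) / p) * ennreal (k x y * (g y powr p * norm y powr b))
         + ennreal (s * (p - 1) / p) * ennreal (k x y * norm y powr (- a)) \<partial>lborel)"
      proof (rule nn_integral_mono_AE)
        show "AE y in lborel. ennreal (k x y * g y) \<le> ennreal (s powr (1 - p) / p) * ennreal (k x y * (g y powr p * norm y powr b))
         + ennreal (s * (p - 1) / p) * ennreal (k x y * norm y powr (- a))"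
          using AE0
        proof eventually_elim
          case (elim y)
          define h where "h = g y * norm y powr a"
          have h: "h \<ge> 0" using nn by (simp add: h_def)
          have "k x y * norm y powr (- a) * h \<le> k x y * norm y powr (- a) * (s powr (1 - p) / p * h powr p + s * (p - 1) / p)"
            using nn by (intro mult_left_mono young_powr h s p) auto
          moreover have "k x y * norm y powr (- a) * h = k x y * g y"
          proof -
            have "k x y * norm y powr (- a) * h = k x y * g y * (norm y powr (- a) * norm y powr a)"
              by (simp add: h_def)
            also have "norm y powr (- a) * norm y powr a = 1" using elim by (simp flip: powr_add)
            finally show ?thesis by simp
          qed
          moreover have "norm y powr (- a) * h powr p = g y powr p * norm y powr b"
          proof -
            have "h powr p = g y powr p * norm y powr (a * p)" using nn by (simp add: h_def powr_mult powr_powr)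
            then have "norm y powr (- a) * h powr p = g y powr p * norm y powr (- a + a * p)"
              by (simp only: powr_add mult_ac)
            also have "- a + a * p = b" by (simp add: b algebra_simps)
            finally show ?thesis .
          qed
          moreover have "k x y * norm y powr (- a) * (S * h powr p + S') = S * (k x y * (norm y powr (- a) * h powr p)) + S' * (k x y * norm y powr (- a))" for S S' :: real
            by (simp add: algebra_simps)
          ultimately have "k x y * g y \<le> s powr (1 - p) / p * (k x y * (g y powr p * norm y powr b)) + s * (p - 1) / p * (k x y * norm y powr (- a))"
            by (simp only:)
          then have "ennreal (k x y * g y) \<le> ennreal (s powr (1 - p) / p * (k x y * (g y powr p * norm y powr b)) + s * (p - 1) / p * (k x y * norm y powr (- a)))"
            by (rule ennreal_leI)
          also have "\<dots> = ennreal (s powr (1 - p) / p) * ennreal (k x y * (g y powr p * norm y powr b))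
             + ennreal (s * (p - 1) / p) * ennreal (k x y * norm y powr (- a))"
            using c0 nn by (intro ennreal_lincomb mult_nonneg_nonneg) auto
          finally show ?case .
        qed
      qed
      also have "\<dots> = ennreal (s powr (1 - p) / p) * J x + ennreal (s * (p - 1) / p) * (\<integral>\<^sup>+y. ennreal (k x y * norm y powr (- a)) \<partial>lborel)"
        unfolding J_def by (rule nn_integral_lincomb) measurable
      also have "\<dots> \<le> ennreal (s powr (1 - p) / p) * ennreal j + ennreal (s * (p - 1) / p) * ennreal m"
        unfolding j(2) m_def by (intro add_left_mono mult_left_mono A x) auto
      also have "\<dots> = ennreal (s powr (1 - p) / p * j + s * (p - 1) / p * m)"
        using c0 j m by (intro ennreal_lincomb[symmetric]) auto
      finally have "ennreal (v x) \<le> ennreal (s powr (1 - p) / p * j + s * (p - 1) / p * m)" .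
      moreover have "0 \<le> s powr (1 - p) / p * j + s * (p - 1) / p * m"
        using c0 j m by (intro add_nonneg_nonneg mult_nonneg_nonneg) auto
      ultimately show ?thesis using ennreal_le_iff by blast
    qed
    then have "v x powr p \<le> m powr (p - 1) * j" by (rule schur_pointwise[OF p m V])
    also have "m powr (p - 1) = M powr (p - 1) * norm x powr (- b)"
      using M x by (simp add: m_def powr_mult powr_powr b)
    finally show ?thesis unfolding j(2) using j(1) M by (simp add: ennreal_mult[symmetric] ennreal_leI)
  qed
  have "(\<integral>\<^sup>+x. ennreal (v x powr p) \<partial>lborel) \<le> (\<integral>\<^sup>+x. ennreal (M powr (p - 1) * norm x powr (- b)) * J x \<partial>lborel)"
    using AE0 by (intro nn_integral_mono_AE) (auto elim!: eventually_mono intro: pt)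
  also have "\<dots> = (\<integral>\<^sup>+x. \<integral>\<^sup>+y. ennreal (M powr (p - 1) * norm x powr (- b)) * ennreal (k x y * (g y powr p * norm y powr b)) \<partial>lborel \<partial>lborel)"
    unfolding J_def by (subst nn_integral_cmult) auto
  also have "\<dots> = (\<integral>\<^sup>+y. \<integral>\<^sup>+x. ennreal (M powr (p - 1) * norm x powr (- b)) * ennreal (k x y * (g y powr p * norm y powr b)) \<partial>lborel \<partial>lborel)"
    by (rule lborel_pair.Fubini') measurable
  also have "\<dots> \<le> (\<integral>\<^sup>+y. ennreal (M powr p) * ennreal (g y powr p) \<partial>lborel)"
  proof (rule nn_integral_mono_AE)
    show "AE y in lborel. (\<integral>\<^sup>+x. ennreal (M powr (p - 1) * norm x powr (- b)) * ennreal (k x y * (g y powr p * norm y powr b)) \<partial>lborel)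
       \<le> ennreal (M powr p) * ennreal (g y powr p)"
      using AE0
    proof eventually_elim
      case (elim y)
      have "(\<integral>\<^sup>+x. ennreal (M powr (p - 1) * norm x powr (- b)) * ennreal (k x y * (g y powr p * norm y powr b)) \<partial>lborel)
        = (\<integral>\<^sup>+x. ennreal (M powr (p - 1) * (g y powr p * norm y powr b)) * ennreal (k x y * norm x powr (- b)) \<partial>lborel)"
        using nn by (intro nn_integral_cong) (simp add: ennreal_mult[symmetric] mult_ac)
      also have "\<dots> = ennreal (M powr (p - 1) * (g y powr p * norm y powr b)) * (\<integral>\<^sup>+x. ennreal (k x y * norm x powr (- b)) \<partial>lborel)"
        by (rule nn_integral_cmult) measurable
      also have "\<dots> \<le> ennreal (M powr (p - 1) * (g y powr p * norm y powr b)) * ennreal (M * norm y powr (- b))"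
        by (intro mult_left_mono B elim) auto
      also have "\<dots> = ennreal (M powr (p - 1) * M * (g y powr p * (norm y powr b * norm y powr (- b))))"
        using M by (simp add: ennreal_mult[symmetric] mult_ac)
      also have "M powr (p - 1) * M = M powr p" using M powr_add[of M "p - 1" 1] by simp
      also have "norm y powr b * norm y powr (- b) = 1" using elim by (simp flip: powr_add)
      finally show ?case by (simp add: ennreal_mult)
    qed
  qed
  also have "\<dots> = ennreal (M powr p) * (\<integral>\<^sup>+y. ennreal (g y powr p) \<partial>lborel)"
    by (rule nn_integral_cmult) measurable
  finally show ?thesis .
qed

section \<open>From kernel bounds to weighted inequalities\<close>

text \<open>\<open>s\<close> and \<open>t\<close> are the orders of the kernel in \<open>y\<close> at 0 and at infinity, \<open>\<sigma>\<close> that of the diagonal singularity.\<close>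

definition kernel_bound :: "real \<Rightarrow> real \<Rightarrow> real \<Rightarrow> real \<Rightarrow> (real^'n::finite \<Rightarrow> real^'n \<Rightarrow> real) \<Rightarrow> bool" where
  "kernel_bound s t \<sigma> A K \<longleftrightarrow> (\<forall>x y. x \<noteq> 0 \<longrightarrow> y \<noteq> 0 \<longrightarrow> x \<noteq> y \<longrightarrow>
     (norm y \<le> norm x / 4 \<longrightarrow> K x y \<le> A * (norm x powr (2 - real CARD('n)) * (norm y / norm x) powr s)) \<and>
     (4 * norm x \<le> norm y \<longrightarrow> K x y \<le> A * (norm x powr (2 - real CARD('n)) * (norm y / norm x) powr t)) \<and>
     (norm x / 4 \<le> norm y \<longrightarrow> norm y \<le> 4 * norm x \<longrightarrow>
        K x y \<le> A * (norm x powr (2 - real CARD('n)) * (norm (x - y) / norm x) powr (-\<sigma>))))"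

lemma powr_comparable:
  fixes x y q :: real
  assumes "x > 0" "y > 0" "x / 4 \<le> y" "y \<le> 4 * x"
  shows "y powr q \<le> 4 powr \<bar>q\<bar> * x powr q"
proof -
  have "(y / x) powr q \<le> 4 powr \<bar>q\<bar>"
  proof (cases "q \<ge> 0")
    case True
    then show ?thesis using assms by (auto intro!: powr_mono2 simp: field_simps)
  next
    case False
    have "(y / x) powr q \<le> (1/4) powr q" using assms False by (intro powr_mono2') (auto simp: field_simps)
    also have "\<dots> = 4 powr \<bar>q\<bar>" using False by (simp add: powr_divide powr_minus_divide)
    finally show ?thesis .
  qed
  then show ?thesis using assms by (simp add: powr_divide field_simps)
qed

lemma powr_ratio:
  fixes x z :: real
  assumes "x > 0" "z \<ge> 0" shows "x powr a * (z / x) powr q = x powr (a - q) * z powr q"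
  using assms by (simp add: powr_divide powr_diff)

text \<open>Rewriting \<open>|x|^(2-N) (|y|/|x|)^q\<close> as
  \<open>|y|^(2-N) (|x|/|y|)^(2-N-q)\<close> reflects and exchanges the orders at 0 and at infinity.
  A new constant appears only near the diagonal, where the two norms are merely comparable.\<close>

lemma kernel_bound_transpose:
  fixes K :: "real^'n::finite \<Rightarrow> real^'n \<Rightarrow> real"
  assumes K: "kernel_bound s t \<sigma> A K" and A: "A \<ge> 0"
  defines "N \<equiv> real CARD('n)"
  shows "kernel_bound (2 - N - t) (2 - N - s) \<sigma> (A * 4 powr \<bar>2 - N + \<sigma>\<bar>) (\<lambda>y x. K x y)"
  unfolding kernel_bound_def N_def[symmetric]
proof (intro allI impI conjI)
  fix y x :: "real^'n"
  assume nz: "y \<noteq> 0" "x \<noteq> 0" "y \<noteq> x"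
  have A1: "A \<le> A * 4 powr \<bar>2 - N + \<sigma>\<bar>" using A by (simp add: mult_le_cancel_left1 ge_one_powr_ge_zero)
  have id: "norm x powr (2 - N) * (norm y / norm x) powr q = norm y powr (2 - N) * (norm x / norm y) powr (2 - N - q)" for q
  proof -
    have "norm x powr (2 - N) * (norm y / norm x) powr q = norm x powr (2 - N - q) * norm y powr q"
      using nz by (intro powr_ratio) auto
    also have "\<dots> = norm y powr (2 - N) * (norm x / norm y) powr (2 - N - q)"
      using nz powr_ratio[of "norm y" "norm x" "2 - N" "2 - N - q"] by simp
    finally show ?thesis .
  qed
  have up: "K x y \<le> A * Q \<Longrightarrow> Q \<ge> 0 \<Longrightarrow> K x y \<le> A * 4 powr \<bar>2 - N + \<sigma>\<bar> * Q" for Q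
    using A1 by (meson mult_right_mono order_trans)
  note Kx = K[unfolded kernel_bound_def N_def[symmetric], rule_format, OF nz(2,1) nz(3)[symmetric]]
  note Kx1 = Kx[THEN conjunct1, rule_format] and Kx2 = Kx[THEN conjunct2, THEN conjunct1, rule_format]
    and Kx3 = Kx[THEN conjunct2, THEN conjunct2, rule_format]
  { assume "norm x \<le> norm y / 4"
    then have "K x y \<le> A * (norm x powr (2 - N) * (norm y / norm x) powr t)" by (intro Kx2) simp
    then show "K x y \<le> A * 4 powr \<bar>2 - N + \<sigma>\<bar> * (norm y powr (2 - N) * (norm x / norm y) powr (2 - N - t))"
      unfolding id by (rule up) simp }
  { assume "4 * norm y \<le> norm x"
    then have "K x y \<le> A * (norm x powr (2 - N) * (norm y / norm x) powr s)" by (intro Kx1) simp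
    then show "K x y \<le> A * 4 powr \<bar>2 - N + \<sigma>\<bar> * (norm y powr (2 - N) * (norm x / norm y) powr (2 - N - s))"
      unfolding id by (rule up) simp }
  { assume c: "norm y / 4 \<le> norm x" "norm x \<le> 4 * norm y"
    then have "K x y \<le> A * (norm x powr (2 - N) * (norm (x - y) / norm x) powr (- \<sigma>))" by (intro Kx3) simp_all
    also have "norm x powr (2 - N) * (norm (x - y) / norm x) powr (- \<sigma>) = norm x powr (2 - N + \<sigma>) * norm (x - y) powr (- \<sigma>)"
      using nz powr_ratio[of "norm x" "norm (x - y)" "2 - N" "- \<sigma>"] by simp
    also have "A * (norm x powr (2 - N + \<sigma>) * norm (x - y) powr (- \<sigma>))
       \<le> A * ((4 powr \<bar>2 - N + \<sigma>\<bar> * norm y powr (2 - N + \<sigma>)) * norm (x - y) powr (- \<sigma>))"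
      using nz c A by (intro mult_left_mono mult_right_mono powr_comparable) auto
    also have "\<dots> = A * 4 powr \<bar>2 - N + \<sigma>\<bar> * (norm y powr (2 - N + \<sigma>) * norm (y - x) powr (- \<sigma>))"
      by (simp add: norm_minus_commute mult_ac)
    also have "norm y powr (2 - N + \<sigma>) * norm (y - x) powr (- \<sigma>) = norm y powr (2 - N) * (norm (y - x) / norm y) powr (- \<sigma>)"
      using nz powr_ratio[of "norm y" "norm (y - x)" "2 - N" "- \<sigma>"] by simp
    finally show "K x y \<le> A * 4 powr \<bar>2 - N + \<sigma>\<bar> * (norm y powr (2 - N) * (norm (y - x) / norm y) powr (- \<sigma>))" . }
qed

text \<open>The three regions converge because s - \<beta> > -N at 0, t - \<beta> < -N at infinity
  and \<sigma> < N on the diagonal. By homogeneity each contributes a multiple of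
  \<open>|x|^(2 - \<beta>)\<close>.\<close>

lemma kernel_bound_integral:
  fixes K :: "real^'n::finite \<Rightarrow> real^'n \<Rightarrow> real"
  assumes K: "kernel_bound s t \<sigma> A K" and A: "A \<ge> 0"
  defines "N \<equiv> real CARD('n)"
  assumes s: "\<beta> - N < s" and t: "t < \<beta> - N" and \<sigma>: "\<sigma> < N"
  shows "\<exists>M>0. \<forall>x. x \<noteq> 0 \<longrightarrow> (\<integral>\<^sup>+y. ennreal (K x y * norm y powr (-\<beta>)) \<partial>lborel) \<le> ennreal (M * norm x powr (2 - \<beta>))"
proof -
  have D: "real DIM(real^'n) = N" by (simp add: N_def)
  obtain C1 where C1: "C1 \<ge> 0" "\<And>R. R > 0 \<Longrightarrow> (\<integral>\<^sup>+y. ennreal (norm (y::real^'n) powr (s - \<beta>)) * indicator (cball 0 R) y \<partial>lborel)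
           \<le> ennreal (C1 * R powr (s - \<beta> + N))"
    using nn_integral_powr_inside[where 'a = "real^'n" and q = "s - \<beta>", unfolded D] s by auto
  obtain C2 where C2: "C2 \<ge> 0" "\<And>R. R > 0 \<Longrightarrow> (\<integral>\<^sup>+y. ennreal (norm (y::real^'n) powr (t - \<beta>)) * indicator {y. R \<le> norm y} y \<partial>lborel)
           \<le> ennreal (C2 * R powr (t - \<beta> + N))"
    using nn_integral_powr_outside[where 'a = "real^'n" and q = "t - \<beta>", unfolded D] t by auto
  obtain C3 where C3: "C3 \<ge> 0" "\<And>R x. R > 0 \<Longrightarrow> (\<integral>\<^sup>+y. ennreal (norm (x - (y::real^'n)) powr (-\<sigma>)) * indicator (cball x R) y \<partial>lborel)
           \<le> ennreal (C3 * R powr (-\<sigma> + N))"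
    using nn_integral_powr_ball[where 'a = "real^'n" and q = "-\<sigma>", unfolded D] \<sigma> by auto
  \<comment> \<open>The factors come from the radii |x|/4, 4|x| and 5|x|. The ball of radius 5|x|
    about \<open>x\<close> contains the middle region, and the power of 4 compares
    \<open>|y|^(-\<beta>)\<close> with \<open>|x|^(-\<beta>)\<close> there.\<close>
  define M1 where "M1 = C1 * (1/4) powr (s - \<beta> + N)"
  define M2 where "M2 = C2 * 4 powr (t - \<beta> + N)"
  define M3 where "M3 = 4 powr \<bar>-\<beta>\<bar> * (C3 * 5 powr (-\<sigma> + N))"
  have M: "M1 \<ge> 0" "M2 \<ge> 0" "M3 \<ge> 0" using C1 C2 C3 by (auto simp: M1_def M2_def M3_def)
  have "(\<integral>\<^sup>+y. ennreal (K x y * norm y powr (-\<beta>)) \<partial>lborel) \<le> ennreal (A * (M1 + M2 + M3) * norm x powr (2 - \<beta>))"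
    if x: "x \<noteq> 0" for x
  proof -
    let ?X = "norm x"
    have X: "?X > 0" using x by simp
    define e1 where "e1 = A * ?X powr (2 - N - s)"
    define e2 where "e2 = A * ?X powr (2 - N - t)"
    define e3 where "e3 = A * (?X powr (2 - N + \<sigma>) * (4 powr \<bar>-\<beta>\<bar> * ?X powr (-\<beta>)))"
    have e: "e1 \<ge> 0" "e2 \<ge> 0" "e3 \<ge> 0" using A by (auto simp: e1_def e2_def e3_def)
    define f1 where "f1 y = ennreal e1 * (ennreal (norm (y::real^'n) powr (s - \<beta>)) * indicator (cball 0 (?X / 4)) y)" for y
    define f2 where "f2 y = ennreal e2 * (ennreal (norm (y::real^'n) powr (t - \<beta>)) * indicator {y. 4 * ?X \<le> norm y} y)" for y
    define f3 where "f3 y = ennreal e3 * (ennreal (norm (x - y) powr (-\<sigma>)) * indicator (cball x (5 * ?X)) y)" for y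
    have [measurable]: "cball x (5 * ?X) \<in> sets borel" "cball (0::real^'n) (?X / 4) \<in> sets borel" by simp_all
    have [measurable]: "{y::real^'n. 4 * ?X \<le> norm y} \<in> sets borel" by measurable
    have [measurable]: "f1 \<in> borel_measurable lborel" "f2 \<in> borel_measurable lborel" "f3 \<in> borel_measurable lborel"
      unfolding f1_def[abs_def] f2_def[abs_def] f3_def[abs_def] by measurable
    have "AE y in lborel. y \<noteq> (0::real^'n)" "AE y in lborel. y \<noteq> x" by (rule AE_lborel_singleton)+
    then have "AE y in lborel. ennreal (K x y * norm y powr (-\<beta>)) \<le> f1 y + (f2 y + f3 y)"
    proof eventually_elim
      case (elim y)
      have Y: "norm y > 0" using elim by simp
      note Ky = K[unfolded kernel_bound_def N_def[symmetric], rule_format, OF x elim(1) elim(2)[symmetric]]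
      note Ky1 = Ky[THEN conjunct1, rule_format] and Ky2 = Ky[THEN conjunct2, THEN conjunct1, rule_format]
        and Ky3 = Ky[THEN conjunct2, THEN conjunct2, rule_format]
      have q: "?X powr (2 - N) * (norm y / ?X) powr q * norm y powr (-\<beta>) = ?X powr (2 - N - q) * norm y powr (q - \<beta>)" for q
        using X Y powr_ratio[of ?X "norm y" "2 - N" q] powr_add[of "norm y" q "-\<beta>"] by simp
      consider "norm y \<le> ?X / 4" | "4 * ?X \<le> norm y" | "?X / 4 \<le> norm y" "norm y \<le> 4 * ?X" by linarith
      then show ?case
      proof cases
        case 1
        have "K x y * norm y powr (-\<beta>) \<le> A * (?X powr (2 - N) * (norm y / ?X) powr s) * norm y powr (-\<beta>)"
          using 1 by (intro mult_right_mono Ky1) auto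
        also have "\<dots> = e1 * norm y powr (s - \<beta>)" using q[of s] by (simp add: e1_def mult.assoc)
        finally have "ennreal (K x y * norm y powr (-\<beta>)) \<le> f1 y"
          using 1 e by (simp add: f1_def ennreal_mult[symmetric] ennreal_leI)
        then show ?thesis by (rule order_trans) simp
      next
        case 2
        have "K x y * norm y powr (-\<beta>) \<le> A * (?X powr (2 - N) * (norm y / ?X) powr t) * norm y powr (-\<beta>)"
          using 2 by (intro mult_right_mono Ky2) auto
        also have "\<dots> = e2 * norm y powr (t - \<beta>)" using q[of t] by (simp add: e2_def mult.assoc)
        finally have "ennreal (K x y * norm y powr (-\<beta>)) \<le> f2 y"
          using 2 e by (simp add: f2_def ennreal_mult[symmetric] ennreal_leI)
        then have "ennreal (K x y * norm y powr (-\<beta>)) \<le> f2 y + f3 y" by (rule order_trans) simp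
        then show ?thesis by (rule order_trans) simp
      next
        case 3
        have "K x y * norm y powr (-\<beta>) \<le> A * (?X powr (2 - N) * (norm (x - y) / ?X) powr (-\<sigma>)) * norm y powr (-\<beta>)"
          using 3 by (intro mult_right_mono Ky3) auto
        also have "\<dots> \<le> A * (?X powr (2 - N) * (norm (x - y) / ?X) powr (-\<sigma>)) * (4 powr \<bar>-\<beta>\<bar> * ?X powr (-\<beta>))"
          using A X Y 3 by (intro mult_left_mono powr_comparable) auto
        also have "?X powr (2 - N) * (norm (x - y) / ?X) powr (-\<sigma>) = ?X powr (2 - N + \<sigma>) * norm (x - y) powr (-\<sigma>)"
          using X powr_ratio[of ?X "norm (x - y)" "2 - N" "- \<sigma>"] by simp
        also have "A * (?X powr (2 - N + \<sigma>) * norm (x - y) powr (-\<sigma>)) * (4 powr \<bar>-\<beta>\<bar> * ?X powr (-\<beta>)) = e3 * norm (x - y) powr (-\<sigma>)"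
          by (simp add: e3_def mult_ac)
        finally have le: "K x y * norm y powr (-\<beta>) \<le> e3 * norm (x - y) powr (-\<sigma>)" .
        have "norm (x - y) \<le> 5 * ?X" using norm_triangle_ineq4[of x y] 3 by linarith
        then have "ennreal (K x y * norm y powr (-\<beta>)) \<le> f3 y"
          using le e by (simp add: f3_def ennreal_mult[symmetric] ennreal_leI dist_norm)
        then have "ennreal (K x y * norm y powr (-\<beta>)) \<le> f2 y + f3 y" by (rule order_trans) simp
        then show ?thesis by (rule order_trans) simp
      qed
    qed
    then have "(\<integral>\<^sup>+y. ennreal (K x y * norm y powr (-\<beta>)) \<partial>lborel) \<le> (\<integral>\<^sup>+y. f1 y + (f2 y + f3 y) \<partial>lborel)"
      by (rule nn_integral_mono_AE)
    also have "\<dots> = (\<integral>\<^sup>+y. f1 y \<partial>lborel) + (\<integral>\<^sup>+y. f2 y + f3 y \<partial>lborel)" by (rule nn_integral_add) measurable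
    also have "(\<integral>\<^sup>+y. f2 y + f3 y \<partial>lborel) = (\<integral>\<^sup>+y. f2 y \<partial>lborel) + (\<integral>\<^sup>+y. f3 y \<partial>lborel)" by (rule nn_integral_add) measurable
    also have "(\<integral>\<^sup>+y. f1 y \<partial>lborel) \<le> ennreal (A * M1 * ?X powr (2 - \<beta>))"
    proof -
      have "(\<integral>\<^sup>+y. f1 y \<partial>lborel) \<le> ennreal e1 * ennreal (C1 * (?X / 4) powr (s - \<beta> + N))"
        unfolding f1_def by (subst nn_integral_cmult) (measurable, intro mult_left_mono C1, use X in auto)
      also have "\<dots> = ennreal (e1 * (C1 * (?X / 4) powr (s - \<beta> + N)))" using e C1 by (simp add: ennreal_mult)
      also have "(?X / 4) powr (s - \<beta> + N) = (1/4) powr (s - \<beta> + N) * ?X powr (s - \<beta> + N)"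
        using powr_mult[of "1/4" ?X "s - \<beta> + N"] by simp
      also have "e1 * (C1 * ((1/4) powr (s - \<beta> + N) * ?X powr (s - \<beta> + N))) = A * M1 * (?X powr (2 - N - s) * ?X powr (s - \<beta> + N))"
        by (simp add: e1_def M1_def mult_ac)
      also have "?X powr (2 - N - s) * ?X powr (s - \<beta> + N) = ?X powr (2 - \<beta>)" by (simp flip: powr_add)
      finally show ?thesis .
    qed
    also have "(\<integral>\<^sup>+y. f2 y \<partial>lborel) \<le> ennreal (A * M2 * ?X powr (2 - \<beta>))"
    proof -
      have "(\<integral>\<^sup>+y. f2 y \<partial>lborel) \<le> ennreal e2 * ennreal (C2 * (4 * ?X) powr (t - \<beta> + N))"
        unfolding f2_def by (subst nn_integral_cmult) (measurable, intro mult_left_mono C2, use X in auto)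
      also have "\<dots> = ennreal (e2 * (C2 * (4 * ?X) powr (t - \<beta> + N)))" using e C2 by (simp add: ennreal_mult)
      also have "(4 * ?X) powr (t - \<beta> + N) = 4 powr (t - \<beta> + N) * ?X powr (t - \<beta> + N)" by (simp add: powr_mult)
      also have "e2 * (C2 * (4 powr (t - \<beta> + N) * ?X powr (t - \<beta> + N))) = A * M2 * (?X powr (2 - N - t) * ?X powr (t - \<beta> + N))"
        by (simp add: e2_def M2_def mult_ac)
      also have "?X powr (2 - N - t) * ?X powr (t - \<beta> + N) = ?X powr (2 - \<beta>)" by (simp flip: powr_add)
      finally show ?thesis .
    qed
    also have "(\<integral>\<^sup>+y. f3 y \<partial>lborel) \<le> ennreal (A * M3 * ?X powr (2 - \<beta>))"
    proof -
      have "(\<integral>\<^sup>+y. f3 y \<partial>lborel) \<le> ennreal e3 * ennreal (C3 * (5 * ?X) powr (-\<sigma> + N))"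
        unfolding f3_def by (subst nn_integral_cmult) (measurable, intro mult_left_mono C3, use X in auto)
      also have "\<dots> = ennreal (e3 * (C3 * (5 * ?X) powr (-\<sigma> + N)))" using e C3 by (simp add: ennreal_mult)
      also have "(5 * ?X) powr (-\<sigma> + N) = 5 powr (-\<sigma> + N) * ?X powr (-\<sigma> + N)" by (simp add: powr_mult)
      also have "e3 * (C3 * (5 powr (-\<sigma> + N) * ?X powr (-\<sigma> + N))) = A * M3 * (?X powr (2 - N + \<sigma>) * ?X powr (-\<beta>) * ?X powr (-\<sigma> + N))"
        by (simp add: e3_def M3_def mult_ac)
      also have "?X powr (2 - N + \<sigma>) * ?X powr (-\<beta>) * ?X powr (-\<sigma> + N) = ?X powr (2 - \<beta>)" by (simp flip: powr_add)
      finally show ?thesis .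
    qed
    also have "ennreal (A * M1 * ?X powr (2 - \<beta>)) + (ennreal (A * M2 * ?X powr (2 - \<beta>)) + ennreal (A * M3 * ?X powr (2 - \<beta>)))
      = ennreal (A * M1 * ?X powr (2 - \<beta>) + (A * M2 * ?X powr (2 - \<beta>) + A * M3 * ?X powr (2 - \<beta>)))"
      using A M by (simp add: ennreal_plus)
    also have "\<dots> = ennreal (A * (M1 + M2 + M3) * ?X powr (2 - \<beta>))" by (simp add: algebra_simps)
    finally show ?thesis by (simp add: add_mono)
  qed
  \<comment> \<open>Adding 1 keeps the final constant positive even if the product is 0.\<close>
  moreover have "ennreal (A * (M1 + M2 + M3) * norm x powr (2 - \<beta>)) \<le> ennreal ((A * (M1 + M2 + M3) + 1) * norm x powr (2 - \<beta>))" for x :: "real^'n"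
    by (intro ennreal_leI mult_right_mono) auto
  moreover have "A * (M1 + M2 + M3) + 1 > 0" using A M by (simp add: add_nonneg_pos)
  ultimately show ?thesis by (meson order_trans)
qed

text \<open>As \<delta> may be arbitrarily small, the window between the orders at infinity and at 0
  fills the open interval from \<open>m\<close> to \<open>m + 1\<close>.\<close>

lemma newton_rest_kbound:
  assumes N2: "CARD('n::finite) \<ge> 2" and d: "\<delta> > 0"
  shows "\<exists>A\<ge>0. kernel_bound (real m + 1) (real m + \<delta>) (sing_order (real CARD('n))) A (\<lambda>x y::real^'n. \<bar>newton_rest m x y\<bar>)"
proof -
  define N where "N = real CARD('n)"
  obtain A1 where A1: "A1 \<ge> 0" "\<And>x y::real^'n. x \<noteq> 0 \<Longrightarrow> norm y \<le> norm x / 4 \<Longrightarrow>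
     \<bar>newton_rest m x y\<bar> \<le> norm x powr (2 - N) * (A1 * (norm y / norm x) ^ Suc m)"
    using newton_rest_inner[OF N2, of m] unfolding N_def by blast
  obtain A2 where A2: "A2 \<ge> 0" "\<And>x y::real^'n. x \<noteq> 0 \<Longrightarrow> norm y \<ge> 4 * norm x \<Longrightarrow>
     \<bar>newton_rest m x y\<bar> \<le> norm x powr (2 - N) * (A2 * (norm y / norm x) powr (real m + \<delta>))"
    using newton_rest_outer[OF N2 d, of m] unfolding N_def by blast
  obtain A3 where A3: "A3 \<ge> 0" "\<And>x y::real^'n. x \<noteq> 0 \<Longrightarrow> x \<noteq> y \<Longrightarrow> norm y \<le> 4 * norm x \<Longrightarrow>
     \<bar>newton_rest m x y\<bar> \<le> norm x powr (2 - N) * (A3 * (norm (x - y) / norm x) powr (- sing_order N))"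
    using newton_rest_middle[OF N2, of m] unfolding N_def by blast
  define A where "A = A1 + A2 + A3"
  have A: "A1 \<le> A" "A2 \<le> A" "A3 \<le> A" "A \<ge> 0" using A1(1) A2(1) A3(1) by (auto simp: A_def)
  have up: "q \<le> P * (B * Q) \<Longrightarrow> B \<le> A \<Longrightarrow> P \<ge> 0 \<Longrightarrow> Q \<ge> 0 \<Longrightarrow> q \<le> A * (P * Q)" for q P B Q :: real
    using mult_right_mono[of B A "P * Q"] by (simp add: mult_ac)
  have "kernel_bound (real m + 1) (real m + \<delta>) (sing_order N) A (\<lambda>x y::real^'n. \<bar>newton_rest m x y\<bar>)"
    unfolding kernel_bound_def N_def[symmetric]
  proof (intro allI impI conjI)
    fix x y :: "real^'n" assume nz: "x \<noteq> 0" "y \<noteq> 0" "x \<noteq> y"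
    { assume a: "norm y \<le> norm x / 4"
      have eq: "(norm y / norm x) ^ Suc m = (norm y / norm x) powr (real m + 1)"
        using nz powr_realpow[of "norm y / norm x" "Suc m"] by (simp add: add.commute)
      show "\<bar>newton_rest m x y\<bar> \<le> A * (norm x powr (2 - N) * (norm y / norm x) powr (real m + 1))"
        using A1(2)[OF nz(1) a] unfolding eq by (rule up[OF _ A(1)]) auto }
    { assume "4 * norm x \<le> norm y"
      then show "\<bar>newton_rest m x y\<bar> \<le> A * (norm x powr (2 - N) * (norm y / norm x) powr (real m + \<delta>))"
        using A2(2)[OF nz(1)] A(2) by (intro up[where B = A2]) auto }
    { assume "norm y \<le> 4 * norm x"
      then show "\<bar>newton_rest m x y\<bar> \<le> A * (norm x powr (2 - N) * (norm (x - y) / norm x) powr (- sing_order N))"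
        using A3(2)[OF nz(1,3)] A(3) by (intro up[where B = A3]) auto }
  qed
  then show ?thesis using A(4) unfolding N_def by blast
qed

section \<open>Weighted norms and the passage from kernel bounds to inequalities\<close>

lemma continuous_weight:
  fixes w :: "real^'n::finite \<Rightarrow> real"
  assumes w: "continuous_on UNIV w" "\<And>x. norm x < r \<Longrightarrow> w x = 0" and r: "r > 0"
  shows "continuous_on UNIV (\<lambda>x. norm x powr \<gamma> * w x)"
proof -
  have 1: "continuous_on (ball 0 r) (\<lambda>x. norm x powr \<gamma> * w x)"
    by (rule continuous_on_eq[where f = "\<lambda>_. 0"]) (use w(2) in \<open>auto intro: continuous_on_const\<close>)
  have 2: "continuous_on (- {0}) (\<lambda>x. norm x powr \<gamma> * w x)"
    by (intro continuous_on_mult continuous_on_powr continuous_on_norm continuous_on_id continuous_on_const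
        continuous_on_subset[OF w(1)]) auto
  have "ball 0 r \<union> - {0} = (UNIV :: (real^'n) set)" using r by auto
  moreover have "open (- {0::real^'n})" by (rule open_Compl) simp
  ultimately show ?thesis using continuous_on_open_Un[OF open_ball _ 1 2] by metis
qed

text \<open>\<open>Lp_norm top\<close> passes through \<open>real_of_ereal\<close>, which sends
  infinite values to 0. The bound \<open>B\<close> makes the essential supremum finite, so that it
  keeps its usual meaning.\<close>

lemma Linf_facts:
  fixes f :: "real^'n::finite \<Rightarrow> real"
  assumes [measurable]: "f \<in> borel_measurable borel" and B: "\<And>x. \<bar>f x\<bar> \<le> B"
  shows "0 \<le> Lp_norm top f" "AE x in lborel. \<bar>f x\<bar> \<le> Lp_norm top f"
    "\<And>b. (AE x in lborel. \<bar>f x\<bar> \<le> b) \<Longrightarrow> Lp_norm top f \<le> b"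
proof -
  define E where "E = esssup lborel (\<lambda>x. ereal \<bar>f x\<bar>)"
  have m: "(\<lambda>x. ereal \<bar>f x\<bar>) \<in> borel_measurable lborel" by measurable
  have ae: "AE x in lborel. ereal \<bar>f x\<bar> \<le> E" unfolding E_def by (rule esssup_AE)
  have le: "E \<le> ereal b" if "AE x in lborel. \<bar>f x\<bar> \<le> b" for b
    unfolding E_def using that by (intro esssup_I m) auto
  have "E \<le> ereal B" using B by (intro le) auto
  moreover have "0 \<le> E"
  proof (rule ccontr)
    assume "\<not> 0 \<le> E"
    from ae have "AE x in (lborel :: (real^'n) measure). False"
    proof eventually_elim
      case (elim x)
      have "ereal 0 \<le> ereal \<bar>f x\<bar>" by simp
      then have "0 \<le> E" using elim order_trans by (metis zero_ereal_def)
      then show ?case using \<open>\<not> 0 \<le> E\<close> by simp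
    qed
    then show False by (simp add: AE_iff_null null_sets_def)
  qed
  ultimately obtain e where e: "E = ereal e" "e \<ge> 0" by (cases E) auto
  have L: "Lp_norm top f = e" using e by (simp add: Lp_norm_def E_def)
  show "0 \<le> Lp_norm top f" using L e by simp
  show "AE x in lborel. \<bar>f x\<bar> \<le> Lp_norm top f" using ae unfolding L e by simp
  show "Lp_norm top f \<le> b" if "AE x in lborel. \<bar>f x\<bar> \<le> b" for b using le[OF that] unfolding L e by simp
qed

lemma finite_exponent:
  fixes p :: ennreal assumes "1 \<le> p" "p \<noteq> top"
  shows "enn2real p \<ge> 1" "inv_exp p = 1 / enn2real p"
  using assms by (auto simp: inv_exp_def) (metis enn2real_1 enn2real_mono less_top)

text \<open>The weights are moved into the kernel
  \<open>|x|^(\<alpha>-2) K x y |y|^(-\<alpha>)\<close>, which has to be bounded on unweighted L^p;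
  this is the Schur test with \<open>a = N/p\<close> and \<open>b = N/p'\<close>. For
  \<open>p = top\<close> the exponent \<open>a\<close> is 0, and the first bound becomes a uniform
  bound on the integral of the kernel in \<open>y\<close>, hence a sup estimate.\<close>

theorem rellich_from_kernel:
  fixes u :: "real^'n::finite \<Rightarrow> real" and p :: ennreal
  defines "N \<equiv> real CARD('n)"
  assumes p: "1 \<le> p" and u: "test_fun u" and c: "c > 0" and M: "M > 0"
    and [measurable]: "case_prod K \<in> borel_measurable (borel \<Otimes>\<^sub>M borel)" and K0: "\<And>x y. K x y \<ge> 0"
    and A: "\<And>x. x \<noteq> 0 \<Longrightarrow> (\<integral>\<^sup>+y. ennreal (K x y * norm y powr (-(\<alpha> + N * inv_exp p))) \<partial>lborel) \<le> ennreal (M * norm x powr (2 - (\<alpha> + N * inv_exp p)))"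
    and B: "\<And>y. y \<noteq> 0 \<Longrightarrow> (\<integral>\<^sup>+x. ennreal (K x y * norm x powr (\<alpha> + N * inv_exp p - N - 2)) \<partial>lborel) \<le> ennreal (M * norm y powr (\<alpha> + N * inv_exp p - N))"
    and rep: "\<And>x. x \<noteq> 0 \<Longrightarrow> ennreal \<bar>c * u x\<bar> \<le> (\<integral>\<^sup>+y. ennreal (K x y * \<bar>laplacian u y\<bar>) \<partial>lborel)"
  shows "c * Lp_norm p (\<lambda>x. norm x powr (\<alpha> - 2) * u x) \<le> M * Lp_norm p (\<lambda>x. norm x powr \<alpha> * laplacian u x)"
proof -
  define k where "k x y = norm x powr (\<alpha> - 2) * K x y * norm y powr (-\<alpha>)" for x y
  define F where "F y = norm y powr \<alpha> * laplacian u y" for y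
  define V where "V x = norm x powr (\<alpha> - 2) * u x" for x
  obtain r R where rR: "0 < r" "r < R" "\<And>x. norm x < r \<Longrightarrow> u x = 0" "\<And>x. norm x > R \<Longrightarrow> u x = 0"
    "\<And>x. norm x < r \<Longrightarrow> laplacian u x = 0" "\<And>x. norm x > R \<Longrightarrow> laplacian u x = 0"
    using test_fun_support[OF u] by metis
  have sm: "smooth_fun u" using u by (simp add: test_fun_def)
  have cF: "continuous_on UNIV F" unfolding F_def by (rule continuous_weight[OF smooth_facts(6)[OF sm] rR(5,1)])
  have cV: "continuous_on UNIV V" unfolding V_def by (rule continuous_weight[OF smooth_facts(1)[OF sm] rR(3,1)])
  have zF: "\<And>x. norm x > R \<Longrightarrow> F x = 0" and zV: "\<And>x. norm x > R \<Longrightarrow> V x = 0" using rR by (auto simp: F_def V_def)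
  have [measurable]: "F \<in> borel_measurable borel" "V \<in> borel_measurable borel"
    using cF cV by (auto intro: borel_measurable_continuous_onI)
  have [measurable]: "case_prod k \<in> borel_measurable (borel \<Otimes>\<^sub>M borel)" unfolding k_def by measurable
  have k0: "k x y \<ge> 0" for x y using K0 by (simp add: k_def)
  have AE0: "AE y in lborel. y \<noteq> (0::real^'n)" by (rule AE_lborel_singleton)
  have rep': "ennreal (c * \<bar>V x\<bar>) \<le> (\<integral>\<^sup>+y. ennreal (k x y * \<bar>F y\<bar>) \<partial>lborel)" if x: "x \<noteq> 0" for x
  proof -
    have "ennreal (c * \<bar>V x\<bar>) = ennreal (norm x powr (\<alpha> - 2)) * ennreal \<bar>c * u x\<bar>"
      using c by (simp add: V_def abs_mult ennreal_mult[symmetric] mult_ac)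
    also have "\<dots> \<le> ennreal (norm x powr (\<alpha> - 2)) * (\<integral>\<^sup>+y. ennreal (K x y * \<bar>laplacian u y\<bar>) \<partial>lborel)"
      by (intro mult_left_mono rep x) auto
    also have "\<dots> = (\<integral>\<^sup>+y. ennreal (norm x powr (\<alpha> - 2)) * ennreal (K x y * \<bar>laplacian u y\<bar>) \<partial>lborel)"
      using borel_measurable_continuous_onI[OF smooth_facts(6)[OF sm]] by (intro nn_integral_cmult[symmetric]) measurable
    also have "\<dots> = (\<integral>\<^sup>+y. ennreal (k x y * \<bar>F y\<bar>) \<partial>lborel)"
    proof (rule nn_integral_cong_AE)
      show "AE y in lborel. ennreal (norm x powr (\<alpha> - 2)) * ennreal (K x y * \<bar>laplacian u y\<bar>) = ennreal (k x y * \<bar>F y\<bar>)"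
        using AE0
      proof eventually_elim
        case (elim y)
        have "k x y * \<bar>F y\<bar> = norm x powr (\<alpha> - 2) * (K x y * \<bar>laplacian u y\<bar>) * (norm y powr (-\<alpha>) * norm y powr \<alpha>)"
          by (simp add: k_def F_def abs_mult)
        also have "norm y powr (-\<alpha>) * norm y powr \<alpha> = 1" using elim by (simp flip: powr_add)
        finally show ?case using K0 by (simp add: ennreal_mult)
      qed
    qed
    finally show ?thesis .
  qed
  have kA: "(\<integral>\<^sup>+y. ennreal (k x y * norm y powr (- (N * inv_exp p))) \<partial>lborel) \<le> ennreal (M * norm x powr (- (N * inv_exp p)))" if x: "x \<noteq> 0" for x
  proof -
    have "(\<integral>\<^sup>+y. ennreal (k x y * norm y powr (- (N * inv_exp p))) \<partial>lborel)
      = (\<integral>\<^sup>+y. ennreal (norm x powr (\<alpha> - 2)) * ennreal (K x y * norm y powr (-(\<alpha> + N * inv_exp p))) \<partial>lborel)"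
    proof (rule nn_integral_cong)
      fix y :: "real^'n"
      have "norm y powr (-(\<alpha> + N * inv_exp p)) = norm y powr (-\<alpha>) * norm y powr (- (N * inv_exp p))" by (simp flip: powr_add)
      then show "ennreal (k x y * norm y powr (- (N * inv_exp p))) = ennreal (norm x powr (\<alpha> - 2)) * ennreal (K x y * norm y powr (-(\<alpha> + N * inv_exp p)))"
        using K0 by (simp add: k_def ennreal_mult[symmetric] mult_ac)
    qed
    also have "\<dots> = ennreal (norm x powr (\<alpha> - 2)) * (\<integral>\<^sup>+y. ennreal (K x y * norm y powr (-(\<alpha> + N * inv_exp p))) \<partial>lborel)"
      by (rule nn_integral_cmult) measurable
    also have "\<dots> \<le> ennreal (norm x powr (\<alpha> - 2)) * ennreal (M * norm x powr (2 - (\<alpha> + N * inv_exp p)))"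
      by (intro mult_left_mono A x) auto
    also have "\<dots> = ennreal (M * (norm x powr (\<alpha> - 2) * norm x powr (2 - (\<alpha> + N * inv_exp p))))"
      using M by (simp add: ennreal_mult[symmetric] mult_ac)
    also have "norm x powr (\<alpha> - 2) * norm x powr (2 - (\<alpha> + N * inv_exp p)) = norm x powr (- (N * inv_exp p))" by (simp flip: powr_add)
    finally show ?thesis .
  qed
  have "c * Lp_norm p V \<le> M * Lp_norm p F"
  proof (cases "p = top")
    case True
    obtain BF where BF: "\<And>x. \<bar>F x\<bar> \<le> BF" using bounded_compact_support[OF cF zF] by blast
    obtain BV where BV: "\<And>x. \<bar>V x\<bar> \<le> BV" using bounded_compact_support[OF cV zV] by blast
    define G where "G = Lp_norm top F"
    have F1: "0 \<le> G" "AE x in lborel. \<bar>F x\<bar> \<le> G"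
      unfolding G_def by (rule Linf_facts(1,2)[where B = BF]; simp add: BF)+
    have i0: "inv_exp p = 0" using True by (simp add: inv_exp_def)
    have "c * \<bar>V x\<bar> \<le> M * G" if x: "x \<noteq> 0" for x
    proof -
      have "ennreal (c * \<bar>V x\<bar>) \<le> (\<integral>\<^sup>+y. ennreal (k x y * \<bar>F y\<bar>) \<partial>lborel)" by (rule rep'[OF x])
      also have "\<dots> \<le> (\<integral>\<^sup>+y. ennreal G * ennreal (k x y * norm y powr (- (N * inv_exp p))) \<partial>lborel)"
      proof (rule nn_integral_mono_AE)
        show "AE y in lborel. ennreal (k x y * \<bar>F y\<bar>) \<le> ennreal G * ennreal (k x y * norm y powr (- (N * inv_exp p)))"
          using F1(2) AE0
        proof eventually_elim
          case (elim y)
          have "k x y * \<bar>F y\<bar> \<le> k x y * G" using elim k0 by (intro mult_left_mono) auto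
          then show ?case using elim F1(1) k0 by (simp add: i0 ennreal_mult[symmetric] mult.commute ennreal_leI)
        qed
      qed
      also have "\<dots> = ennreal G * (\<integral>\<^sup>+y. ennreal (k x y * norm y powr (- (N * inv_exp p))) \<partial>lborel)"
        by (rule nn_integral_cmult) measurable
      also have "\<dots> \<le> ennreal G * ennreal (M * norm x powr (- (N * inv_exp p)))" by (intro mult_left_mono kA x) auto
      also have "\<dots> = ennreal (M * G)" using x F1 M by (simp add: i0 ennreal_mult mult.commute)
      finally show ?thesis using M F1 by (simp add: ennreal_le_iff)
    qed
    then have "AE x in lborel. \<bar>V x\<bar> \<le> M * G / c"
      using AE0 by (auto elim!: eventually_mono simp: field_simps c)
    then have "Lp_norm top V \<le> M * G / c" by (intro Linf_facts(3)[where B = BV]) (simp_all add: BV)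
    then show ?thesis using c True by (simp add: G_def field_simps)
  next
    case False
    define P where "P = enn2real p"
    have P: "P \<ge> 1" "inv_exp p = 1 / P" using finite_exponent[OF p False] by (simp_all add: P_def)
    \<comment> \<open>The weight \<open>|y|^(-a)\<close> is critical for L^p, and the dual exponent
      is \<open>b = N - N/p\<close>; with this choice the two hypotheses on \<open>K\<close> are the
      two Schur bounds for \<open>k\<close>.\<close>
    define a where "a = N * inv_exp p"
    define b where "b = a * (P - 1)"
    have bN: "b = N - a" using P by (simp add: b_def a_def field_simps)
    have kB: "(\<integral>\<^sup>+x. ennreal (k x y * norm x powr (- b)) \<partial>lborel) \<le> ennreal (M * norm y powr (- b))" if y: "y \<noteq> 0" for y
    proof -
      have "(\<integral>\<^sup>+x. ennreal (k x y * norm x powr (- b)) \<partial>lborel)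
        = (\<integral>\<^sup>+x. ennreal (norm y powr (-\<alpha>)) * ennreal (K x y * norm x powr (\<alpha> + N * inv_exp p - N - 2)) \<partial>lborel)"
      proof (rule nn_integral_cong)
        fix x :: "real^'n"
        have "\<alpha> + N * inv_exp p - N - 2 = (\<alpha> - 2) + (- b)" by (simp add: bN a_def)
        then have "norm x powr (\<alpha> + N * inv_exp p - N - 2) = norm x powr (\<alpha> - 2) * norm x powr (- b)" by (simp only: powr_add)
        then show "ennreal (k x y * norm x powr (- b)) = ennreal (norm y powr (-\<alpha>)) * ennreal (K x y * norm x powr (\<alpha> + N * inv_exp p - N - 2))"
          using K0 by (simp add: k_def ennreal_mult[symmetric] mult_ac)
      qed
      also have "\<dots> = ennreal (norm y powr (-\<alpha>)) * (\<integral>\<^sup>+x. ennreal (K x y * norm x powr (\<alpha> + N * inv_exp p - N - 2)) \<partial>lborel)"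
        by (rule nn_integral_cmult) measurable
      also have "\<dots> \<le> ennreal (norm y powr (-\<alpha>)) * ennreal (M * norm y powr (\<alpha> + N * inv_exp p - N))"
        by (intro mult_left_mono B y) auto
      also have "\<dots> = ennreal (M * (norm y powr (-\<alpha>) * norm y powr (\<alpha> + N * inv_exp p - N)))"
        using M by (simp add: ennreal_mult[symmetric] mult_ac)
      also have "norm y powr (-\<alpha>) * norm y powr (\<alpha> + N * inv_exp p - N) = norm y powr (- b)"
        by (simp add: bN a_def flip: powr_add)
      finally show ?thesis .
    qed
    have sch: "(\<integral>\<^sup>+x. ennreal ((c * \<bar>V x\<bar>) powr P) \<partial>lborel) \<le> ennreal (M powr P) * (\<integral>\<^sup>+y. ennreal (\<bar>F y\<bar> powr P) \<partial>lborel)"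
      by (rule schur_test[where k = k and a = a and b = b and M = M, OF _ _ k0 _ _ P(1) b_def M])
         (use c kA kB rep' in \<open>auto simp: a_def\<close>)
    have iF: "integrable lborel (\<lambda>y. \<bar>F y\<bar> powr P)"
      using zF P by (intro integrable_compact_support[where R = R] continuous_on_powr' continuous_on_const continuous_on_rabs cF) auto
    have iV: "integrable lborel (\<lambda>x. \<bar>V x\<bar> powr P)"
      using zV P by (intro integrable_compact_support[where R = R] continuous_on_powr' continuous_on_const continuous_on_rabs cV) auto
    have "(\<integral>\<^sup>+x. ennreal ((c * \<bar>V x\<bar>) powr P) \<partial>lborel) = ennreal (c powr P * (\<integral>x. \<bar>V x\<bar> powr P \<partial>lborel))"
      using c iV by (simp add: powr_mult nn_integral_eq_integral integrable_mult_right)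
    moreover have "(\<integral>\<^sup>+y. ennreal (\<bar>F y\<bar> powr P) \<partial>lborel) = ennreal (\<integral>x. \<bar>F x\<bar> powr P \<partial>lborel)"
      using iF by (simp add: nn_integral_eq_integral)
    ultimately have "ennreal (c powr P * (\<integral>x. \<bar>V x\<bar> powr P \<partial>lborel)) \<le> ennreal (M powr P * (\<integral>x. \<bar>F x\<bar> powr P \<partial>lborel))"
      using sch by (simp add: ennreal_mult)
    then have "c powr P * (\<integral>x. \<bar>V x\<bar> powr P \<partial>lborel) \<le> M powr P * (\<integral>x. \<bar>F x\<bar> powr P \<partial>lborel)"
      by (subst (asm) ennreal_le_iff) auto
    then have "(c powr P * (\<integral>x. \<bar>V x\<bar> powr P \<partial>lborel)) powr (1/P) \<le> (M powr P * (\<integral>x. \<bar>F x\<bar> powr P \<partial>lborel)) powr (1/P)"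
      using P by (intro powr_mono2) auto
    then show ?thesis using P c M False by (simp add: Lp_norm_def P_def[symmetric] powr_mult powr_powr)
  qed
  then show ?thesis unfolding V_def F_def .
qed

section \<open>Smooth test functions concentrated on wide annuli\<close>

text \<open>The denominators \<open>t^m\<close> make the family closed under differentiation up to
  linear combinations, so all orders of smoothness follow from one induction.\<close>

definition flat :: "nat \<Rightarrow> real \<Rightarrow> real" where
  "flat m t = (if t > 0 then exp (- (1 / t)) / t ^ m else 0)"

lemma flat_deriv: "(flat m has_real_derivative flat (m + 2) t - real m * flat (m + 1) t) (at t)"
proof -
  consider "t > 0" | "t < 0" | "t = 0" by linarith
  then show ?thesis
  proof cases
    case 1
    have d: "((\<lambda>t. exp (- (1 / t)) / t ^ m) has_real_derivative
      (exp (- (1 / t)) * (1 / t\<^sup>2) * t ^ m - exp (- (1 / t)) * (real m * t ^ (m - 1))) / (t ^ m * t ^ m)) (at t)"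
      using 1 by (auto intro!: derivative_eq_intros simp: power2_eq_square divide_simps)
    have e: "(exp (- (1 / t)) * (1 / t\<^sup>2) * t ^ m - exp (- (1 / t)) * (real m * t ^ (m - 1))) / (t ^ m * t ^ m)
      = flat (m + 2) t - real m * flat (m + 1) t"
    proof (cases m)
      case 0
      then show ?thesis using 1 by (simp add: flat_def power2_eq_square)
    next
      case (Suc k)
      then show ?thesis using 1 by (simp add: flat_def field_simps power2_eq_square)
    qed
    show ?thesis
      by (rule has_field_derivative_transform_within_open[OF d[unfolded e], of "{0<..}"]) (use 1 in \<open>auto simp: flat_def\<close>)
  next
    case 2
    have "((\<lambda>t. 0) has_real_derivative 0) (at t)" by simp
    then have "(flat m has_real_derivative 0) (at t)"
      by (rule has_field_derivative_transform_within_open[where S = "{..<0}"]) (use 2 in \<open>auto simp: flat_def\<close>)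
    then show ?thesis using 2 by (simp add: flat_def)
  next
    case 3
    have R: "((\<lambda>h. (flat m (0 + h) - flat m 0) / h) \<longlongrightarrow> 0) (at_right 0)"
    proof -
      \<comment> \<open>With \<open>x = 1/h\<close> the right difference quotient is
        \<open>x^(m+1) / exp x\<close>.\<close>
      have "((\<lambda>h::real. inverse h ^ Suc m / exp (inverse h)) \<longlongrightarrow> 0) (at_right 0)"
        by (rule filterlim_compose[OF tendsto_power_div_exp_0 filterlim_inverse_at_top_right])
      moreover have "eventually (\<lambda>h::real. inverse h ^ Suc m / exp (inverse h) = (flat m (0 + h) - flat m 0) / h) (at_right 0)"
        using eventually_at_right_less[of "0::real"]
        by eventually_elim (simp add: flat_def exp_minus field_simps)
      ultimately show ?thesis by (rule Lim_transform_eventually)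
    qed
    have L: "((\<lambda>h. (flat m (0 + h) - flat m 0) / h) \<longlongrightarrow> 0) (at_left 0)"
    proof (rule Lim_transform_eventually[OF tendsto_const])
      show "eventually (\<lambda>h::real. 0 = (flat m (0 + h) - flat m 0) / h) (at_left 0)"
        using eventually_at_left_real[of "-1" "0::real"] by (auto elim!: eventually_mono simp: flat_def)
    qed
    have "(flat m has_real_derivative 0) (at 0)"
      unfolding DERIV_def using L R by (simp add: filterlim_split_at)
    then show ?thesis using 3 by (simp add: flat_def)
  qed
qed

lemma flat_Ck1: "Ck1 n (flat m)"
proof (induction n arbitrary: m)
  case 0
  show ?case by (simp, rule DERIV_continuous_on[OF has_field_derivative_at_within[OF flat_deriv]])
next
  case (Suc n)
  have "Ck1 n (\<lambda>t. flat (m + 2) t + (- real m) * flat (m + 1) t)"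
    by (intro Ck1_add Ck1_mult Ck1_const Suc.IH)
  then have "Ck1 n (\<lambda>t. flat (m + 2) t - real m * flat (m + 1) t)" by simp
  then show ?case using flat_deriv[of m] by (auto intro!: exI[of _ "\<lambda>t. flat (m + 2) t - real m * flat (m + 1) t"])
qed

definition smooth1 :: "(real \<Rightarrow> real) \<Rightarrow> bool" where "smooth1 f \<longleftrightarrow> (\<forall>n. Ck1 n f)"

definition supp1 :: "(real \<Rightarrow> real) \<Rightarrow> bool" where "supp1 f \<longleftrightarrow> (\<forall>t. \<bar>t\<bar> > 1 \<longrightarrow> f t = 0)"

lemma smooth1_has_deriv:
  assumes "smooth1 f" shows "(f has_real_derivative deriv f t) (at t)"
proof -
  have "Ck1 (Suc 0) f" using assms by (simp add: smooth1_def del: Ck1.simps)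
  then obtain g where "\<And>t. (f has_real_derivative g t) (at t)" by auto
  then show ?thesis using DERIV_imp_deriv by metis
qed

lemma smooth1_deriv:
  assumes "smooth1 f" shows "smooth1 (deriv f)"
  unfolding smooth1_def
proof
  fix n
  have "Ck1 (Suc n) f" using assms by (simp add: smooth1_def del: Ck1.simps)
  then obtain g where g: "\<And>t. (f has_real_derivative g t) (at t)" "Ck1 n g" by auto
  then have "deriv f = g" using DERIV_imp_deriv by blast
  then show "Ck1 n (deriv f)" using g by simp
qed

lemma supp1_deriv:
  assumes "supp1 f" shows "supp1 (deriv f)"
  unfolding supp1_def
proof (intro allI impI)
  fix t :: real assume t: "\<bar>t\<bar> > 1"
  have o: "open {t::real. 1 < \<bar>t\<bar>}" by (intro open_Collect_less continuous_on_const continuous_on_rabs continuous_on_id)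
  have d: "((\<lambda>t. 0) has_real_derivative 0) (at t)" by simp
  have "(f has_real_derivative 0) (at t)"
    by (rule has_field_derivative_transform_within_open[OF d o]) (use t assms in \<open>auto simp: supp1_def\<close>)
  then show "deriv f t = 0" by (rule DERIV_imp_deriv)
qed

lemma smooth1_combine:
  "smooth1 f \<Longrightarrow> smooth1 g \<Longrightarrow> smooth1 (\<lambda>t. a * f t + b * g t)"
  unfolding smooth1_def by (auto intro!: Ck1_add Ck1_mult Ck1_const)

lemma smooth1_bounded:
  assumes "smooth1 f" "supp1 f" shows "\<exists>D\<ge>0. \<forall>t. \<bar>f t\<bar> \<le> D"
proof (rule bounded_compact_support[where R = 1])
  show "continuous_on UNIV f" using assms(1) Ck1_cont by (auto simp: smooth1_def)
  show "f x = 0" if "norm x > 1" for x using assms(2) that by (simp add: supp1_def)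
qed

lemma exists_bump:
  "\<exists>\<eta>. smooth1 \<eta> \<and> supp1 \<eta> \<and> \<eta> 0 = 1 \<and> (\<forall>t. 0 \<le> \<eta> t \<and> \<eta> t \<le> 1) \<and>
     (\<exists>c1>0. \<forall>t. \<bar>t\<bar> \<le> 1/2 \<longrightarrow> c1 \<le> \<eta> t)"
proof (intro exI conjI)
  \<comment> \<open>The factor \<open>exp 1\<close> normalises the value at 0 to 1.\<close>
  let ?\<eta> = "\<lambda>t::real. exp 1 * flat 0 (1 + (-1) * (t * t))"
  show "smooth1 ?\<eta>" unfolding smooth1_def
  proof
    fix n
    have "Ck1 n (\<lambda>t. 1 + (-1) * (t * t))" by (intro Ck1_add Ck1_mult Ck1_const Ck1_ident)
    then show "Ck1 n ?\<eta>" by (intro Ck1_mult Ck1_const Ck1_compose[OF flat_Ck1])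
  qed
  show "supp1 ?\<eta>" unfolding supp1_def
  proof (intro allI impI)
    fix t :: real assume "\<bar>t\<bar> > 1"
    then have "1 < \<bar>t\<bar> * \<bar>t\<bar>" by (rule less_1_mult[rotated]) fact
    then show "?\<eta> t = 0" by (simp add: flat_def)
  qed
  show "?\<eta> 0 = 1" by (simp add: flat_def exp_minus)
  show "\<forall>t. 0 \<le> ?\<eta> t \<and> ?\<eta> t \<le> 1"
  proof (intro allI conjI)
    fix t :: real
    show "0 \<le> ?\<eta> t" by (simp add: flat_def)
    show "?\<eta> t \<le> 1"
    proof (cases "1 - t * t > 0")
      case True
      have "1 \<le> 1 / (1 - t * t)" using True by (simp add: field_simps)
      then have "exp 1 * exp (- (1 / (1 - t * t))) \<le> 1" by (simp flip: exp_add)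
      then show ?thesis using True by (simp add: flat_def)
    qed (simp add: flat_def)
  qed
  \<comment> \<open>The value of the bump at 1/2, as 1 - 1/(1 - 1/4) = -1/3.\<close>
  show "exp (-1/3) > (0::real)" by simp
  show "\<forall>t. \<bar>t\<bar> \<le> 1/2 \<longrightarrow> exp (-1/3) \<le> ?\<eta> t"
  proof (intro allI impI)
    fix t :: real assume "\<bar>t\<bar> \<le> 1/2"
    then have "\<bar>t\<bar> * \<bar>t\<bar> \<le> 1/2 * (1/2)" by (intro mult_mono) auto
    then have t: "t * t \<le> 1/4" by simp
    then have "1 / (1 - t * t) \<le> 4/3" by (simp add: field_simps)
    then have "exp (-1/3) \<le> exp (1 + - (1 / (1 - t * t)))" by simp
    also have "\<dots> = exp 1 * exp (- (1 / (1 - t * t)))" by (rule exp_add)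
    finally show "exp (-1/3) \<le> ?\<eta> t" using t by (simp add: flat_def)
  qed
qed

section \<open>Cutoffs in the logarithmic variable\<close>

definition log_cutoff :: "real \<Rightarrow> (real \<Rightarrow> real) \<Rightarrow> real \<Rightarrow> real \<Rightarrow> real" where
  "log_cutoff b \<eta> K s = (if s > 0 then s powr b * \<eta> (ln s / K) else 0)"

text \<open>Differentiation stays within the family: the exponent drops by 1, and each derivative
  that falls on \<eta> costs a factor \<open>1/K\<close>. This factor makes the cutoff
  asymptotically invisible in the Laplacian.\<close>

lemma log_cutoff_deriv:
  assumes K: "K > 0" and \<eta>: "smooth1 \<eta>" "supp1 \<eta>"
  shows "(log_cutoff b \<eta> K has_real_derivative log_cutoff (b - 1) (\<lambda>t. b * \<eta> t + (1 / K) * deriv \<eta> t) K s) (at s)"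
proof (cases "s > 0")
  case True
  have 1: "((\<lambda>s. \<eta> (ln s / K)) has_real_derivative deriv \<eta> (ln s / K) * (inverse s / K)) (at s)"
    by (rule DERIV_chain2[OF smooth1_has_deriv[OF \<eta>(1)] DERIV_cdivide[OF DERIV_ln[OF True]]])
  have "((\<lambda>s. s powr b * \<eta> (ln s / K)) has_real_derivative
     (b * s powr (b - 1)) * \<eta> (ln s / K) + deriv \<eta> (ln s / K) * (inverse s / K) * s powr b) (at s)"
    by (rule DERIV_mult[OF has_real_derivative_powr[OF True] 1])
  moreover have "(b * s powr (b - 1)) * \<eta> (ln s / K) + deriv \<eta> (ln s / K) * (inverse s / K) * s powr b
     = log_cutoff (b - 1) (\<lambda>t. b * \<eta> t + (1 / K) * deriv \<eta> t) K s"
    using True by (simp add: log_cutoff_def powr_diff field_simps)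
  ultimately have "((\<lambda>s. s powr b * \<eta> (ln s / K)) has_real_derivative log_cutoff (b - 1) (\<lambda>t. b * \<eta> t + (1 / K) * deriv \<eta> t) K s) (at s)"
    by simp
  then show ?thesis
    by (rule has_field_derivative_transform_within_open[of _ _ _ "{0<..}"]) (use True in \<open>auto simp: log_cutoff_def\<close>)
next
  case False
  \<comment> \<open>The function already vanishes below \<open>exp (-K)\<close>, so its extension by
    0 to nonpositive \<open>s\<close> is smooth.\<close>
  have z: "log_cutoff b \<eta> K s = 0" if "s < exp (- K)" for s
  proof (cases "s > 0")
    case True
    have "ln s < - K" using that True by (metis ln_exp ln_less_cancel_iff exp_gt_zero)
    then have "ln s / K < -1" using K by (simp add: field_simps)
    then have "\<bar>ln s / K\<bar> > 1" by linarith
    then have "\<eta> (ln s / K) = 0" using \<eta>(2) unfolding supp1_def by blast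
    then show ?thesis by (simp add: log_cutoff_def)
  qed (simp add: log_cutoff_def)
  have "((\<lambda>t. 0) has_real_derivative 0) (at s)" by simp
  then have "(log_cutoff b \<eta> K has_real_derivative 0) (at s)"
    by (rule has_field_derivative_transform_within_open[of _ _ _ "{..<exp (-K)}"])
       (use False z in \<open>auto intro: le_less_trans[of _ 0]\<close>)
  then show ?thesis using False by (simp add: log_cutoff_def)
qed

lemma log_cutoff_Ck1:
  assumes K: "K > 0" and \<eta>: "smooth1 \<eta>" "supp1 \<eta>"
  shows "Ck1 n (log_cutoff b \<eta> K)"
  using \<eta>
proof (induction n arbitrary: b \<eta>)
  case 0
  show ?case
    by (simp, rule DERIV_continuous_on[where D = "log_cutoff (b - 1) (\<lambda>t. b * \<eta> t + (1 / K) * deriv \<eta> t) K"])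
       (rule has_field_derivative_at_within[OF log_cutoff_deriv[OF K 0]])
next
  case (Suc n)
  have "Ck1 n (log_cutoff (b - 1) (\<lambda>t. b * \<eta> t + (1 / K) * deriv \<eta> t) K)"
  proof (rule Suc.IH)
    show "smooth1 (\<lambda>t. b * \<eta> t + (1 / K) * deriv \<eta> t)"
      by (rule smooth1_combine[OF Suc.prems(1) smooth1_deriv[OF Suc.prems(1)]])
    show "supp1 (\<lambda>t. b * \<eta> t + (1 / K) * deriv \<eta> t)"
      using Suc.prems(2) supp1_deriv[OF Suc.prems(2)] by (simp add: supp1_def)
  qed
  then show ?case using log_cutoff_deriv[OF K Suc.prems] by auto
qed

text \<open>The last two clauses express harmonicity and Euler's identity for homogeneous functions.\<close>

definition harmonic_hom :: "nat \<Rightarrow> (real^'n::finite \<Rightarrow> real) \<Rightarrow> real^'n \<Rightarrow> bool" where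
  "harmonic_hom n P e \<longleftrightarrow> (\<forall>m. CkN m P) \<and> (\<forall>x. \<bar>P x\<bar> \<le> norm x ^ n) \<and> norm e = 1 \<and> P e = 1 \<and>
     (\<forall>r x. P (r *\<^sub>R x) = r ^ n * P x) \<and>
     (\<exists>P1 P2. (\<forall>i. has_pd i P (P1 i) \<and> has_pd i (P1 i) (P2 i)) \<and>
        (\<forall>x. (\<Sum>i\<in>UNIV. P2 i x) = 0) \<and> (\<forall>x. (\<Sum>i\<in>UNIV. x $ i * P1 i x) = real n * P x))"

lemma harmonic_hom_const: "harmonic_hom 0 (\<lambda>_. 1) (axis i 1)"
  unfolding harmonic_hom_def by (auto simp: CkN_const norm_axis_1 intro!: exI[of _ "\<lambda>_ _. 0"] has_pd_const)

section \<open>Harmonic homogeneous polynomials of every degree\<close>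

definition plane_power :: "'n::finite \<Rightarrow> 'n \<Rightarrow> nat \<Rightarrow> real^'n \<Rightarrow> complex" where
  "plane_power i j n x = Complex (x $ i) (x $ j) ^ n"

text \<open>The Cauchy-Riemann equations couple the real and imaginary parts of the complex power,
  so both are treated in one induction. At \<open>n = 0\<close> the truncated \<open>n - 1\<close>
  is multiplied by 0.\<close>

lemma plane_power_pd:
  assumes ij: "i \<noteq> j"
  shows "has_pd k (\<lambda>x. Re (plane_power i j n x)) (\<lambda>x. real n * ((if k = i then Re (plane_power i j (n - 1) x) else 0) - (if k = j then Im (plane_power i j (n - 1) x) else 0)))
       \<and> has_pd k (\<lambda>x. Im (plane_power i j n x)) (\<lambda>x. real n * ((if k = i then Im (plane_power i j (n - 1) x) else 0) + (if k = j then Re (plane_power i j (n - 1) x) else 0)))"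
proof (induction n)
  case 0
  then show ?case by (simp add: plane_power_def has_pd_const)
next
  case (Suc n)
  note IH = Suc.IH[THEN conjunct1] Suc.IH[THEN conjunct2]
  have re: "(\<lambda>x. Re (plane_power i j (Suc n) x)) = (\<lambda>x. x $ i * Re (plane_power i j n x) - x $ j * Im (plane_power i j n x))"
    and im: "(\<lambda>x. Im (plane_power i j (Suc n) x)) = (\<lambda>x. x $ i * Im (plane_power i j n x) + x $ j * Re (plane_power i j n x))"
    by (auto simp: plane_power_def fun_eq_iff)
  have st: "real n * Re (plane_power i j n x) = real n * (x $ i * Re (plane_power i j (n - 1) x) - x $ j * Im (plane_power i j (n - 1) x))"
    "real n * Im (plane_power i j n x) = real n * (x $ i * Im (plane_power i j (n - 1) x) + x $ j * Re (plane_power i j (n - 1) x))" for x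
    by (cases n; simp add: plane_power_def)+
  have 1: "has_pd k (\<lambda>x. x $ i * Re (plane_power i j n x) - x $ j * Im (plane_power i j n x))
     (\<lambda>x. real (Suc n) * ((if k = i then Re (plane_power i j (Suc n - 1) x) else 0) - (if k = j then Im (plane_power i j (Suc n - 1) x) else 0)))"
    by (rule has_pd_cong[OF has_pd_diff[OF has_pd_mult[OF has_pd_component IH(1)] has_pd_mult[OF has_pd_component IH(2)]]])
       (use ij st in \<open>auto simp: algebra_simps\<close>)
  have 2: "has_pd k (\<lambda>x. x $ i * Im (plane_power i j n x) + x $ j * Re (plane_power i j n x))
     (\<lambda>x. real (Suc n) * ((if k = i then Im (plane_power i j (Suc n - 1) x) else 0) + (if k = j then Re (plane_power i j (Suc n - 1) x) else 0)))"
    by (rule has_pd_cong[OF has_pd_add[OF has_pd_mult[OF has_pd_component IH(2)] has_pd_mult[OF has_pd_component IH(1)]]])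
       (use ij st in \<open>auto simp: algebra_simps\<close>)
  show ?case unfolding re im using 1 2 by blast
qed

lemma plane_power_CkN: "CkN m (\<lambda>x. Re (plane_power i j n x)) \<and> CkN m (\<lambda>x. Im (plane_power i j n x))"
proof (induction n)
  case 0
  then show ?case by (simp add: plane_power_def CkN_const)
next
  case (Suc n)
  have re: "(\<lambda>x. Re (plane_power i j (Suc n) x)) = (\<lambda>x. x $ i * Re (plane_power i j n x) + (-1) * (x $ j * Im (plane_power i j n x)))"
    and im: "(\<lambda>x. Im (plane_power i j (Suc n) x)) = (\<lambda>x. x $ i * Im (plane_power i j n x) + x $ j * Re (plane_power i j n x))"
    by (auto simp: plane_power_def fun_eq_iff)
  show ?case unfolding re im using Suc.IH by (intro conjI CkN_add CkN_mult CkN_component CkN_const) auto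
qed

text \<open>The real part of a complex power in two distinct coordinates: its pure second
  derivatives in these two directions are opposite. The bound by the norm is attained at the first
  of the two axis vectors.\<close>

lemma exists_harmonic_hom:
  assumes "CARD('n::finite) \<ge> 2"
  shows "\<exists>P (e::real^'n). harmonic_hom n P e"
proof -
  obtain i j :: 'n where ij: "i \<noteq> j"
  proof -
    have "\<exists>i j :: 'n. i \<noteq> j"
    proof (rule ccontr)
      assume "\<not> ?thesis"
      then have "(UNIV :: 'n set) = {undefined}" by auto
      then have "CARD('n) = card {undefined :: 'n}" by simp
      then show False using assms by simp
    qed
    then show ?thesis using that by blast
  qed
  let ?P = "\<lambda>x. Re (plane_power i j n x)" and ?e = "axis i 1 :: real^'n"
  let ?P1 = "\<lambda>k x. real n * ((if k = i then Re (plane_power i j (n - 1) x) else 0) - (if k = j then Im (plane_power i j (n - 1) x) else 0))"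
  let ?P2 = "\<lambda>k x. real n * ((if k = i then real (n - 1) * Re (plane_power i j (n - 1 - 1) x) else 0) - (if k = j then real (n - 1) * Re (plane_power i j (n - 1 - 1) x) else 0))"
  have "harmonic_hom n ?P ?e" unfolding harmonic_hom_def
  proof (intro conjI allI)
    fix m show "CkN m ?P" using plane_power_CkN by blast
  next
    fix x :: "real^'n"
    have "(x $ i)\<^sup>2 + (x $ j)\<^sup>2 = (\<Sum>k\<in>{i, j}. (x $ k)\<^sup>2)" using ij by simp
    also have "\<dots> \<le> (\<Sum>k\<in>UNIV. (x $ k)\<^sup>2)" by (intro sum_mono2) auto
    finally have "cmod (Complex (x $ i) (x $ j)) \<le> norm x"
      by (simp add: cmod_def sum_component_sq real_le_lsqrt)
    then have "cmod (plane_power i j n x) \<le> norm x ^ n" by (simp add: plane_power_def norm_power power_mono)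
    then show "\<bar>?P x\<bar> \<le> norm x ^ n" using abs_Re_le_cmod order_trans by blast
  next
    show "norm ?e = 1" by (simp add: norm_axis_1)
    have "Complex (?e $ i) (?e $ j) = 1" using ij by (simp add: axis_def complex_eq_iff)
    then show "?P ?e = 1" by (simp add: plane_power_def)
  next
    fix r and x :: "real^'n"
    have "Complex ((r *\<^sub>R x) $ i) ((r *\<^sub>R x) $ j) = of_real r * Complex (x $ i) (x $ j)" by (simp add: complex_eq_iff)
    then have "plane_power i j n (r *\<^sub>R x) = of_real (r ^ n) * plane_power i j n x" by (simp add: plane_power_def power_mult_distrib)
    then show "?P (r *\<^sub>R x) = r ^ n * ?P x" by simp
  next
    show "\<exists>P1 P2. (\<forall>i. has_pd i ?P (P1 i) \<and> has_pd i (P1 i) (P2 i)) \<and>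
        (\<forall>x. (\<Sum>i\<in>UNIV. P2 i x) = 0) \<and> (\<forall>x. (\<Sum>i\<in>UNIV. x $ i * P1 i x) = real n * ?P x)"
    proof (rule exI[of _ ?P1], rule exI[of _ ?P2], intro conjI allI)
      fix k
      show "has_pd k ?P (?P1 k)" using plane_power_pd[OF ij] by blast
      have a: "has_pd k (\<lambda>x. Re (plane_power i j (n - 1) x)) (\<lambda>x. real (n - 1) * ((if k = i then Re (plane_power i j (n - 1 - 1) x) else 0) - (if k = j then Im (plane_power i j (n - 1 - 1) x) else 0)))"
        and b: "has_pd k (\<lambda>x. Im (plane_power i j (n - 1) x)) (\<lambda>x. real (n - 1) * ((if k = i then Im (plane_power i j (n - 1 - 1) x) else 0) + (if k = j then Re (plane_power i j (n - 1 - 1) x) else 0)))"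
        using plane_power_pd[OF ij] by blast+
      have "has_pd k (\<lambda>x. real n * ((if k = i then 1 else 0) * Re (plane_power i j (n - 1) x) - (if k = j then 1 else 0) * Im (plane_power i j (n - 1) x))) (?P2 k)"
        by (rule has_pd_cong[OF has_pd_mult[OF has_pd_const has_pd_diff[OF has_pd_mult[OF has_pd_const a] has_pd_mult[OF has_pd_const b]]]])
           (use ij in auto)
      moreover have "(\<lambda>x. real n * ((if k = i then 1 else 0) * Re (plane_power i j (n - 1) x) - (if k = j then 1 else 0) * Im (plane_power i j (n - 1) x))) = ?P1 k"
        by (auto simp: fun_eq_iff)
      ultimately show "has_pd k (?P1 k) (?P2 k)" by simp
    next
      fix x :: "real^'n"
      show "(\<Sum>k\<in>UNIV. ?P2 k x) = 0"
        by (simp add: sum_distrib_left[symmetric] sum_subtractf)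
      have "(\<Sum>k\<in>UNIV. x $ k * ?P1 k x) = (\<Sum>k\<in>UNIV. if k = i then x $ i * (real n * Re (plane_power i j (n - 1) x)) else 0)
          - (\<Sum>k\<in>UNIV. if k = j then x $ j * (real n * Im (plane_power i j (n - 1) x)) else 0)"
        unfolding sum_subtractf[symmetric] by (intro sum.cong) (auto simp: algebra_simps)
      also have "\<dots> = real n * (x $ i * Re (plane_power i j (n - 1) x) - x $ j * Im (plane_power i j (n - 1) x))"
        by (simp add: algebra_simps)
      also have "\<dots> = real n * ?P x" by (cases n) (simp_all add: plane_power_def)
      finally show "(\<Sum>k\<in>UNIV. x $ k * ?P1 k x) = real n * ?P x" .
    qed
  qed
  then show ?thesis by blast
qed

section \<open>The test functions and their Laplacians\<close>

definition test_family :: "(real^'n::finite \<Rightarrow> real) \<Rightarrow> real \<Rightarrow> (real \<Rightarrow> real) \<Rightarrow> real \<Rightarrow> real^'n \<Rightarrow> real" where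
  "test_family P b \<eta> K x = P x * log_cutoff b \<eta> K ((norm x)\<^sup>2)"

lemma test_family_test:
  fixes P :: "real^'n::finite \<Rightarrow> real"
  assumes P: "harmonic_hom n P e" and K: "K > 0" and \<eta>: "smooth1 \<eta>" "supp1 \<eta>"
  shows "test_fun (test_family P b \<eta> K)"
proof -
  have "CkN m (test_family P b \<eta> K)" for m
    unfolding test_family_def[abs_def] using P
    by (intro CkN_mult CkN_compose[OF log_cutoff_Ck1[OF K \<eta>]] CkN_norm_sq) (simp add: harmonic_hom_def)
  then have 1: "smooth_fun (test_family P b \<eta> K)" by (rule CkN_smooth)
  define S where "S = {x::real^'n. exp (- K) \<le> (norm x)\<^sup>2} \<inter> {x. (norm x)\<^sup>2 \<le> exp K}"
  have sub: "{x. test_family P b \<eta> K x \<noteq> 0} \<subseteq> S"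
  proof
    fix x assume "x \<in> {x. test_family P b \<eta> K x \<noteq> 0}"
    then have *: "(norm x)\<^sup>2 > 0" "\<eta> (ln ((norm x)\<^sup>2) / K) \<noteq> 0" by (auto simp: test_family_def log_cutoff_def split: if_splits)
    then have "\<bar>ln ((norm x)\<^sup>2) / K\<bar> \<le> 1" using \<eta>(2) unfolding supp1_def by (meson not_less)
    then have "- K \<le> ln ((norm x)\<^sup>2)" "ln ((norm x)\<^sup>2) \<le> K" using K by (auto simp: abs_le_iff field_simps)
    then have "exp (- K) \<le> exp (ln ((norm x)\<^sup>2))" "exp (ln ((norm x)\<^sup>2)) \<le> exp K"
      by (simp_all only: exp_le_cancel_iff)
    then show "x \<in> S" unfolding exp_ln[OF *(1)] S_def by simp
  qed
  have cl: "closed S" unfolding S_def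
    by (intro closed_Int closed_Collect_le continuous_on_const continuous_on_power continuous_on_norm continuous_on_id)
  have "bounded S"
  proof (rule boundedI[where B = "exp K + 1"])
    fix x assume "x \<in> S"
    then have "(norm x)\<^sup>2 \<le> exp K" by (simp add: S_def)
    moreover have "norm x \<le> (norm x)\<^sup>2 + 1"
    proof (cases "norm x \<le> 1")
      case False
      then have "norm x * 1 \<le> norm x * norm x" by (intro mult_left_mono) auto
      then show ?thesis by (simp add: power2_eq_square)
    qed (simp add: add_increasing)
    ultimately show "norm x \<le> exp K + 1" by linarith
  qed
  then have cS: "compact S" using cl by (simp add: compact_eq_bounded_closed)
  have clS: "closure {x. test_family P b \<eta> K x \<noteq> 0} \<subseteq> S" by (rule closure_minimal[OF sub cl])
  then have "compact (closure {x. test_family P b \<eta> K x \<noteq> 0})"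
    using cS by (metis closed_closure compact_Int_closed inf.absorb_iff2)
  moreover have "0 \<notin> S" by (simp add: S_def not_le)
  ultimately show ?thesis using 1 clS by (auto simp: test_fun_def)
qed

text \<open>For a function \<open>g\<close> of \<open>s = |x|^2\<close>, harmonicity and Euler's
  identity give \<open>P ((2 N + 4 n) g' + 4 s g'')\<close> as the Laplacian of \<open>P g\<close>.
  With \<open>2 b = z - n\<close> the coefficient of \<eta> is
  \<open>(z - n) (z + n + N - 2)\<close>, and the other terms carry \<open>1/K\<close> or
  \<open>1/K^2\<close>.\<close>

lemma test_family_laplacian:
  fixes P :: "real^'n::finite \<Rightarrow> real"
  assumes P: "harmonic_hom n P e" and K: "K > 0" and \<eta>: "smooth1 \<eta>" "supp1 \<eta>" and x: "x \<noteq> 0"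
  defines "N \<equiv> real CARD('n)" and "\<tau> \<equiv> ln ((norm x)\<^sup>2) / K"
  shows "laplacian (test_family P b \<eta> K) x = P x * (norm x)\<^sup>2 powr (b - 1) *
     ((4 * b\<^sup>2 + (2 * N + 4 * real n - 4) * b) * \<eta> \<tau> + (8 * b + 2 * N + 4 * real n - 4) / K * deriv \<eta> \<tau>
       + 4 / K\<^sup>2 * deriv (deriv \<eta>) \<tau>)"
proof -
  obtain P1 P2 where P12: "\<And>i. has_pd i P (P1 i)" "\<And>i. has_pd i (P1 i) (P2 i)"
    "\<And>x. (\<Sum>i\<in>UNIV. P2 i x) = 0" "\<And>x. (\<Sum>i\<in>UNIV. x $ i * P1 i x) = real n * P x"
    using P unfolding harmonic_hom_def by blast
  define \<eta>1 where "\<eta>1 = (\<lambda>t. b * \<eta> t + (1 / K) * deriv \<eta> t)"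
  define \<eta>2 where "\<eta>2 = (\<lambda>t. (b - 1) * \<eta>1 t + (1 / K) * deriv \<eta>1 t)"
  have "smooth1 \<eta>1" unfolding \<eta>1_def by (rule smooth1_combine[OF \<eta>(1) smooth1_deriv[OF \<eta>(1)]])
  moreover have "supp1 \<eta>1" using \<eta>(2) supp1_deriv[OF \<eta>(2)] by (simp add: supp1_def \<eta>1_def)
  ultimately have \<eta>1: "smooth1 \<eta>1" "supp1 \<eta>1" by blast+
  define g where "g = log_cutoff b \<eta> K"
  define g' where "g' = log_cutoff (b - 1) \<eta>1 K"
  define g'' where "g'' = log_cutoff (b - 2) \<eta>2 K"
  have d1: "(g has_real_derivative g' s) (at s)" for s unfolding g_def g'_def \<eta>1_def by (rule log_cutoff_deriv[OF K \<eta>])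
  have d2: "(g' has_real_derivative g'' s) (at s)" for s
    unfolding g'_def g''_def \<eta>2_def using log_cutoff_deriv[OF K \<eta>1, of "b - 1"] by simp
  have ns: "has_pd i (\<lambda>x::real^'n. (norm x)\<^sup>2) (\<lambda>x. 2 * x $ i)" for i using has_pd_norm_sq[of i 0] by simp
  have pg: "has_pd i (\<lambda>x. g ((norm x)\<^sup>2)) (\<lambda>x. g' ((norm x)\<^sup>2) * (2 * x $ i))" for i :: "'n" by (rule has_pd_compose[OF ns d1])
  have pg': "has_pd i (\<lambda>x. g' ((norm x)\<^sup>2)) (\<lambda>x. g'' ((norm x)\<^sup>2) * (2 * x $ i))" for i :: "'n" by (rule has_pd_compose[OF ns d2])
  have u1: "has_pd i (test_family P b \<eta> K) (\<lambda>x. P1 i x * g ((norm x)\<^sup>2) + P x * (g' ((norm x)\<^sup>2) * (2 * x $ i)))" for i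
    unfolding test_family_def[abs_def] g_def[symmetric] by (rule has_pd_mult[OF P12(1) pg])
  have xi: "has_pd i (\<lambda>x. 2 * x $ i) (\<lambda>x. 2)" for i :: 'n
    by (rule has_pd_cong[OF has_pd_mult[OF has_pd_const has_pd_component]]) simp
  have u2: "has_pd i (\<lambda>x. P1 i x * g ((norm x)\<^sup>2) + P x * (g' ((norm x)\<^sup>2) * (2 * x $ i)))
    (\<lambda>x. P2 i x * g ((norm x)\<^sup>2) + 4 * g' ((norm x)\<^sup>2) * (x $ i * P1 i x) + 4 * P x * g'' ((norm x)\<^sup>2) * (x $ i)\<^sup>2
        + 2 * P x * g' ((norm x)\<^sup>2))" for i
    by (rule has_pd_cong[OF has_pd_add[OF has_pd_mult[OF P12(2) pg] has_pd_mult[OF P12(1) has_pd_mult[OF pg' xi]]]])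
       (simp add: power2_eq_square algebra_simps)
  have "pdiff i (pdiff i (test_family P b \<eta> K)) x = P2 i x * g ((norm x)\<^sup>2) + 4 * g' ((norm x)\<^sup>2) * (x $ i * P1 i x)
      + 4 * P x * g'' ((norm x)\<^sup>2) * (x $ i)\<^sup>2 + 2 * P x * g' ((norm x)\<^sup>2)" for i
    unfolding has_pd_pdiff[OF u1] has_pd_pdiff[OF u2] ..
  then have "laplacian (test_family P b \<eta> K) x = (\<Sum>i\<in>UNIV. P2 i x) * g ((norm x)\<^sup>2) + 4 * g' ((norm x)\<^sup>2) * (\<Sum>i\<in>UNIV. x $ i * P1 i x)
      + 4 * P x * g'' ((norm x)\<^sup>2) * (\<Sum>i\<in>UNIV. (x $ i)\<^sup>2) + N * (2 * P x * g' ((norm x)\<^sup>2))"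
    by (simp only: laplacian_def sum.distrib sum_distrib_left sum_distrib_right) (simp add: N_def)
  also have "\<dots> = P x * ((2 * N + 4 * real n) * g' ((norm x)\<^sup>2) + 4 * ((norm x)\<^sup>2 * g'' ((norm x)\<^sup>2)))"
    unfolding P12(3,4) sum_component_sq by (simp add: algebra_simps)
  finally have L: "laplacian (test_family P b \<eta> K) x = P x * ((2 * N + 4 * real n) * g' ((norm x)\<^sup>2) + 4 * ((norm x)\<^sup>2 * g'' ((norm x)\<^sup>2)))" .
  define s where "s = (norm x)\<^sup>2"
  have s: "s > 0" using x by (simp add: s_def)
  have g1: "g' s = s powr (b - 1) * \<eta>1 \<tau>" using s by (simp add: g'_def log_cutoff_def \<tau>_def s_def)
  have "s * s powr (b - 2) = s powr (b - 1)" using s powr_add[of s 1 "b - 2"] by simp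
  then have g2: "s * g'' s = s powr (b - 1) * \<eta>2 \<tau>" using s by (simp add: g''_def log_cutoff_def \<tau>_def s_def mult.assoc[symmetric])
  have "(\<eta>1 has_real_derivative b * deriv \<eta> \<tau> + (1 / K) * deriv (deriv \<eta>) \<tau>) (at \<tau>)"
    unfolding \<eta>1_def by (intro DERIV_add DERIV_cmult smooth1_has_deriv \<eta> smooth1_deriv)
  then have dd: "deriv \<eta>1 \<tau> = b * deriv \<eta> \<tau> + (1 / K) * deriv (deriv \<eta>) \<tau>" by (rule DERIV_imp_deriv)
  have "laplacian (test_family P b \<eta> K) x = P x * s powr (b - 1) * ((2 * N + 4 * real n) * \<eta>1 \<tau> + 4 * \<eta>2 \<tau>)"
    unfolding L s_def[symmetric] g1 g2 by (simp add: algebra_simps)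
  also have "(2 * N + 4 * real n) * \<eta>1 \<tau> + 4 * \<eta>2 \<tau> = (4 * b\<^sup>2 + (2 * N + 4 * real n - 4) * b) * \<eta> \<tau> + (8 * b + 2 * N + 4 * real n - 4) / K * deriv \<eta> \<tau>
       + 4 / K\<^sup>2 * deriv (deriv \<eta>) \<tau>"
    unfolding \<eta>2_def dd using K by (simp add: \<eta>1_def power2_eq_square field_simps)
  finally show ?thesis by (simp add: s_def)
qed

section \<open>Near-extremal functions\<close>

lemma open_not_AE_avoided:
  fixes U :: "'a::euclidean_space set"
  assumes "open U" "x \<in> U" "AE y in lborel. y \<notin> U" shows False
proof -
  have "U \<in> null_sets lborel"
    using assms(3) AE_iff_null_sets[of U lborel] borel_open[OF assms(1)] by simp
  then have "negligible U" unfolding negligible_iff_null_sets by (rule null_sets_completionI)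
  then show False using open_not_negligible[OF assms(1)] assms(2) by blast
qed

text \<open>By continuity a value above the essential supremum would be exceeded on a nonempty open
  set, which has positive measure.\<close>

lemma Linf_ge:
  fixes f :: "real^'n::finite \<Rightarrow> real"
  assumes f: "continuous_on UNIV f" and B: "\<And>x. \<bar>f x\<bar> \<le> B"
  shows "\<bar>f e\<bar> \<le> Lp_norm top f"
proof (rule ccontr)
  let ?U = "{x. Lp_norm top f < \<bar>f x\<bar>}"
  assume "\<not> \<bar>f e\<bar> \<le> Lp_norm top f"
  then have "e \<in> ?U" by simp
  moreover have "open ?U" by (intro open_Collect_less continuous_on_const continuous_on_rabs f)
  moreover have "AE x in lborel. x \<notin> ?U"
    using Linf_facts(2)[OF borel_measurable_continuous_onI[OF f] B] by (auto elim!: eventually_mono)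
  ultimately show False using open_not_AE_avoided by blast
qed

lemma error_bound:
  fixes K B d1 d2 D1 D2 :: real
  assumes K: "K \<ge> 1" and d: "\<bar>d1\<bar> \<le> D1" "\<bar>d2\<bar> \<le> D2"
  shows "\<bar>B / K * d1 + 4 / K\<^sup>2 * d2\<bar> \<le> (\<bar>B\<bar> * D1 + 4 * D2) / K"
proof -
  have D: "D1 \<ge> 0" "D2 \<ge> 0" using d by linarith+
  have "\<bar>B / K * d1\<bar> \<le> \<bar>B\<bar> / K * D1"
    unfolding abs_mult using K D d by (intro mult_mono) (auto simp: abs_divide)
  moreover have "\<bar>4 / K\<^sup>2 * d2\<bar> \<le> 4 / K * D2"
  proof -
    have "4 / K\<^sup>2 \<le> 4 / K" using K by (simp add: power2_eq_square field_simps)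
    then show ?thesis unfolding abs_mult using K D d by (intro mult_mono) (auto simp: abs_divide)
  qed
  ultimately have "\<bar>B / K * d1 + 4 / K\<^sup>2 * d2\<bar> \<le> \<bar>B\<bar> / K * D1 + 4 / K * D2" by linarith
  then show ?thesis by (simp add: add_divide_distrib)
qed

section \<open>Masses of annuli that are half-open in the logarithmic variable\<close>

definition shell :: "real \<Rightarrow> real \<Rightarrow> (real^'n::finite) set" where
  "shell a b = {x. x \<noteq> 0 \<and> a \<le> 2 * ln (norm x) \<and> 2 * ln (norm x) < b}"

definition shell_mass :: "(real^'n::finite \<Rightarrow> real) \<Rightarrow> real \<Rightarrow> real \<Rightarrow> ennreal" where
  "shell_mass w a b = (\<integral>\<^sup>+x. ennreal (w x) * indicator (shell a b) x \<partial>lborel)"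

lemma shell_measurable [measurable]: "shell a b \<in> sets borel"
  unfolding shell_def by measurable

context
  fixes w :: "real^'n::finite \<Rightarrow> real"
  assumes w[measurable]: "w \<in> borel_measurable borel"
    and hom: "\<And>r x. r > 0 \<Longrightarrow> w (r *\<^sub>R x) = r powr (- real CARD('n)) * w x"
begin

text \<open>A weight homogeneous of degree -N defines a dilation invariant measure, and dilation by
  \<open>exp (1/2)\<close> shifts \<open>ln |x|^2\<close> by 1. Together with additivity this makes
  the mass proportional to the number of unit shells.\<close>

lemma shell_mass_shift1: "shell_mass w (a + 1) (b + 1) = shell_mass w a b"
proof -
  define r :: real where "r = exp (1/2)"
  have r: "r > 0" "ln r = 1/2" by (simp_all add: r_def)
  have "shell_mass w (a + 1) (b + 1) = ennreal (\<bar>r\<bar> ^ DIM(real^'n)) * (\<integral>\<^sup>+x. ennreal (w (0 + r *\<^sub>R x)) * indicator (shell (a + 1) (b + 1)) (0 + r *\<^sub>R x) \<partial>lborel)"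
    unfolding shell_mass_def using r by (intro nn_integral_lborel_affine) auto
  also have "\<dots> = ennreal (r powr real CARD('n)) * (\<integral>\<^sup>+x. ennreal (r powr (- real CARD('n))) * (ennreal (w x) * indicator (shell a b) x) \<partial>lborel)"
  proof -
    have "r *\<^sub>R x \<in> shell (a + 1) (b + 1) \<longleftrightarrow> x \<in> shell a b" for x :: "real^'n"
    proof (cases "x = 0")
      case False
      have "ln (norm (r *\<^sub>R x)) = 1/2 + ln (norm x)" using r False by (simp add: ln_mult)
      then show ?thesis using False r by (simp add: shell_def)
    qed (simp add: shell_def)
    then have "ennreal (w (0 + r *\<^sub>R x)) * indicator (shell (a + 1) (b + 1)) (0 + r *\<^sub>R x)
       = ennreal (r powr (- real CARD('n))) * (ennreal (w x) * indicator (shell a b) x)" for x :: "real^'n"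
      using r by (auto simp: indicator_def hom ennreal_mult')
    then show ?thesis using r by (simp add: powr_realpow)
  qed
  also have "(\<integral>\<^sup>+x. ennreal (r powr (- real CARD('n))) * (ennreal (w x) * indicator (shell a b) x) \<partial>lborel)
     = ennreal (r powr (- real CARD('n))) * shell_mass w a b"
    unfolding shell_mass_def by (rule nn_integral_cmult) measurable
  also have "ennreal (r powr real CARD('n)) * (ennreal (r powr (- real CARD('n))) * shell_mass w a b) = shell_mass w a b"
  proof -
    have "ennreal (r powr real CARD('n)) * ennreal (r powr (- real CARD('n))) = ennreal (r powr real CARD('n) * r powr (- real CARD('n)))"
      by (rule ennreal_mult[symmetric]) auto
    also have "r powr real CARD('n) * r powr (- real CARD('n)) = 1" using r by (simp flip: powr_add)
    finally show ?thesis by (simp flip: mult.assoc)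
  qed
  finally show ?thesis .
qed

lemma shell_mass_shift: "shell_mass w (a + real k) (b + real k) = shell_mass w a b"
proof (induction k)
  case (Suc k)
  then show ?case using shell_mass_shift1[of "a + real k" "b + real k"] by (simp add: add_ac)
qed simp

lemma shell_mass_add:
  assumes "a \<le> b" "b \<le> c" shows "shell_mass w a c = shell_mass w a b + shell_mass w b c"
proof -
  have "shell_mass w a c = (\<integral>\<^sup>+x. ennreal (w x) * indicator (shell a b) x + ennreal (w x) * indicator (shell b c) x \<partial>lborel)"
    unfolding shell_mass_def by (rule nn_integral_cong) (use assms in \<open>auto simp: indicator_def shell_def\<close>)
  also have "\<dots> = shell_mass w a b + shell_mass w b c" unfolding shell_mass_def by (rule nn_integral_add) measurable
  finally show ?thesis .
qed

lemma shell_mass_nat: "shell_mass w a (a + real j) = of_nat j * shell_mass w a (a + 1)"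
proof (induction j)
  case 0
  have "shell a a = ({} :: (real^'n) set)" by (auto simp: shell_def)
  then show ?case by (simp add: shell_mass_def)
next
  case (Suc j)
  have "shell_mass w a (a + real (Suc j)) = shell_mass w a (a + real j) + shell_mass w (a + real j) (a + real (Suc j))"
    by (intro shell_mass_add) auto
  also have "shell_mass w (a + real j) (a + real (Suc j)) = shell_mass w a (a + 1)" using shell_mass_shift[of a j "a + 1"] by (simp add: add_ac)
  finally show ?case using Suc by (simp add: algebra_simps)
qed

lemma shell_mass_from_neg: "shell_mass w (- real i) (real j) = of_nat (i + j) * shell_mass w 0 1"
  using shell_mass_nat[of "- real i" "i + j"] shell_mass_shift[of "- real i" i "- real i + 1"] by simp

end

text \<open>For finite \<open>p\<close> the p-th power of \<open>|x|^(\<alpha>-2) u\<close> is a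
  weight homogeneous of degree -N times a power of the cutoff, so its integral grows like the number
  of unit shells, that is like \<open>K\<close>. The error terms have size \<open>E/K\<close>
  against the same weight on a comparable number of shells and lose against the gap between
  \<open>|A|\<close> and \<open>C\<close>.\<close>

theorem near_extremal:
  fixes p :: ennreal and \<alpha> C :: real and n :: nat
  defines "N \<equiv> real CARD('n::finite)"
  assumes N2: "CARD('n) \<ge> 2" and p: "1 \<le> p"
    and C: "\<bar>(2 - \<alpha> - N * inv_exp p - n) * (2 - \<alpha> - N * inv_exp p + n + N - 2)\<bar> < C"
  shows "\<exists>u::real^'n \<Rightarrow> real. test_fun u \<and>
    Lp_norm p (\<lambda>x. norm x powr \<alpha> * laplacian u x) < C * Lp_norm p (\<lambda>x. norm x powr (\<alpha> - 2) * u x)"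
proof -
  define a where "a = N * inv_exp p"
  define z where "z = 2 - \<alpha> - a"
  define A where "A = (z - n) * (z + n + N - 2)"
  have AC: "\<bar>A\<bar> < C" using C by (simp add: A_def z_def a_def)
  obtain P and e :: "real^'n" where P: "harmonic_hom n P e" using exists_harmonic_hom[OF N2] by blast
  obtain \<eta> c1 where \<eta>: "smooth1 \<eta>" "supp1 \<eta>" "\<eta> 0 = 1" "\<And>t. 0 \<le> \<eta> t" "\<And>t. \<eta> t \<le> 1" "c1 > 0" "\<And>t. \<bar>t\<bar> \<le> 1/2 \<Longrightarrow> c1 \<le> \<eta> t"
    using exists_bump by blast
  \<comment> \<open>The product \<open>|x|^(2b) P\<close> has degree \<open>z\<close>, and
    \<open>z + \<alpha> - 2 = -N/p\<close> is the borderline of p-integrability both at 0 and at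
    infinity.\<close>
  define b where "b = (z - n) / 2"
  define B where "B = 8 * b + 2 * N + 4 * real n - 4"
  have A: "4 * b\<^sup>2 + (2 * N + 4 * real n - 4) * b = A" by (simp add: A_def b_def power2_eq_square field_simps)
  obtain D1 where D1: "D1 \<ge> 0" "\<And>t. \<bar>deriv \<eta> t\<bar> \<le> D1"
    using smooth1_bounded[OF smooth1_deriv[OF \<eta>(1)] supp1_deriv[OF \<eta>(2)]] by blast
  obtain D2 where D2: "D2 \<ge> 0" "\<And>t. \<bar>deriv (deriv \<eta>) t\<bar> \<le> D2"
    using smooth1_bounded[OF smooth1_deriv[OF smooth1_deriv[OF \<eta>(1)]] supp1_deriv[OF supp1_deriv[OF \<eta>(2)]]] by blast
  define E where "E = \<bar>B\<bar> * D1 + 4 * D2"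
  have E: "E \<ge> 0" using D1 D2 by (simp add: E_def)
  define \<psi> where "\<psi> K t = A * \<eta> t + B / K * deriv \<eta> t + 4 / K\<^sup>2 * deriv (deriv \<eta>) t" for K t
  have \<psi>: "\<bar>\<psi> K t\<bar> \<le> \<bar>A\<bar> * \<eta> t + E / K" if K: "K \<ge> 1" for K t
  proof -
    have "\<bar>A * \<eta> t\<bar> = \<bar>A\<bar> * \<eta> t" using \<eta>(4)[of t] by (simp add: abs_mult)
    then show ?thesis
      using error_bound[OF K D1(2) D2(2), of B t t] unfolding \<psi>_def E_def by linarith
  qed
  have \<psi>0: "\<psi> K t = 0" if "\<bar>t\<bar> > 1" for K t
    using that \<eta>(2) supp1_deriv[OF \<eta>(2)] supp1_deriv[OF supp1_deriv[OF \<eta>(2)]] by (simp add: \<psi>_def supp1_def)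
  define H where "H x = P x / norm x ^ n" for x
  have P1: "\<bar>P x\<bar> \<le> norm x ^ n" "P (r *\<^sub>R x) = r ^ n * P x" "norm e = 1" "P e = 1" "CkN 0 P" for r x
    using P unfolding harmonic_hom_def by blast+
  have cP: "continuous_on UNIV P" using P1(5) by simp
  have H1: "\<bar>H x\<bar> \<le> 1" for x
    using P1(1)[of x] by (cases "norm x ^ n = 0") (auto simp: H_def abs_divide field_simps)
  define u where "u K = test_family P b \<eta> K" for K
  define V where "V K x = norm x powr (\<alpha> - 2) * u K x" for K x
  define F where "F K x = norm x powr \<alpha> * laplacian (u K) x" for K x
  have tu: "test_fun (u K)" if "K > 0" for K unfolding u_def by (rule test_family_test[OF P that \<eta>(1,2)])
  have nx: "norm x powr q * (norm x)\<^sup>2 powr (b - s) * P x = norm x powr (- a) * H x"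
    if "x \<noteq> 0" "q = \<alpha> - 2 + 2 * s" for x :: "real^'n" and q s
  proof -
    have "(norm x)\<^sup>2 powr (b - s) = norm x powr (2 * (b - s))" using that powr_powr[of "norm x" 2 "b - s"] by simp
    then have "norm x powr q * (norm x)\<^sup>2 powr (b - s) = norm x powr (q + 2 * (b - s))" by (simp add: powr_add)
    also have "q + 2 * (b - s) = - a - real n"
    proof -
      have "2 * b = z - real n" by (simp add: b_def)
      then have "q + 2 * (b - s) = q + (z - real n) - 2 * s" by (simp only: right_diff_distrib)
      then show ?thesis unfolding that(2) z_def by simp
    qed
    also have "norm x powr (- a - real n) = norm x powr (- a) / norm x ^ n"
      using that by (simp add: powr_diff powr_realpow)
    finally show ?thesis by (simp add: H_def)
  qed
  have V: "V K x = norm x powr (- a) * H x * \<eta> (2 * ln (norm x) / K)" if "x \<noteq> 0" for x K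
    using nx[OF that, of "\<alpha> - 2" 0] that by (simp add: V_def u_def test_family_def log_cutoff_def ln_realpow mult_ac)
  have F: "F K x = norm x powr (- a) * H x * \<psi> K (2 * ln (norm x) / K)" if "x \<noteq> 0" "K > 0" for x K
  proof -
    have "laplacian (u K) x = P x * (norm x)\<^sup>2 powr (b - 1) * \<psi> K (ln ((norm x)\<^sup>2) / K)"
      unfolding u_def \<psi>_def B_def A[symmetric] N_def by (rule test_family_laplacian[OF P that(2) \<eta>(1,2) that(1)])
    also have "ln ((norm x)\<^sup>2) = 2 * ln (norm x)" using that by (simp add: ln_realpow)
    finally have "F K x = norm x powr \<alpha> * (norm x)\<^sup>2 powr (b - 1) * P x * \<psi> K (2 * ln (norm x) / K)"
      by (simp add: F_def mult_ac)
    then show ?thesis using nx[OF that(1), of \<alpha> 1] by simp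
  qed
  have cont: "continuous_on UNIV (V K)" "continuous_on UNIV (F K)" "\<exists>R. (\<forall>x. norm x > R \<longrightarrow> V K x = 0) \<and> (\<forall>x. norm x > R \<longrightarrow> F K x = 0)"
    if K: "K > 0" for K
  proof -
    have sm: "smooth_fun (u K)" using tu[OF K] by (simp add: test_fun_def)
    obtain r R where rR: "0 < r" "\<And>x. norm x < r \<Longrightarrow> u K x = 0" "\<And>x. norm x > R \<Longrightarrow> u K x = 0"
      "\<And>x. norm x < r \<Longrightarrow> laplacian (u K) x = 0" "\<And>x. norm x > R \<Longrightarrow> laplacian (u K) x = 0"
      using test_fun_support[OF tu[OF K]] by metis
    show "continuous_on UNIV (V K)" unfolding V_def by (rule continuous_weight[OF smooth_facts(1)[OF sm] rR(2,1)])
    show "continuous_on UNIV (F K)" unfolding F_def by (rule continuous_weight[OF smooth_facts(6)[OF sm] rR(4,1)])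
    show "\<exists>R. (\<forall>x. norm x > R \<longrightarrow> V K x = 0) \<and> (\<forall>x. norm x > R \<longrightarrow> F K x = 0)"
      using rR by (intro exI[of _ R]) (simp add: V_def F_def)
  qed
  have AE0: "AE x in lborel. x \<noteq> (0::real^'n)" by (rule AE_lborel_singleton)
  have "\<exists>K>0. Lp_norm p (F K) < C * Lp_norm p (V K)"
  proof (cases "p = top")
    case True
    have a0: "a = 0" using True by (simp add: a_def inv_exp_def)
    \<comment> \<open>Chosen so that the error \<open>E/K\<close> takes up at most half of the gap
      \<open>C - |A|\<close>.\<close>
    define K where "K = max 1 (2 * E / (C - \<bar>A\<bar>))"
    have K: "K \<ge> 1" "K > 0" by (simp_all add: K_def)
    have "2 * E / (C - \<bar>A\<bar>) \<le> K" by (simp add: K_def)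
    then have "2 * (E / K) \<le> C - \<bar>A\<bar>" using AC K by (simp add: field_simps)
    then have small: "\<bar>A\<bar> + E / K < C" using AC E K by (smt (verit) divide_nonneg_pos)
    obtain R where R: "\<And>x. norm x > R \<Longrightarrow> V K x = 0" "\<And>x. norm x > R \<Longrightarrow> F K x = 0" using cont(3)[OF K(2)] by blast
    obtain BV where BV: "\<And>x. \<bar>V K x\<bar> \<le> BV" using bounded_compact_support[OF cont(1)[OF K(2)] R(1)] by blast
    obtain BF where BF: "\<And>x. \<bar>F K x\<bar> \<le> BF" using bounded_compact_support[OF cont(2)[OF K(2)] R(2)] by blast
    have "\<bar>F K x\<bar> \<le> \<bar>A\<bar> + E / K" if "x \<noteq> 0" for x
    proof -
      let ?t = "2 * ln (norm x) / K"
      have "\<bar>F K x\<bar> = \<bar>H x\<bar> * \<bar>\<psi> K ?t\<bar>" using F[OF that K(2)] that by (simp add: a0 abs_mult)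
      also have "\<dots> \<le> 1 * \<bar>\<psi> K ?t\<bar>" by (intro mult_right_mono H1) auto
      also have "\<dots> \<le> \<bar>A\<bar> * \<eta> ?t + E / K" using \<psi>[OF K(1)] by simp
      also have "\<bar>A\<bar> * \<eta> ?t \<le> \<bar>A\<bar> * 1" by (intro mult_left_mono \<eta>) auto
      finally show ?thesis by simp
    qed
    then have "AE x in lborel. \<bar>F K x\<bar> \<le> \<bar>A\<bar> + E / K" using AE0 by (auto elim!: eventually_mono)
    then have 1: "Lp_norm top (F K) \<le> \<bar>A\<bar> + E / K"
      by (rule Linf_facts(3)[OF borel_measurable_continuous_onI[OF cont(2)[OF K(2)]] BF])
    have "e \<noteq> 0" using P1(3) by auto
    \<comment> \<open>At the unit vector \<open>e\<close> the logarithm is 0, so all three factors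
      are 1.\<close>
    then have "V K e = 1" using V[of e K] P1(3,4) \<eta>(3) by (simp add: H_def)
    then have "1 \<le> Lp_norm top (V K)" using Linf_ge[OF cont(1)[OF K(2)] BV, of e] by simp
    moreover have "C > 0" using AC by linarith
    ultimately have "C * 1 \<le> C * Lp_norm top (V K)" by (intro mult_left_mono) auto
    then have "Lp_norm p (F K) < C * Lp_norm p (V K)" using 1 small True by simp
    then show ?thesis using K by blast
  next
    case False
    define Q where "Q = enn2real p"
    have Q: "Q \<ge> 1" "inv_exp p = 1 / Q" using finite_exponent[OF p False] by (simp_all add: Q_def)
    define w where "w x = norm x powr (- N) * \<bar>H x\<bar> powr Q" for x
    have [measurable]: "P \<in> borel_measurable borel" by (rule borel_measurable_continuous_onI[OF cP])
    have [measurable]: "w \<in> borel_measurable borel" unfolding w_def H_def by measurable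
    have w0: "w x \<ge> 0" for x by (simp add: w_def)
    have hom: "w (r *\<^sub>R x) = r powr (- real CARD('n)) * w x" if r: "r > 0" for r x
    proof -
      have "H (r *\<^sub>R x) = H x" using r P1(2) by (simp add: H_def power_mult_distrib)
      then show ?thesis using r by (simp add: w_def powr_mult N_def)
    qed
    have aQ: "a * Q = N" using Q by (simp add: a_def)
    have pw: "\<bar>norm x powr (- a) * H x * y\<bar> powr Q = w x * \<bar>y\<bar> powr Q" for x y
    proof -
      have "\<bar>norm x powr (- a) * H x * y\<bar> powr Q = (norm x powr (- a)) powr Q * \<bar>H x\<bar> powr Q * \<bar>y\<bar> powr Q"
        by (simp add: abs_mult powr_mult)
      also have "(norm x powr (- a)) powr Q = norm x powr (- N)" using aQ by (simp add: powr_powr)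
      finally show ?thesis by (simp add: w_def)
    qed
    define S0 where "S0 = shell_mass w 0 1"
    have "S0 \<le> (\<integral>\<^sup>+x. indicator (cball (0::real^'n) (exp (1/2))) x \<partial>lborel)"
      unfolding S0_def shell_mass_def
    proof (rule nn_integral_mono)
      fix x :: "real^'n"
      show "ennreal (w x) * indicator (shell 0 1) x \<le> indicator (cball 0 (exp (1/2))) x"
      proof (cases "x \<in> shell 0 1")
        case True
        then have x: "x \<noteq> 0" "0 \<le> ln (norm x)" "ln (norm x) < 1/2" by (auto simp: shell_def)
        have "exp 0 \<le> exp (ln (norm x))" "exp (ln (norm x)) \<le> exp (1/2)" using x by (simp_all only: exp_le_cancel_iff less_imp_le)
        then have n1: "1 \<le> norm x" "norm x \<le> exp (1/2)" using x(1) by simp_all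
        have "norm x powr (- N) \<le> 1 powr (- N)" using n1 by (intro powr_mono2') (auto simp: N_def)
        moreover have "\<bar>H x\<bar> powr Q \<le> 1 powr Q" using H1 Q by (intro powr_mono2) auto
        ultimately have "w x \<le> 1" unfolding w_def using mult_mono[of "norm x powr (- N)" 1 "\<bar>H x\<bar> powr Q" 1] by simp
        then have "ennreal (w x) \<le> 1" using w0 ennreal_leI by fastforce
        then show ?thesis using True n1 by simp
      qed simp
    qed
    also have "\<dots> < top" by (simp add: emeasure_cball_less_top)
    finally obtain s0 where s0: "s0 \<ge> 0" "S0 = ennreal s0" by (auto simp: less_top_ennreal)
    \<comment> \<open>\<open>P\<close> is positive near \<open>e\<close>, so the weight is positive
      on an open part of the unit shell; dilating \<open>e\<close> by \<open>exp (1/4)\<close> moves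
      it into the interior.\<close>
    have "S0 \<noteq> 0"
    proof
      assume "S0 = 0"
      then have ae: "AE x in lborel. ennreal (w x) * indicator (shell 0 1) x = 0"
        unfolding S0_def shell_mass_def by (subst (asm) nn_integral_0_iff_AE) auto
      let ?U = "{x. 0 < P x} \<inter> ({x::real^'n. 1 < norm x} \<inter> {x. norm x < exp (1/2)})"
      have "open ?U" by (intro open_Int open_Collect_less continuous_on_const continuous_on_norm continuous_on_id cP)
      moreover have "exp (1/4) *\<^sub>R e \<in> ?U" using P1(2,3,4) by simp
      moreover have "AE x in lborel. x \<notin> ?U"
        using ae
      proof eventually_elim
        case (elim x)
        show ?case
        proof
          assume "x \<in> ?U"
          then have x: "P x > 0" "1 < norm x" "norm x < exp (1/2)" "x \<noteq> 0" by auto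
          have "ln (norm x) < ln (exp (1/2))" using x by (subst ln_less_cancel_iff) auto
          then have "x \<in> shell 0 1" using x by (simp add: shell_def)
          moreover have "w x > 0" using x by (simp add: w_def H_def)
          ultimately show False using elim by simp
        qed
      qed
      ultimately show False by (rule open_not_AE_avoided)
    qed
    then have s0p: "s0 > 0" using s0 by (cases "s0 = 0") auto
    \<comment> \<open>The error lives on \<open>4j + 1\<close> shells, at most \<open>5j\<close>,
      while the norm integral \<open>I\<close> is at least \<open>c1^Q j s0\<close>. Dividing by 10
      thus keeps the total error below half of \<open>(C^Q - |A|^Q) I\<close>.\<close>
    define \<delta> where "\<delta> = c1 powr Q * (C powr Q - \<bar>A\<bar> powr Q) / 10"
    have CQ: "C powr Q > \<bar>A\<bar> powr Q" using AC Q by (intro powr_less_mono2) auto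
    have c1Q: "c1 powr Q > 0" using \<eta>(6) by simp
    have \<delta>: "\<delta> > 0" using CQ c1Q by (simp add: \<delta>_def)
    \<comment> \<open>This turns the error \<open>E/K\<close> inside the power into an additive
      \<delta> outside it, uniformly over all values of the cutoff.\<close>
    have "uniformly_continuous_on {0..\<bar>A\<bar> + E} (\<lambda>s. s powr Q)"
      using Q by (intro compact_uniformly_continuous continuous_on_powr' continuous_on_id continuous_on_const) auto
    then obtain d where d: "d > 0" "\<And>s s'. s \<in> {0..\<bar>A\<bar> + E} \<Longrightarrow> s' \<in> {0..\<bar>A\<bar> + E} \<Longrightarrow> \<bar>s - s'\<bar> < d \<Longrightarrow> \<bar>s powr Q - s' powr Q\<bar> < \<delta>"
      using \<delta> unfolding uniformly_continuous_on_def dist_real_def by metis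
    obtain j :: nat where j: "real j > max 1 (E / d)" using reals_Archimedean2 by blast
    \<comment> \<open>With this \<open>K\<close> the shells from 0 to \<open>j\<close> lie where the
      argument of the cutoff is at most 1/2 and \<eta> is at least \<open>c1\<close>.\<close>
    define K where "K = real (2 * j)"
    have K: "K \<ge> 1" "K > 0" using j by (auto simp: K_def)
    have EK: "E / K < d" "E / K \<le> E" "E / K \<ge> 0"
    proof -
      have "E / d < K" using j by (simp add: K_def)
      then show "E / K < d" using d K by (simp add: field_simps)
      show "E / K \<le> E" using K mult_left_mono[OF K(1) E] by (simp add: field_simps)
      show "E / K \<ge> 0" using K E by simp
    qed
    have \<psi>Q: "\<bar>\<psi> K t\<bar> powr Q \<le> \<bar>A\<bar> powr Q * \<eta> t powr Q + \<delta>" for t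
    proof -
      have le: "\<bar>A\<bar> * \<eta> t \<le> \<bar>A\<bar> * 1" "\<bar>A\<bar> * \<eta> t \<ge> 0"
        using mult_left_mono[OF \<eta>(5)[of t], of "\<bar>A\<bar>"] \<eta>(4)[of t] by simp_all
      have "\<bar>\<psi> K t\<bar> powr Q \<le> (\<bar>A\<bar> * \<eta> t + E / K) powr Q" using \<psi>[OF K(1)] Q by (intro powr_mono2) auto
      also have "\<dots> \<le> (\<bar>A\<bar> * \<eta> t) powr Q + \<delta>"
      proof -
        have "\<bar>(\<bar>A\<bar> * \<eta> t + E / K) powr Q - (\<bar>A\<bar> * \<eta> t) powr Q\<bar> < \<delta>"
        proof (rule d(2))
          show "\<bar>\<bar>A\<bar> * \<eta> t + E / K - \<bar>A\<bar> * \<eta> t\<bar> < d"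
            using EK by (simp only: add_diff_cancel_left' abs_of_nonneg)
        qed (use le EK E in auto)
        then show ?thesis by linarith
      qed
      finally show ?thesis using \<eta>(4) by (simp add: powr_mult)
    qed
    have [measurable]: "V K \<in> borel_measurable borel" "F K \<in> borel_measurable borel"
      using cont(1,2)[OF K(2)] by (auto intro: borel_measurable_continuous_onI)
    obtain R where R: "\<And>x. norm x > R \<Longrightarrow> V K x = 0" "\<And>x. norm x > R \<Longrightarrow> F K x = 0" using cont(3)[OF K(2)] by blast
    have iV: "integrable lborel (\<lambda>x. \<bar>V K x\<bar> powr Q)"
      using R Q by (intro integrable_compact_support[where R = R] continuous_on_powr' continuous_on_const continuous_on_rabs cont K) auto
    have iF: "integrable lborel (\<lambda>x. \<bar>F K x\<bar> powr Q)"
      using R Q by (intro integrable_compact_support[where R = R] continuous_on_powr' continuous_on_const continuous_on_rabs cont K) auto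
    define I where "I = (\<integral>x. \<bar>V K x\<bar> powr Q \<partial>lborel)"
    have I: "(\<integral>\<^sup>+x. ennreal (\<bar>V K x\<bar> powr Q) \<partial>lborel) = ennreal I"
      unfolding I_def using iV by (intro nn_integral_eq_integral) auto
    have I0: "I \<ge> 0" by (simp add: I_def)
    have lower: "c1 powr Q * (real j * s0) \<le> I"
    proof -
      have "ennreal (c1 powr Q) * shell_mass w 0 (real j) = (\<integral>\<^sup>+x. ennreal (c1 powr Q) * (ennreal (w x) * indicator (shell 0 (real j)) x) \<partial>lborel)"
        unfolding shell_mass_def by (rule nn_integral_cmult[symmetric]) measurable
      also have "\<dots> \<le> (\<integral>\<^sup>+x. ennreal (\<bar>V K x\<bar> powr Q) \<partial>lborel)"
      proof (rule nn_integral_mono)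
        fix x
        show "ennreal (c1 powr Q) * (ennreal (w x) * indicator (shell 0 (real j)) x) \<le> ennreal (\<bar>V K x\<bar> powr Q)"
        proof (cases "x \<in> shell 0 (real j)")
          case True
          then have x: "x \<noteq> 0" "0 \<le> 2 * ln (norm x)" "2 * ln (norm x) \<le> real j" by (auto simp: shell_def)
          then have "\<bar>2 * ln (norm x) / K\<bar> \<le> 1/2" using j by (simp add: K_def field_simps)
          then have "c1 \<le> \<bar>\<eta> (2 * ln (norm x) / K)\<bar>" by (rule order_trans[OF \<eta>(7) abs_ge_self])
          then have "c1 powr Q \<le> \<bar>\<eta> (2 * ln (norm x) / K)\<bar> powr Q" using \<eta>(6) Q by (intro powr_mono2) auto
          then have "c1 powr Q * w x \<le> \<bar>V K x\<bar> powr Q"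
            unfolding V[OF x(1)] pw using w0 by (simp add: mult.commute mult_left_mono)
          then show ?thesis using True w0 by (simp add: ennreal_mult[symmetric] ennreal_leI)
        qed simp
      qed
      also have "\<dots> = ennreal I" by (rule I)
      also have "shell_mass w 0 (real j) = of_nat j * S0" using shell_mass_nat[OF _ hom, of 0 j] by (simp add: S0_def)
      also have "ennreal (c1 powr Q) * (of_nat j * S0) = ennreal (c1 powr Q * (real j * s0))"
        using s0 by (simp add: ennreal_mult ennreal_of_nat_eq_real_of_nat)
      finally show ?thesis using I0 by (simp add: ennreal_le_iff)
    qed
    have "(\<integral>\<^sup>+x. ennreal (\<bar>F K x\<bar> powr Q) \<partial>lborel)
      \<le> (\<integral>\<^sup>+x. ennreal (\<bar>A\<bar> powr Q) * ennreal (\<bar>V K x\<bar> powr Q) + ennreal \<delta> * (ennreal (w x) * indicator (shell (- real (2 * j)) (real (2 * j + 1))) x) \<partial>lborel)"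
    proof (rule nn_integral_mono_AE)
      show "AE x in lborel. ennreal (\<bar>F K x\<bar> powr Q) \<le> ennreal (\<bar>A\<bar> powr Q) * ennreal (\<bar>V K x\<bar> powr Q)
         + ennreal \<delta> * (ennreal (w x) * indicator (shell (- real (2 * j)) (real (2 * j + 1))) x)"
        using AE0
      proof eventually_elim
        case (elim x)
        let ?t = "2 * ln (norm x) / K"
        show ?case
        proof (cases "\<bar>?t\<bar> > 1")
          case True
          then have "F K x = 0" using F[OF elim K(2)] \<psi>0 by simp
          then show ?thesis by simp
        next
          case False
          then have "\<bar>2 * ln (norm x)\<bar> \<le> K" using K by (simp add: abs_divide field_simps)
          \<comment> \<open>The upper end is \<open>2j + 1\<close> because shells are half-open and
            the sphere \<open>2 ln |x| = K\<close> has to be included.\<close>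
          then have "x \<in> shell (- real (2 * j)) (real (2 * j + 1))" using elim by (auto simp: shell_def K_def abs_le_iff)
          moreover have "\<bar>F K x\<bar> powr Q \<le> \<bar>A\<bar> powr Q * \<bar>V K x\<bar> powr Q + \<delta> * w x"
          proof -
            have "\<bar>F K x\<bar> powr Q = w x * \<bar>\<psi> K ?t\<bar> powr Q" unfolding F[OF elim K(2)] pw ..
            also have "\<dots> \<le> w x * (\<bar>A\<bar> powr Q * \<eta> ?t powr Q + \<delta>)" using w0 by (intro mult_left_mono \<psi>Q)
            also have "\<dots> = \<bar>A\<bar> powr Q * (w x * \<bar>\<eta> ?t\<bar> powr Q) + \<delta> * w x" using \<eta>(4)[of ?t] by (simp add: algebra_simps)
            also have "w x * \<bar>\<eta> ?t\<bar> powr Q = \<bar>V K x\<bar> powr Q" unfolding V[OF elim] pw ..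
            finally show ?thesis .
          qed
          moreover have "ennreal (\<bar>A\<bar> powr Q * \<bar>V K x\<bar> powr Q + \<delta> * w x)
              = ennreal (\<bar>A\<bar> powr Q) * ennreal (\<bar>V K x\<bar> powr Q) + ennreal \<delta> * ennreal (w x)"
            using \<delta> w0 by (intro ennreal_lincomb) auto
          ultimately show ?thesis using ennreal_leI by fastforce
        qed
      qed
    qed
    also have "\<dots> = ennreal (\<bar>A\<bar> powr Q) * (\<integral>\<^sup>+x. ennreal (\<bar>V K x\<bar> powr Q) \<partial>lborel)
       + ennreal \<delta> * shell_mass w (- real (2 * j)) (real (2 * j + 1))"
      unfolding shell_mass_def by (rule nn_integral_lincomb) measurable
    also have "\<dots> = ennreal (\<bar>A\<bar> powr Q) * ennreal I + ennreal \<delta> * ennreal (real (4 * j + 1) * s0)"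
      using shell_mass_from_neg[OF _ hom, of "2 * j" "2 * j + 1"] s0 unfolding I
      by (simp add: S0_def[symmetric] ennreal_mult ennreal_of_nat_eq_real_of_nat)
    also have "\<dots> = ennreal (\<bar>A\<bar> powr Q * I + \<delta> * (real (4 * j + 1) * s0))"
      using \<delta> s0 I0 by (intro ennreal_lincomb[symmetric]) auto
    finally have "ennreal (\<integral>x. \<bar>F K x\<bar> powr Q \<partial>lborel) \<le> ennreal (\<bar>A\<bar> powr Q * I + \<delta> * (real (4 * j + 1) * s0))"
      using iF by (subst (asm) nn_integral_eq_integral) auto
    then have up: "(\<integral>x. \<bar>F K x\<bar> powr Q \<partial>lborel) \<le> \<bar>A\<bar> powr Q * I + \<delta> * (real (4 * j + 1) * s0)"
      using \<delta> s0 I0 by (subst (asm) ennreal_le_iff) auto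
    have Ip: "I > 0"
    proof -
      have "c1 powr Q * (real j * s0) > 0" using c1Q j s0p by simp
      then show ?thesis using lower by linarith
    qed
    have "real (4 * j + 1) \<le> 5 * real j" using j by simp
    from mult_right_mono[OF this s0(1)] have "real (4 * j + 1) * s0 \<le> 5 * (real j * s0)" by (simp add: mult.assoc)
    then have "\<delta> * (real (4 * j + 1) * s0) \<le> \<delta> * (5 * (real j * s0))" using \<delta> by (intro mult_left_mono) auto
    also have "\<dots> = (C powr Q - \<bar>A\<bar> powr Q) / 2 * (c1 powr Q * (real j * s0))" by (simp add: \<delta>_def)
    also have "\<dots> \<le> (C powr Q - \<bar>A\<bar> powr Q) / 2 * I" using CQ lower by (intro mult_left_mono) auto
    also have "\<dots> < (C powr Q - \<bar>A\<bar> powr Q) * I" using CQ Ip by simp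
    finally have "\<delta> * (real (4 * j + 1) * s0) < (C powr Q - \<bar>A\<bar> powr Q) * I" .
    then have "(\<integral>x. \<bar>F K x\<bar> powr Q \<partial>lborel) < C powr Q * I" using up by (simp add: algebra_simps)
    then have "(\<integral>x. \<bar>F K x\<bar> powr Q \<partial>lborel) powr (1/Q) < (C powr Q * I) powr (1/Q)"
      using Q by (intro powr_less_mono2) auto
    also have "(C powr Q * I) powr (1/Q) = C * I powr (1/Q)" using Q AC I0 by (simp add: powr_mult powr_powr)
    finally have "Lp_norm p (F K) < C * Lp_norm p (V K)" using False by (simp add: Lp_norm_def I_def Q_def)
    then show ?thesis using K by blast
  qed
  then obtain K where K: "K > 0" "Lp_norm p (F K) < C * Lp_norm p (V K)" by blast
  then show ?thesis using tu[OF K(1)] unfolding F_def V_def by blast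
qed

section \<open>The exact constant and the weighted inequality\<close>

lemma newton_eq:
  assumes "CARD('n::finite) \<ge> 3"
  shows "newton (z::real^'n) = norm z powr (2 - real CARD('n)) / (2 - real CARD('n))"
proof (cases "z = 0")
  case False
  have "((norm z)\<^sup>2) powr (1 - real CARD('n)/2) = norm z powr (2 * (1 - real CARD('n)/2))"
    using False powr_powr[of "norm z" 2 "1 - real CARD('n)/2"] by simp
  also have "2 * (1 - real CARD('n)/2) = 2 - real CARD('n)" by simp
  finally show ?thesis using assms by (simp add: newton_def newton_profile_def)
qed (use assms in \<open>simp add: newton_def newton_profile_def\<close>)

text \<open>In the two outer regions \<open>|x - y|\<close> is at least 3/4 of the larger norm,
  whence the constant. Near the diagonal the bound is an identity multiplied by a constant that is
  at least 1.\<close>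

lemma newton_kbound:
  assumes N3: "CARD('n::finite) \<ge> 3"
  defines "N \<equiv> real CARD('n)"
  shows "kernel_bound 0 (2 - N) (N - 2) ((3/4) powr (2 - N)) (\<lambda>x y::real^'n. norm (x - y) powr (2 - N))"
  unfolding kernel_bound_def N_def[symmetric]
proof (intro allI impI conjI)
  have N: "2 - N < 0" using N3 by (simp add: N_def)
  fix x y :: "real^'n" assume nz: "x \<noteq> 0" "y \<noteq> 0" "x \<noteq> y"
  { assume "norm y \<le> norm x / 4"
    then have "3/4 * norm x \<le> norm (x - y)" using norm_triangle_ineq2[of x y] by linarith
    then have "norm (x - y) powr (2 - N) \<le> (3/4 * norm x) powr (2 - N)" using nz N by (intro powr_mono2') auto
    then show "norm (x - y) powr (2 - N) \<le> (3/4) powr (2 - N) * (norm x powr (2 - N) * (norm y / norm x) powr 0)"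
      using nz by (simp add: powr_mult[symmetric] powr_zero_eq_one) }
  { assume "4 * norm x \<le> norm y"
    then have "3/4 * norm y \<le> norm (x - y)" using norm_triangle_ineq2[of y x] by (simp add: norm_minus_commute)
    then have "norm (x - y) powr (2 - N) \<le> (3/4 * norm y) powr (2 - N)" using nz N by (intro powr_mono2') auto
    also have "\<dots> = (3/4) powr (2 - N) * norm y powr (2 - N)" by (rule powr_mult)
    also have "norm y powr (2 - N) = norm x powr (2 - N) * (norm y / norm x) powr (2 - N)"
      using powr_ratio[of "norm x" "norm y" "2 - N" "2 - N"] nz by simp
    finally show "norm (x - y) powr (2 - N) \<le> (3/4) powr (2 - N) * (norm x powr (2 - N) * (norm y / norm x) powr (2 - N))" . }
  { have "norm x powr (2 - N) * (norm (x - y) / norm x) powr (- (N - 2)) = norm (x - y) powr (2 - N)"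
      using powr_ratio[of "norm x" "norm (x - y)" "2 - N" "- (N - 2)"] nz by simp
    moreover have "1 powr (2 - N) \<le> (3/4::real) powr (2 - N)" using N by (intro powr_mono2') auto
    ultimately show "norm (x - y) powr (2 - N) \<le> (3/4) powr (2 - N) * (norm x powr (2 - N) * (norm (x - y) / norm x) powr (- (N - 2)))"
      using mult_right_mono[of 1 "(3/4) powr (2 - N)" "norm (x - y) powr (2 - N)"] by simp }
qed

text \<open>The exact value comes from letting \<open>K \<rightarrow> \<infinity>\<close> in the representation formula
  for \<open>|x|^(2 - \<beta>) \<eta>(ln |x|\<^sup>2 / K)\<close>.\<close>

theorem newton_weight_integral:
  fixes x :: "real^'n::finite"
  assumes N3: "CARD('n) \<ge> 3" and x: "x \<noteq> 0"
  defines "N \<equiv> real CARD('n)"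
  assumes \<beta>: "2 < \<beta>" "\<beta> < N"
    and rep: "\<And>u::real^'n \<Rightarrow> real. test_fun u \<Longrightarrow> (\<integral>y. newton (x - y) * laplacian u y \<partial>lborel) = c * u x"
  shows "(\<integral>\<^sup>+y. ennreal (norm (x - y) powr (2 - N) * norm y powr (- \<beta>)) \<partial>lborel)
    = ennreal (c * (N - 2) / ((\<beta> - 2) * (N - \<beta>)) * norm x powr (2 - \<beta>))"
proof -
  have N: "N > 2" using N3 by (simp add: N_def)
  define q where "q = (\<lambda>y. norm (x - y) powr (2 - N) * norm y powr (- \<beta>))"
  have [measurable]: "q \<in> borel_measurable borel" unfolding q_def by measurable
  \<comment> \<open>The rough kernel bound makes \<open>q\<close> integrable, so that a multiple of
    \<open>q\<close> can serve as majorant in the limit.\<close>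
  obtain M where M: "(\<integral>\<^sup>+y. ennreal (q y) \<partial>lborel) \<le> ennreal (M * norm x powr (2 - \<beta>))"
    using kernel_bound_integral[OF newton_kbound[OF N3], of \<beta>] \<beta> N x unfolding N_def q_def by auto
  have iq: "integrable lborel q"
    by (rule integrableI_nonneg) (use M in \<open>auto simp: q_def intro: le_less_trans\<close>)
  obtain \<eta> where \<eta>: "smooth1 \<eta>" "supp1 \<eta>" "\<eta> 0 = 1" "\<And>t. 0 \<le> \<eta> t" "\<And>t. \<eta> t \<le> 1"
    using exists_bump by blast
  obtain D1 where D1: "D1 \<ge> 0" "\<And>t. \<bar>deriv \<eta> t\<bar> \<le> D1"
    using smooth1_bounded[OF smooth1_deriv[OF \<eta>(1)] supp1_deriv[OF \<eta>(2)]] by blast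
  obtain D2 where D2: "D2 \<ge> 0" "\<And>t. \<bar>deriv (deriv \<eta>) t\<bar> \<le> D2"
    using smooth1_bounded[OF smooth1_deriv[OF smooth1_deriv[OF \<eta>(1)]] supp1_deriv[OF supp1_deriv[OF \<eta>(2)]]] by blast
  \<comment> \<open>Without cutoff the function is \<open>|y|^(2-\<beta>)\<close>, and
    \<open>A\<close> is the factor in \<open>\<Delta> |y|^(2-\<beta>) = A |y|^(-\<beta>)\<close>,
    negative in the given range.\<close>
  define b where "b = (2 - \<beta>) / 2"
  define A where "A = (2 - \<beta>) * (N - \<beta>)"
  have A: "4 * b\<^sup>2 + (2 * N - 4) * b = A" by (simp add: A_def b_def power2_eq_square field_simps)
  have A0: "A < 0" using \<beta> by (simp add: A_def mult_neg_pos)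
  define B where "B = 8 * b + 2 * N - 4"
  define K where "K k = real (Suc k)" for k
  have K: "K k \<ge> 1" "K k > 0" for k by (simp_all add: K_def)
  have Kinv: "(\<lambda>k. 1 / K k) \<longlonglongrightarrow> 0" unfolding K_def using LIMSEQ_inverse_real_of_nat by (simp add: inverse_eq_divide)
  define \<psi> where "\<psi> k t = A * \<eta> t + B / K k * deriv \<eta> t + 4 / (K k)\<^sup>2 * deriv (deriv \<eta>) t" for k t
  define u where "u k = test_family (\<lambda>_::real^'n. 1) b \<eta> (K k)" for k
  have tu: "test_fun (u k)" for k unfolding u_def by (rule test_family_test[OF harmonic_hom_const K(2) \<eta>(1,2)])
  have pb: "(norm y)\<^sup>2 powr (b - s) = norm y powr (2 - \<beta> - 2 * s)" if "y \<noteq> 0" for y :: "real^'n" and s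
  proof -
    have "(norm y)\<^sup>2 powr (b - s) = norm y powr (2 * (b - s))" using that powr_powr[of "norm y" 2 "b - s"] by simp
    also have "2 * (b - s) = 2 - \<beta> - 2 * s" by (simp add: b_def)
    finally show ?thesis .
  qed
  have lap: "newton (x - y) * laplacian (u k) y = 1 / (2 - N) * (q y * \<psi> k (2 * ln (norm y) / K k))" if y: "y \<noteq> 0" for y k
    using test_family_laplacian[OF harmonic_hom_const K(2) \<eta>(1,2) y, of b k] pb[OF y, of 1] y
    by (simp add: u_def newton_eq[OF N3] q_def \<psi>_def A[unfolded N_def] B_def N_def ln_realpow)
  have ux: "u k x = norm x powr (2 - \<beta>) * \<eta> (2 * ln (norm x) / K k)" for k
    using pb[OF x, of 0] x by (simp add: u_def test_family_def log_cutoff_def ln_realpow)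
  have arg0: "(\<lambda>k. \<eta> (l / K k)) \<longlonglongrightarrow> 1" for l
  proof -
    have "(\<lambda>k. l * (1 / K k)) \<longlonglongrightarrow> l * 0" by (intro tendsto_mult tendsto_const Kinv)
    then have "(\<lambda>k. l / K k) \<longlonglongrightarrow> 0" by simp
    moreover have "isCont \<eta> 0" using smooth1_has_deriv[OF \<eta>(1)] DERIV_isCont by blast
    ultimately show ?thesis using isCont_tendsto_compose[of 0 \<eta>] \<eta>(3) by fastforce
  qed
  define E where "E = \<bar>B\<bar> * D1 + 4 * D2"
  have err: "\<bar>\<psi> k t - A * \<eta> t\<bar> \<le> E * (1 / K k)" for k t
    using error_bound[OF K(1) D1(2) D2(2), of B k t t] by (simp add: \<psi>_def E_def add.assoc)
  have E: "E \<ge> 0" using D1(1) D2(1) by (simp add: E_def)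
  have \<psi>lim: "(\<lambda>k. \<psi> k (l / K k)) \<longlonglongrightarrow> A" for l
  proof -
    have "(\<lambda>k. E * (1 / K k)) \<longlonglongrightarrow> E * 0" by (intro tendsto_mult tendsto_const Kinv)
    then have g: "(\<lambda>k. E * (1 / K k)) \<longlonglongrightarrow> 0" by simp
    have "(\<lambda>k. \<psi> k (l / K k) - A * \<eta> (l / K k)) \<longlonglongrightarrow> 0"
      by (rule Lim_null_comparison[OF _ g]) (use err in auto)
    from tendsto_add[OF this tendsto_mult[OF tendsto_const[of A] arg0[of l]]]
    show ?thesis by simp
  qed
  have \<psi>bd: "\<bar>\<psi> k t\<bar> \<le> \<bar>A\<bar> + E" for k t
  proof -
    have "E * (1 / K k) \<le> E * 1" using K[of k] E by (intro mult_left_mono) auto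
    moreover have "\<bar>A * \<eta> t\<bar> \<le> \<bar>A\<bar> * 1" unfolding abs_mult using \<eta>(4,5)[of t] by (intro mult_left_mono) auto
    ultimately show ?thesis using err[of k t] by linarith
  qed
  have q0: "q y \<ge> 0" for y by (simp add: q_def)
  have AE0: "AE y in lborel. y \<noteq> (0::real^'n)" by (rule AE_lborel_singleton)
  have "(\<lambda>k. \<integral>y. newton (x - y) * laplacian (u k) y \<partial>lborel) \<longlonglongrightarrow> (\<integral>y. 1 / (2 - N) * (q y * A) \<partial>lborel)"
  proof (rule integral_dominated_convergence)
    show "integrable lborel (\<lambda>y. (\<bar>A\<bar> + E) / (N - 2) * q y)" by (intro integrable_mult_right iq)
    have [measurable]: "laplacian (u k) \<in> borel_measurable borel" for k
      by (rule borel_measurable_continuous_onI[OF laplacian_compact(3)[OF tu]])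
    show "(\<lambda>y. newton (x - y) * laplacian (u k) y) \<in> borel_measurable lborel" for k by measurable
    show "AE y in lborel. (\<lambda>k. newton (x - y) * laplacian (u k) y) \<longlonglongrightarrow> 1 / (2 - N) * (q y * A)"
      using AE0
    proof eventually_elim
      case (elim y)
      show ?case unfolding lap[OF elim] by (intro tendsto_mult tendsto_const \<psi>lim)
    qed
    show "AE y in lborel. norm (newton (x - y) * laplacian (u k) y) \<le> (\<bar>A\<bar> + E) / (N - 2) * q y" for k
      using AE0
    proof eventually_elim
      case (elim y)
      have "norm (newton (x - y) * laplacian (u k) y) = 1 / (N - 2) * (q y * \<bar>\<psi> k (2 * ln (norm y) / K k)\<bar>)"
        unfolding lap[OF elim] using N q0[of y] by (simp add: abs_mult abs_divide)
      also have "\<dots> \<le> 1 / (N - 2) * (q y * (\<bar>A\<bar> + E))"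
        using N q0 by (intro mult_left_mono \<psi>bd) auto
      finally show ?case by (simp add: mult_ac)
    qed
  qed measurable
  moreover have "(\<lambda>k. \<integral>y. newton (x - y) * laplacian (u k) y \<partial>lborel) \<longlonglongrightarrow> c * (norm x powr (2 - \<beta>) * 1)"
    unfolding rep[OF tu] ux by (intro tendsto_mult tendsto_const arg0)
  ultimately have "(\<integral>y. 1 / (2 - N) * (q y * A) \<partial>lborel) = c * (norm x powr (2 - \<beta>) * 1)" by (rule LIMSEQ_unique)
  then have "1 / (2 - N) * ((\<integral>y. q y \<partial>lborel) * A) = c * norm x powr (2 - \<beta>)" by simp
  then have "(\<integral>y. q y \<partial>lborel) * A = c * norm x powr (2 - \<beta>) * (2 - N)" using N by (simp add: field_simps)
  then have "(\<integral>y. q y \<partial>lborel) = c * norm x powr (2 - \<beta>) * (2 - N) / A" using A0 by (simp add: eq_divide_eq)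
  also have "\<dots> = c * (N - 2) / ((\<beta> - 2) * (N - \<beta>)) * norm x powr (2 - \<beta>)"
  proof -
    have "(2 - N) / A = (N - 2) / ((\<beta> - 2) * (N - \<beta>))"
    proof -
      have "A = - ((\<beta> - 2) * (N - \<beta>))" by (simp add: A_def algebra_simps)
      moreover have "2 - N = - (N - 2)" by simp
      ultimately show ?thesis by (simp only: minus_divide_divide)
    qed
    then show ?thesis by (metis (no_types, lifting) mult.commute mult.left_commute times_divide_eq_right)
  qed
  finally have "(\<integral>y. q y \<partial>lborel) = c * (N - 2) / ((\<beta> - 2) * (N - \<beta>)) * norm x powr (2 - \<beta>)" .
  then show ?thesis using nn_integral_eq_integral[OF iq] q0 by (simp add: q_def)
qed

text \<open>The second bound is the first one for the transposed kernel with \<beta> replaced by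
  \<open>N + 2 - \<beta>\<close>. The reflected window is again the condition that \<beta> - N lies
  between \<open>t\<close> and \<open>s\<close>.\<close>

lemma kernel_bound_pair:
  fixes K :: "real^'n::finite \<Rightarrow> real^'n \<Rightarrow> real"
  assumes K: "kernel_bound s t \<sigma> A K" and A: "A \<ge> 0"
  defines "N \<equiv> real CARD('n)"
  assumes st: "t < \<beta> - N" "\<beta> - N < s" and \<sigma>: "\<sigma> < N"
  shows "\<exists>M>0. (\<forall>x. x \<noteq> 0 \<longrightarrow> (\<integral>\<^sup>+y. ennreal (K x y * norm y powr (-\<beta>)) \<partial>lborel) \<le> ennreal (M * norm x powr (2 - \<beta>)))
    \<and> (\<forall>y. y \<noteq> 0 \<longrightarrow> (\<integral>\<^sup>+x. ennreal (K x y * norm x powr (\<beta> - N - 2)) \<partial>lborel) \<le> ennreal (M * norm y powr (\<beta> - N)))"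
proof -
  obtain M1 where M1: "M1 > 0" "\<And>x. x \<noteq> 0 \<Longrightarrow> (\<integral>\<^sup>+y. ennreal (K x y * norm y powr (-\<beta>)) \<partial>lborel) \<le> ennreal (M1 * norm x powr (2 - \<beta>))"
    using kernel_bound_integral[OF K A, of \<beta>] st \<sigma> unfolding N_def by blast
  let ?\<gamma> = "2 - (\<beta> - N)"
  have "?\<gamma> - N < 2 - N - t" "2 - N - s < ?\<gamma> - N" using st by auto
  then obtain M2 where M2: "M2 > 0" "\<And>y. y \<noteq> 0 \<Longrightarrow> (\<integral>\<^sup>+x. ennreal (K x y * norm x powr (- ?\<gamma>)) \<partial>lborel) \<le> ennreal (M2 * norm y powr (2 - ?\<gamma>))"
    using kernel_bound_integral[OF kernel_bound_transpose[OF K A], of ?\<gamma>] A \<sigma> unfolding N_def by (auto simp del: minus_diff_eq)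
  have e: "- ?\<gamma> = \<beta> - N - 2" "2 - ?\<gamma> = \<beta> - N" by simp_all
  define M where "M = max M1 M2"
  have up: "ennreal (M1 * norm x powr q) \<le> ennreal (M * norm x powr q)" "ennreal (M2 * norm x powr q) \<le> ennreal (M * norm x powr q)" for x :: "real^'n" and q
    by (auto simp: M_def intro!: ennreal_leI mult_right_mono)
  show ?thesis
  proof (intro exI[of _ M] conjI allI impI)
    show "M > 0" using M1(1) by (simp add: M_def)
    show "(\<integral>\<^sup>+y. ennreal (K x y * norm y powr (-\<beta>)) \<partial>lborel) \<le> ennreal (M * norm x powr (2 - \<beta>))" if "x \<noteq> 0" for x
      by (rule order_trans[OF M1(2)[OF that] up(1)])
    show "(\<integral>\<^sup>+x. ennreal (K x y * norm x powr (\<beta> - N - 2)) \<partial>lborel) \<le> ennreal (M * norm y powr (\<beta> - N))" if "y \<noteq> 0" for y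
      using order_trans[OF M2(2)[OF that] up(2)] unfolding e .
  qed
qed

text \<open>Both weight integrals equal \<open>c / C0\<close> times a power, because \<beta> and
  \<open>N + 2 - \<beta>\<close> give the same product \<open>(\<beta> - 2) (N - \<beta>)\<close>.
  So the Schur bound is \<open>c / C0\<close>, and \<open>c\<close> cancels against the
  representation formula.\<close>

theorem rellich_best_constant:
  fixes p :: ennreal and \<alpha> :: real
  defines "N \<equiv> real CARD('n::finite)"
  assumes N3: "CARD('n) \<ge> 3" and p: "1 \<le> p" and \<alpha>: "2 - N * inv_exp p < \<alpha>" "\<alpha> < N * (1 - inv_exp p)"
    and u: "test_fun (u :: real^'n \<Rightarrow> real)"
  shows "(N * inv_exp p - 2 + \<alpha>) * (N * (1 - inv_exp p) - \<alpha>) * Lp_norm p (\<lambda>x. norm x powr (\<alpha> - 2) * u x)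
    \<le> Lp_norm p (\<lambda>x. norm x powr \<alpha> * laplacian u x)"
proof -
  have N: "N > 2" using N3 by (simp add: N_def)
  have N2: "CARD('n) \<ge> 2" using N3 by simp
  obtain c where c: "c > 0" "\<And>(u :: real^'n \<Rightarrow> real) x. test_fun u \<Longrightarrow> integrable lborel (\<lambda>y. newton (x - y) * laplacian u y)"
    "\<And>(u :: real^'n \<Rightarrow> real) x. test_fun u \<Longrightarrow> (\<integral>y. newton (x - y) * laplacian u y \<partial>lborel) = c * u x"
    using newton_representation[OF N2] by blast
  define \<beta> where "\<beta> = \<alpha> + N * inv_exp p"
  have \<beta>: "2 < \<beta>" "\<beta> < N" using \<alpha> by (auto simp: \<beta>_def algebra_simps)
  define C0 where "C0 = (\<beta> - 2) * (N - \<beta>)"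
  have C0: "C0 > 0" using \<beta> by (simp add: C0_def)
  define K where "K x y = norm (x - y) powr (2 - N) / (N - 2)" for x y :: "real^'n"
  have int: "(\<integral>\<^sup>+y. ennreal (K x y * norm y powr (- \<gamma>)) \<partial>lborel) = ennreal (c / C0 * norm x powr (2 - \<gamma>))"
    if x: "x \<noteq> 0" and \<gamma>: "2 < \<gamma>" "\<gamma> < N" "(\<gamma> - 2) * (N - \<gamma>) = C0" for x \<gamma>
  proof -
    have "(\<integral>\<^sup>+y. ennreal (K x y * norm y powr (- \<gamma>)) \<partial>lborel)
      = (\<integral>\<^sup>+y. ennreal (1 / (N - 2)) * ennreal (norm (x - y) powr (2 - N) * norm y powr (- \<gamma>)) \<partial>lborel)"
      using N by (intro nn_integral_cong) (simp add: K_def ennreal_mult[symmetric])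
    also have "\<dots> = ennreal (1 / (N - 2)) * (\<integral>\<^sup>+y. ennreal (norm (x - y) powr (2 - N) * norm y powr (- \<gamma>)) \<partial>lborel)"
      by (rule nn_integral_cmult) measurable
    also have "\<dots> = ennreal (1 / (N - 2)) * ennreal (c * (N - 2) / C0 * norm x powr (2 - \<gamma>))"
      using newton_weight_integral[OF N3 x \<gamma>(1) \<gamma>(2)[unfolded N_def] c(3), folded N_def] \<gamma>(3) by simp
    also have "\<dots> = ennreal (1 / (N - 2) * (c * (N - 2) / C0 * norm x powr (2 - \<gamma>)))"
      using N c(1) C0 by (intro ennreal_mult[symmetric]) auto
    also have "1 / (N - 2) * (c * (N - 2) / C0 * norm x powr (2 - \<gamma>)) = c / C0 * norm x powr (2 - \<gamma>)"
    proof -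
      have "1 / m * (c * m / C0 * X) = c / C0 * X" if "m \<noteq> 0" for m X :: real using that by simp
      then show ?thesis using N by simp
    qed
    finally show ?thesis .
  qed
  have "c * Lp_norm p (\<lambda>x. norm x powr (\<alpha> - 2) * u x) \<le> c / C0 * Lp_norm p (\<lambda>x. norm x powr \<alpha> * laplacian u x)"
  proof (rule rellich_from_kernel[OF p u c(1), where K = K and \<alpha> = \<alpha>, folded N_def, folded \<beta>_def])
    show "c / C0 > 0" using c(1) C0 by simp
    show "case_prod K \<in> borel_measurable (borel \<Otimes>\<^sub>M borel)" unfolding K_def by measurable
    show "K x y \<ge> 0" for x y using N by (simp add: K_def)
    show "(\<integral>\<^sup>+y. ennreal (K x y * norm y powr (- \<beta>)) \<partial>lborel) \<le> ennreal (c / C0 * norm x powr (2 - \<beta>))" if "x \<noteq> 0" for x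
      using int[OF that \<beta>] by (simp add: C0_def)
    show "(\<integral>\<^sup>+x. ennreal (K x y * norm x powr (\<beta> - N - 2)) \<partial>lborel) \<le> ennreal (c / C0 * norm y powr (\<beta> - N))" if "y \<noteq> 0" for y
    proof -
      have "(\<integral>\<^sup>+x. ennreal (K y x * norm x powr (- (N + 2 - \<beta>))) \<partial>lborel) = ennreal (c / C0 * norm y powr (2 - (N + 2 - \<beta>)))"
        using \<beta> by (intro int[OF that]) (simp_all add: C0_def algebra_simps)
      moreover have e: "- (N + 2 - \<beta>) = \<beta> - N - 2" "2 - (N + 2 - \<beta>) = \<beta> - N" by simp_all
      moreover have "K y = (\<lambda>x. K x y)" by (simp add: K_def norm_minus_commute fun_eq_iff)
      ultimately show ?thesis by (simp only: order_refl)
    qed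
    show "ennreal \<bar>c * u x\<bar> \<le> (\<integral>\<^sup>+y. ennreal (K x y * \<bar>laplacian u y\<bar>) \<partial>lborel)" if "x \<noteq> 0" for x
    proof -
      have "norm (newton (x - y) * laplacian u y) = K x y * \<bar>laplacian u y\<bar>" for y
        using N by (simp add: newton_eq[OF N3] K_def N_def abs_mult abs_divide)
      then show ?thesis using integral_norm_bound_ennreal[OF c(2)[OF u, of x]] by (simp add: c(3)[OF u])
    qed
  qed
  then have "C0 * Lp_norm p (\<lambda>x. norm x powr (\<alpha> - 2) * u x) \<le> Lp_norm p (\<lambda>x. norm x powr \<alpha> * laplacian u x)"
    using c(1) C0 by (simp add: field_simps)
  then show ?thesis by (simp add: C0_def \<beta>_def algebra_simps)
qed

theorem rellich_noncritical:
  fixes p :: ennreal and \<alpha> :: real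
  defines "N \<equiv> real CARD('n::finite)"
  assumes N2: "CARD('n) \<ge> 2" and p: "1 \<le> p"
    and nc: "\<And>n::nat. \<alpha> \<noteq> N * (1 - inv_exp p) + real n" "\<And>n::nat. \<alpha> \<noteq> - N * inv_exp p + 2 - real n"
  shows "\<exists>C>0. \<forall>u :: real^'n \<Rightarrow> real. test_fun u \<longrightarrow>
    C * Lp_norm p (\<lambda>x. norm x powr (\<alpha> - 2) * u x) \<le> Lp_norm p (\<lambda>x. norm x powr \<alpha> * laplacian u x)"
proof -
  have N: "N \<ge> 2" using N2 by (simp add: N_def)
  obtain c where c: "c > 0" "\<And>(u :: real^'n \<Rightarrow> real) x. test_fun u \<Longrightarrow> integrable lborel (\<lambda>y. newton (x - y) * laplacian u y)"
    "\<And>(u :: real^'n \<Rightarrow> real) x. test_fun u \<Longrightarrow> (\<integral>y. newton (x - y) * laplacian u y \<partial>lborel) = c * u x"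
    using newton_representation[OF N2] by blast
  define \<beta> where "\<beta> = \<alpha> + N * inv_exp p"
  define \<mu> where "\<mu> = \<beta> - N"
  have nc1: "\<mu> \<noteq> real n" and nc2: "\<mu> \<noteq> 2 - N - real n" for n :: nat
    using nc(1)[of n] nc(2)[of n] by (auto simp: \<mu>_def \<beta>_def algebra_simps)
  \<comment> \<open>Any nonnegative kernel that dominates the representation will do, provided \<mu>
    lies strictly between its orders at infinity and at 0.\<close>
  have from_kernel: ?thesis
    if K: "kernel_bound s t (sing_order N) A K" "A \<ge> 0" "t < \<mu>" "\<mu> < s"
      and m: "case_prod K \<in> borel_measurable (borel \<Otimes>\<^sub>M borel)" and K0: "\<And>x y. K x y \<ge> 0"
      and rep: "\<And>(u :: real^'n \<Rightarrow> real) x. test_fun u \<Longrightarrow> x \<noteq> 0 \<Longrightarrow> ennreal \<bar>c * u x\<bar> \<le> (\<integral>\<^sup>+y. ennreal (K x y * \<bar>laplacian u y\<bar>) \<partial>lborel)"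
    for s t A and K :: "real^'n \<Rightarrow> real^'n \<Rightarrow> real"
  proof -
    obtain M where M: "M > 0"
      "\<And>x. x \<noteq> 0 \<Longrightarrow> (\<integral>\<^sup>+y. ennreal (K x y * norm y powr (-\<beta>)) \<partial>lborel) \<le> ennreal (M * norm x powr (2 - \<beta>))"
      "\<And>y. y \<noteq> 0 \<Longrightarrow> (\<integral>\<^sup>+x. ennreal (K x y * norm x powr (\<beta> - N - 2)) \<partial>lborel) \<le> ennreal (M * norm y powr (\<beta> - N))"
      using kernel_bound_pair[OF K(1,2), of \<beta>, folded N_def] K(3,4) sing_order_less[OF N] unfolding \<mu>_def by blast
    have "c / M * Lp_norm p (\<lambda>x. norm x powr (\<alpha> - 2) * u x) \<le> Lp_norm p (\<lambda>x. norm x powr \<alpha> * laplacian u x)"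
      if u: "test_fun u" for u :: "real^'n \<Rightarrow> real"
    proof -
      have "c * Lp_norm p (\<lambda>x. norm x powr (\<alpha> - 2) * u x) \<le> M * Lp_norm p (\<lambda>x. norm x powr \<alpha> * laplacian u x)"
        by (rule rellich_from_kernel[OF p u c(1) M(1) m K0, where \<alpha> = \<alpha>, folded N_def, folded \<beta>_def, OF M(2,3) rep[OF u]])
      then show ?thesis using M(1) by (simp add: field_simps)
    qed
    then show ?thesis using c(1) M(1) by (intro exI[of _ "c / M"]) auto
  qed
  have meas1: "case_prod (\<lambda>x y::real^'n. \<bar>newton_rest m x y\<bar>) \<in> borel_measurable (borel \<Otimes>\<^sub>M borel)"
    and meas2: "case_prod (\<lambda>y x::real^'n. \<bar>newton_rest m x y\<bar>) \<in> borel_measurable (borel \<Otimes>\<^sub>M borel)" for m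
    by measurable
  consider "\<mu> > 0" | "\<mu> < 2 - N" | "2 - N < \<mu>" "\<mu> < 0" using nc1[of 0] nc2[of 0] by force
  then show ?thesis
  proof cases
    case 1
    define m where "m = nat \<lfloor>\<mu>\<rfloor>"
    have m: "real m < \<mu>" "\<mu> < real m + 1" using 1 nc1[of m] unfolding m_def by linarith+
    \<comment> \<open>Half the distance from \<open>m\<close> to \<mu>, which keeps the order
      \<open>m + \<delta>\<close> at infinity below \<mu>.\<close>
    define \<delta> where "\<delta> = (\<mu> - real m) / 2"
    have \<delta>: "\<delta> > 0" "real m + \<delta> < \<mu>" using m by (auto simp: \<delta>_def field_simps)
    obtain A where A: "A \<ge> 0" "kernel_bound (real m + 1) (real m + \<delta>) (sing_order N) A (\<lambda>x y::real^'n. \<bar>newton_rest m x y\<bar>)"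
      using newton_rest_kbound[OF N2 \<delta>(1), of m] unfolding N_def by blast
    show ?thesis
      by (rule from_kernel[OF A(2,1) \<delta>(2) m(2) meas1 _ newton_rest_right[OF N2 c(2) c(3)]]) auto
  next
    case 2
    \<comment> \<open>Transposition reflects the window: \<open>l\<close> between \<open>m\<close>
      and \<open>m + 1\<close> corresponds to \<mu> between \<open>1 - N - m\<close> and
      \<open>2 - N - m\<close>.\<close>
    define l where "l = 2 - N - \<mu>"
    have l: "l > 0" using 2 by (simp add: l_def)
    define m where "m = nat \<lfloor>l\<rfloor>"
    have "l \<noteq> real m" using nc2[of m] by (auto simp: l_def)
    then have m: "real m < l" "l < real m + 1" using l unfolding m_def by linarith+
    define \<delta> where "\<delta> = (l - real m) / 2"
    have \<delta>: "\<delta> > 0" "real m + \<delta> < l" using m by (auto simp: \<delta>_def field_simps)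
    obtain A where A: "A \<ge> 0" "kernel_bound (real m + 1) (real m + \<delta>) (sing_order N) A (\<lambda>x y::real^'n. \<bar>newton_rest m x y\<bar>)"
      using newton_rest_kbound[OF N2 \<delta>(1), of m] unfolding N_def by blast
    have T: "kernel_bound (2 - N - (real m + \<delta>)) (2 - N - (real m + 1)) (sing_order N) (A * 4 powr \<bar>2 - N + sing_order N\<bar>) (\<lambda>y x::real^'n. \<bar>newton_rest m x y\<bar>)"
      using kernel_bound_transpose[OF A(2,1)] unfolding N_def .
    show ?thesis
      by (rule from_kernel[OF T _ _ _ meas2 _ newton_rest_left[OF N2 c(2) c(3)]]) (use A m \<delta> in \<open>auto simp: l_def\<close>)
  next
    case 3
    \<comment> \<open>In dimension 2 the interval from \<open>2 - N\<close> to 0 is empty.\<close>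
    then have "CARD('n) \<ge> 3" using N2 by (cases "CARD('n) = 2") (auto simp: N_def)
    then have best: "(N * inv_exp p - 2 + \<alpha>) * (N * (1 - inv_exp p) - \<alpha>) * Lp_norm p (\<lambda>x. norm x powr (\<alpha> - 2) * u x)
        \<le> Lp_norm p (\<lambda>x. norm x powr \<alpha> * laplacian u x)"
      if "2 - N * inv_exp p < \<alpha>" "\<alpha> < N * (1 - inv_exp p)" "test_fun u" for u :: "real^'n \<Rightarrow> real"
      using rellich_best_constant[where 'n='n, OF _ p, of \<alpha> u] that unfolding N_def by blast
    have b: "2 - N * inv_exp p < \<alpha>" "\<alpha> < N * (1 - inv_exp p)" using 3 by (auto simp: \<mu>_def \<beta>_def algebra_simps)
    then have "(N * inv_exp p - 2 + \<alpha>) * (N * (1 - inv_exp p) - \<alpha>) > 0" by (intro mult_pos_pos) auto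
    then show ?thesis using best[OF b] by blast
  qed
qed

theorem mainTheorem3:
  fixes p :: ennreal and \<alpha> :: real
  defines "N \<equiv> real CARD('n::finite)"
  assumes "CARD('n) \<ge> 2" and "1 \<le> p"
  shows "((\<exists>C>0. \<forall>u :: real^'n \<Rightarrow> real. test_fun u \<longrightarrow>
             Lp_norm p (\<lambda>x. norm x powr \<alpha> * laplacian u x)
               \<ge> C * Lp_norm p (\<lambda>x. norm x powr (\<alpha> - 2) * u x))
          \<longleftrightarrow> (\<forall>n::nat. \<alpha> \<noteq> N * (1 - inv_exp p) + real n \<and>
                         \<alpha> \<noteq> - N * inv_exp p + 2 - real n))
       \<and> (CARD('n) \<ge> 3 \<and> 2 - N * inv_exp p < \<alpha> \<and> \<alpha> < N * (1 - inv_exp p) \<longrightarrow>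
            (let C0 = (N * inv_exp p - 2 + \<alpha>) * (N * (1 - inv_exp p) - \<alpha>) in
              (\<forall>u :: real^'n \<Rightarrow> real. test_fun u \<longrightarrow>
                  Lp_norm p (\<lambda>x. norm x powr \<alpha> * laplacian u x)
                    \<ge> C0 * Lp_norm p (\<lambda>x. norm x powr (\<alpha> - 2) * u x))
              \<and> (\<forall>C>C0. \<exists>u :: real^'n \<Rightarrow> real. test_fun u \<and>
                  Lp_norm p (\<lambda>x. norm x powr \<alpha> * laplacian u x)
                    < C * Lp_norm p (\<lambda>x. norm x powr (\<alpha> - 2) * u x))))"
proof -
  let ?ineq = "\<lambda>C (u :: real^'n \<Rightarrow> real). C * Lp_norm p (\<lambda>x. norm x powr (\<alpha> - 2) * u x)
    \<le> Lp_norm p (\<lambda>x. norm x powr \<alpha> * laplacian u x)"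
  \<comment> \<open>The two factors vanish at the two families of exceptional values; the limiting
    quotient is then 0, so every positive \<open>C\<close> is undercut by some test
    function.\<close>
  have crit: "\<not> (\<exists>C>0. \<forall>u. test_fun u \<longrightarrow> ?ineq C u)"
    if z: "(2 - \<alpha> - N * inv_exp p - real n) * (2 - \<alpha> - N * inv_exp p + real n + N - 2) = 0" for n
  proof
    assume "\<exists>C>0. \<forall>u. test_fun u \<longrightarrow> ?ineq C u"
    then obtain C where C: "C > 0" "\<And>u. test_fun u \<Longrightarrow> ?ineq C u" by blast
    have "\<bar>(2 - \<alpha> - N * inv_exp p - real n) * (2 - \<alpha> - N * inv_exp p + real n + N - 2)\<bar> < C"
      unfolding z using C(1) by simp
    from near_extremal[OF assms(2,3) this[unfolded N_def]] C(2) show False by (meson not_less)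
  qed
  have iff: "(\<exists>C>0. \<forall>u. test_fun u \<longrightarrow> ?ineq C u) \<longleftrightarrow>
    (\<forall>n::nat. \<alpha> \<noteq> N * (1 - inv_exp p) + real n \<and> \<alpha> \<noteq> - N * inv_exp p + 2 - real n)"
  proof
    assume ex: "\<exists>C>0. \<forall>u. test_fun u \<longrightarrow> ?ineq C u"
    show "\<forall>n::nat. \<alpha> \<noteq> N * (1 - inv_exp p) + real n \<and> \<alpha> \<noteq> - N * inv_exp p + 2 - real n"
    proof (intro allI conjI notI)
      fix n :: nat
      assume "\<alpha> = N * (1 - inv_exp p) + real n"
      then have "2 - \<alpha> - N * inv_exp p + real n + N - 2 = 0" by (simp add: algebra_simps)
      then show False using crit[of n] ex by simp
    next
      fix n :: nat
      assume "\<alpha> = - N * inv_exp p + 2 - real n"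
      then have "2 - \<alpha> - N * inv_exp p - real n = 0" by simp
      then show False using crit[of n] ex by simp
    qed
  next
    assume nc: "\<forall>n::nat. \<alpha> \<noteq> N * (1 - inv_exp p) + real n \<and> \<alpha> \<noteq> - N * inv_exp p + 2 - real n"
    show "\<exists>C>0. \<forall>u. test_fun u \<longrightarrow> ?ineq C u"
      using rellich_noncritical[where 'n='n, OF assms(2,3), of \<alpha>] nc unfolding N_def by blast
  qed
  have best: "let C0 = (N * inv_exp p - 2 + \<alpha>) * (N * (1 - inv_exp p) - \<alpha>) in
      (\<forall>u. test_fun u \<longrightarrow> ?ineq C0 u) \<and>
      (\<forall>C>C0. \<exists>u. test_fun u \<and> Lp_norm p (\<lambda>x. norm x powr \<alpha> * laplacian u x)
          < C * Lp_norm p (\<lambda>x. norm x powr (\<alpha> - 2) * (u :: real^'n \<Rightarrow> real) x))"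
    if h: "CARD('n) \<ge> 3" "2 - N * inv_exp p < \<alpha>" "\<alpha> < N * (1 - inv_exp p)"
    unfolding Let_def
  proof (intro conjI allI impI)
    fix u :: "real^'n \<Rightarrow> real" assume "test_fun u"
    then show "?ineq ((N * inv_exp p - 2 + \<alpha>) * (N * (1 - inv_exp p) - \<alpha>)) u"
      using rellich_best_constant[where 'n='n, OF h(1) assms(3)] h unfolding N_def by blast
  next
    fix C assume C: "C > (N * inv_exp p - 2 + \<alpha>) * (N * (1 - inv_exp p) - \<alpha>)"
    \<comment> \<open>For \<open>n = 0\<close> the product is the asserted constant up to sign, so
      no larger constant is admissible.\<close>
    have "(2 - \<alpha> - N * inv_exp p - real 0) * (2 - \<alpha> - N * inv_exp p + real 0 + N - 2)
        = - ((N * inv_exp p - 2 + \<alpha>) * (N * (1 - inv_exp p) - \<alpha>))"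
      by (simp add: algebra_simps)
    moreover have "(N * inv_exp p - 2 + \<alpha>) * (N * (1 - inv_exp p) - \<alpha>) > 0"
      using h by (intro mult_pos_pos) auto
    ultimately have "\<bar>(2 - \<alpha> - N * inv_exp p - real 0) * (2 - \<alpha> - N * inv_exp p + real 0 + N - 2)\<bar> < C"
      using C by linarith
    from near_extremal[OF assms(2,3) this[unfolded N_def]]
    show "\<exists>u. test_fun u \<and> Lp_norm p (\<lambda>x. norm x powr \<alpha> * laplacian u x)
          < C * Lp_norm p (\<lambda>x. norm x powr (\<alpha> - 2) * (u :: real^'n \<Rightarrow> real) x)" .
  qed
  show ?thesis using iff best by blast
qed

end
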